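(* Let $a>0$, let $q\in L^2(0,a)$ be complex-valued, and let $\alpha_0\ge0$, $\alpha>0$, $\beta_0,\beta\in\mathbb{C}$. Assume that $(\alpha_0-1)(1-\alpha)\ne0$, that $q(x)$ is known a priori a.e. on $(b,a)$ with $b\in(0,a)$, and that $\alpha$ and $\beta$ are known. Let $\mathbb{Z}_1=\mathbb{Z}\setminus\{0\}$ if $(\alpha_0-1)(1-\alpha)<0$ and $\mathbb{Z}_1=\mathbb{Z}$ if $(\alpha_0-1)(1-\alpha)>0$. Let $\{\lambda^+_{k_j^+}\}_{j\in\mathbb{Z}_1}$ and $\{\lambda^-_{k_j^-}\}_{j\in\mathbb{Z}_1}$ be subfamilies (with pairwise distinct indices $k_j^+$, respectively $k_j^-$) of the eigenvalues $\{\lambda_k^+\}_{k\in\mathbb{Z}_1}$ and $\{\lambda_k^-\}_{k\in\mathbb{Z}_1}$. If $\Omega_1:=\{\lambda^+_{k_j^+}\}_{j\in\mathbb{Z}_1}\cup\{\lambda^-_{k_j^-}\}_{j\in\mathbb{Z}_1}$ satisfies $$\sum_{j\in\mathbb{Z}_1}\frac{|\lambda^+_{k_j^+}-a\mu_j^+/b_+|}{|j|+1}+\sum_{j\in\mathbb{Z}_1}\frac{|\lambda^-_{k_j^-}-a\mu_j^-/b_-|}{|j|+1}<\infty,\qquad b_++b_-=2b,$$ for some nonzero real numbers $b_+,b_-$, then $\Omega_1$ uniquely determines $\alpha_0$, $\beta_0$ and $q(x)$ a.e. on $(0,b)$.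
   Context: Let $y(\lambda,x)$ be the solution of $-y''+q(x)y=\lambda^2y$ on $(0,a)$ with $y(\lambda,0)=1$, $y'(\lambda,0)=i\alpha_0\lambda+\beta_0$ (prime is $d/dx$, $\lambda\in\mathbb{C}$). Put $\Delta_\pm(\lambda)=y'(\lambda,a)+(\pm i\alpha\lambda+\beta)y(\lambda,a)$, the characteristic functions of the boundary value problems $-y''+qy=\lambda^2y$, $y'(0)-(i\alpha_0\lambda+\beta_0)y(0)=0$, $y'(a)+(\pm i\alpha\lambda+\beta)y(a)=0$. The eigenvalues $\{\lambda_k^\pm\}_{k\in\mathbb{Z}_1}$ are the zeros of $\Delta_\pm$, respectively, counted with multiplicity, numbered so that $\lambda_k^\pm=\mu_k^\pm+O(1/k)$ as $|k|\to\infty$. Here $\{\mu_k^\pm\}$ are the zeros of $$g_\pm(\lambda)=\lambda\left[i(\alpha_0\pm\alpha)\cos\lambda a-(1\pm\alpha\alpha_0)\sin\lambda a\right],$$ namely, with $P_0^\pm=\ln\frac{|\alpha_0\pm\alpha+1\pm\alpha\alpha_0|}{|\alpha_0\pm\alpha-(1\pm\alpha\alpha_0)|}$: if $(\alpha_0-1)(1-\alpha)>0$, then $\mu_0^\pm=0$ and $\mu_k^\pm=\frac{\pi}{a}(|k|-\frac12)\operatorname{sgn}k+\frac{iP_0^\pm}{2a}$ for $k\in\mathbb{Z}\setminus\{0\}$; if $(\alpha_0-1)(1-\alpha)<0$, then $\mu_{-1}^\pm=0$ and $\mu_k^\pm=\frac{\pi}{a}(|k|-1)\operatorname{sgn}k+\frac{iP_0^\pm}{2a}$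 for $k\in\mathbb{Z}\setminus\{0,-1\}$. "Uniquely determines" means: if two problems with the same $a$, $\alpha$, $\beta$ and with potentials coinciding a.e. on $(b,a)$ both satisfy the hypotheses with the same families $\{\lambda^+_{k_j^+}\}$ (eigenvalues of the "$+$" problem) and $\{\lambda^-_{k_j^-}\}$ (eigenvalues of the "$-$" problem), then their $\alpha_0$, $\beta_0$ coincide and their potentials coincide a.e. on $(0,b)$. *)

theory Defs
  imports "HOL-Complex_Analysis.Complex_Analysis" "HOL-Library.Landau_Symbols"
begin

definition L2_on :: "real set \<Rightarrow> (real \<Rightarrow> complex) \<Rightarrow> bool" where
  "L2_on S q \<longleftrightarrow> q \<in> borel_measurable (lebesgue_on S)
     \<and> integrable (lebesgue_on S) (\<lambda>x. (cmod (q x))\<^sup>2)"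

(* y solves -y'' + q y = l^2 y on (0,a), with y(0) = 1 and y'(0) = c; dy is y'.
   As q is only in L^2, the equation holds almost everywhere and y' is absolutely
   continuous; both are expressed by the integrated equation
   y'(x) = c + (integral of (q - l^2) y over [0,x]). *)
definition ivp_solution ::
  "real \<Rightarrow> (real \<Rightarrow> complex) \<Rightarrow> complex \<Rightarrow> complex \<Rightarrow> (real \<Rightarrow> complex) \<Rightarrow> (real \<Rightarrow> complex) \<Rightarrow> bool"
where
  "ivp_solution a q l c y dy \<longleftrightarrow> y 0 = 1 \<and> dy 0 = c \<and>
     (\<forall>x\<in>{0..a}. (y has_vector_derivative dy x) (at x within {0..a}) \<and>
        ((\<lambda>t. (q t - l\<^sup>2) * y t) has_integral (dy x - c)) {0..x})"

(* The real parameter s is 1 or -1 and selects Delta_+ or Delta_-.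
   The initial value problem determines y and y' uniquely on [0,a]. *)
definition char_fun ::
  "real \<Rightarrow> real \<Rightarrow> (real \<Rightarrow> complex) \<Rightarrow> real \<Rightarrow> complex \<Rightarrow> real \<Rightarrow> complex \<Rightarrow> complex \<Rightarrow> complex"
where
  "char_fun s a q \<alpha>0 \<beta>0 \<alpha> \<beta> l =
     (THE d. \<exists>y dy. ivp_solution a q l (\<i> * \<alpha>0 * l + \<beta>0) y dy
                  \<and> d = dy a + (s * \<i> * \<alpha> * l + \<beta>) * y a)"

definition Z1 :: "real \<Rightarrow> real \<Rightarrow> int set" where
  "Z1 \<alpha>0 \<alpha> = (if (\<alpha>0 - 1) * (1 - \<alpha>) < 0 then UNIV - {0} else UNIV)"

definition P0 :: "real \<Rightarrow> real \<Rightarrow> real \<Rightarrow> real" where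
  "P0 s \<alpha>0 \<alpha> = ln (\<bar>\<alpha>0 + s * \<alpha> + (1 + s * \<alpha> * \<alpha>0)\<bar> / \<bar>\<alpha>0 + s * \<alpha> - (1 + s * \<alpha> * \<alpha>0)\<bar>)"

(* For s = 1 or s = -1 and (\<alpha>0 - 1) (1 - \<alpha>) \<noteq> 0, the numbers mu s a \<alpha>0 \<alpha> k, with k
   ranging over Z1 \<alpha>0 \<alpha>, are the zeros (with multiplicity) of
   l (i (\<alpha>0 + s \<alpha>) cos (l a) - (1 + s \<alpha> \<alpha>0) sin (l a)).
   If (\<alpha>0 - 1) (1 - \<alpha>) < 0, the value at k = 0 is irrelevant. *)
definition mu :: "real \<Rightarrow> real \<Rightarrow> real \<Rightarrow> real \<Rightarrow> int \<Rightarrow> complex" where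
  "mu s a \<alpha>0 \<alpha> k =
     (if (\<alpha>0 - 1) * (1 - \<alpha>) > 0
      then (if k = 0 then 0
            else Complex (pi / a * (\<bar>real_of_int k\<bar> - 1 / 2) * sgn (real_of_int k))
                         (P0 s \<alpha>0 \<alpha> / (2 * a)))
      else (if k = -1 then 0
            else Complex (pi / a * (\<bar>real_of_int k\<bar> - 1) * sgn (real_of_int k))
                         (P0 s \<alpha>0 \<alpha> / (2 * a))))"

(* ev lists the zeros of the characteristic function with multiplicity.
   On the integers, the cofinite filter expresses |k| tending to infinity. *)
definition eigenvalue_numbering ::
  "real \<Rightarrow> real \<Rightarrow> (real \<Rightarrow> complex) \<Rightarrow> real \<Rightarrow> complex \<Rightarrow> real \<Rightarrow> complex \<Rightarrow> (int \<Rightarrow> complex) \<Rightarrow> bool"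
where
  "eigenvalue_numbering s a q \<alpha>0 \<beta>0 \<alpha> \<beta> ev \<longleftrightarrow>
     (\<forall>z. finite {k \<in> Z1 \<alpha>0 \<alpha>. ev k = z} \<and>
          card {k \<in> Z1 \<alpha>0 \<alpha>. ev k = z} =
            (if char_fun s a q \<alpha>0 \<beta>0 \<alpha> \<beta> z = 0
             then nat (zorder (char_fun s a q \<alpha>0 \<beta>0 \<alpha> \<beta>) z) else 0)) \<and>
     (\<lambda>k. ev k - mu s a \<alpha>0 \<alpha> k) \<in> O[cofinite](\<lambda>k. 1 / of_int k)"

definition eigenvalue_subfamily ::
  "real \<Rightarrow> real \<Rightarrow> (real \<Rightarrow> complex) \<Rightarrow> real \<Rightarrow> complex \<Rightarrow> real \<Rightarrow> complex \<Rightarrow> (int \<Rightarrow> complex) \<Rightarrow> bool"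
where
  "eigenvalue_subfamily s a q \<alpha>0 \<beta>0 \<alpha> \<beta> X \<longleftrightarrow>
     (\<exists>ev k. eigenvalue_numbering s a q \<alpha>0 \<beta>0 \<alpha> \<beta> ev \<and>
        inj_on k (Z1 \<alpha>0 \<alpha>) \<and> k ` Z1 \<alpha>0 \<alpha> \<subseteq> Z1 \<alpha>0 \<alpha> \<and>
        (\<forall>j\<in>Z1 \<alpha>0 \<alpha>. X j = ev (k j)))"

(* Equality of unordered families: same values with the same multiplicities. The index
   sets may differ, since Z1 depends on the unknown parameter \<alpha>0. *)
definition same_family :: "int set \<Rightarrow> (int \<Rightarrow> complex) \<Rightarrow> int set \<Rightarrow> (int \<Rightarrow> complex) \<Rightarrow> bool" where
  "same_family I X J Y \<longleftrightarrow> (\<exists>\<sigma>. bij_betw \<sigma> I J \<and> (\<forall>i\<in>I. Y (\<sigma> i) = X i))"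

end

theory Submission
  imports Defs
begin

text \<open>
  Write $y$ and $\tilde y$ for the two solutions that satisfy the condition at $0$, and let
  $W(\lambda)$ be their Wronskian at $b$. Since the potentials agree on $(b,a)$, this is also their
  Wronskian at $a$, and there $W$ is a combination of the two characteristic functions of either
  sign. Hence every common eigenvalue is a zero of $W$, with multiplicity. A number
  $\lambda \neq 0$ cannot be an eigenvalue of both signs, because then $y$ and $y'$ would vanish
  together at $a$; at $\lambda = 0$ at most one zero is lost
  (\<open>common_zero_orders\<close>). So the two given families count jointly.

  The Wronskian identity and the growth of the solutions give
  $|W(\lambda)| \le K (1 + |\lambda| + e^{2b|\mathrm{Im}\,\lambda|})$. By Jensen's inequality the sum
  of $\ln (R/|z|)$ over zeros of $W$ in the disc of radius $R$ is then at most $4bR/\pi + O(1)$.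
  The zeros $a\mu_j^\pm/b_\pm$ alone would contribute $2|b_\pm|R/\pi + \ln R - O(1)$ for each sign,
  and by the summability hypothesis the given eigenvalues lose only $O(1)$ against them (\<open>eigenvalue_family_log_sum\<close>). As $|b_+| + |b_-| \ge 2b$, the zeros exceed
  the allowance by at least $2\ln R - O(1)$, or $\ln R - O(1)$ if one zero is lost, and so $W$ vanishes identically
  (\<open>entire_zero_if_too_many_zeros\<close>).

  It remains to recover the problem on $(0,b)$ from $W = 0$ (\<open>local_uniqueness\<close>). Let $\theta$ and
  $\varphi$ be the cosine and sine type solutions that start at $b$ and run to the left, with
  $\tilde\theta$, $\tilde\varphi$ for the second potential. The transfer matrix entry
  $F = \varphi\tilde\theta - \theta\tilde\varphi$ is entire in $\lambda$. In a horizontal strip it is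
  bounded because its four factors are. Off the strip $W = 0$ gives
  $F = \varphi\tilde y/\tilde y(b) - \tilde\varphi y/y(b)$, where $y$ is at most of order
  $e^{|\mathrm{Im}\,\lambda| x}$, and exactly of this order at $b$, while $\varphi$ is at most of order
  $e^{|\mathrm{Im}\,\lambda| (b-x)}/|\lambda|$, so that $F = O(1/|\lambda|)$. By Liouville $F = 0$, that is
  $\varphi/\theta = \tilde\varphi/\tilde\theta$. Differentiation yields
  $\theta^2 = \tilde\theta^2$, which determines the potential, and then the Wronskian identity
  reduces to the equality of the two initial slopes $i\alpha_0\lambda + \beta_0$.

  The potential is only square integrable. Solutions are therefore built and compared through
  integral equations: Picard iteration for the first order system, whose iterates are polynomials
  in $\lambda$ (\<open>sl_solution_exists\<close>), integration by parts for indefinite integrals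
  (\<open>has_integral_product_rule\<close>), and exponentially weighted estimates
  (\<open>exp_weighted_integral_le\<close>, \<open>growth_constant_exists\<close>).
\<close>

section \<open>Multiplicities of zeros of entire functions\<close>

text \<open>
  Divisibility by a power of $z - w$ among entire functions. Unlike the zero order it makes sense
  for every entire function and passes to combinations without case distinctions.
\<close>
definition vanishes_to_order :: "(complex \<Rightarrow> complex) \<Rightarrow> complex \<Rightarrow> nat \<Rightarrow> bool" where
  "vanishes_to_order f w n \<longleftrightarrow> (\<exists>g. g holomorphic_on UNIV \<and> (\<forall>z. f z = (z - w) ^ n * g z))"

lemma entire_isCont: "f holomorphic_on UNIV \<Longrightarrow> isCont f w"
  using holomorphic_on_imp_continuous_on[of f UNIV] continuous_on_eq_continuous_at[of UNIV f] by simp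

text \<open>
  Away from $w$ the quotient is explicit, so a factorization that holds near $w$ extends to the
  whole plane.
\<close>
lemma entire_division:
  assumes f: "f holomorphic_on UNIV" and "r > 0" and h: "h holomorphic_on ball w r"
    and eq: "\<And>z. z \<in> ball w r \<Longrightarrow> f z = (z - w) ^ n * h z"
  obtains g where "g holomorphic_on UNIV" "g w = h w" "\<And>z. f z = (z - w) ^ n * g z"
proof -
  define g where "g z = (if z = w then h w else f z / (z - w) ^ n)" for z
  have gh: "g z = h z" if "z \<in> ball w r" for z
    using eq[OF that] by (auto simp: g_def)
  have "g holomorphic_on ball w r"
    by (rule holomorphic_transform[OF h]) (simp add: gh)
  moreover have "g holomorphic_on - {w}"
  proof (rule holomorphic_transform)
    show "(\<lambda>z. f z / (z - w) ^ n) holomorphic_on - {w}"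
      by (intro holomorphic_intros holomorphic_on_subset[OF f]) auto
  qed (auto simp: g_def)
  moreover have "ball w r \<union> - {w} = UNIV" using \<open>r > 0\<close> by auto
  ultimately have "g holomorphic_on UNIV"
    using holomorphic_on_Un[of g "ball w r" "- {w}"] by (simp add: open_Compl)
  moreover have "f z = (z - w) ^ n * g z" for z
    using eq[of w] \<open>r > 0\<close> by (auto simp: g_def)
  ultimately show ?thesis using that by (auto simp: g_def)
qed

lemma vanishes_to_order_mono:
  assumes "vanishes_to_order f w m" "n \<le> m"
  shows "vanishes_to_order f w n"
proof -
  obtain g where g: "g holomorphic_on UNIV" "\<And>z. f z = (z - w) ^ m * g z"
    using assms by (auto simp: vanishes_to_order_def)
  have "(\<lambda>z. (z - w) ^ (m - n) * g z) holomorphic_on UNIV"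
    by (intro holomorphic_intros g)
  moreover have "f z = (z - w) ^ n * ((z - w) ^ (m - n) * g z)" for z
    using assms(2) by (simp add: g(2) mult.assoc[symmetric] power_add[symmetric])
  ultimately show ?thesis unfolding vanishes_to_order_def by (intro exI[of _ "\<lambda>z. (z - w) ^ (m - n) * g z"]) auto
qed

lemma vanishes_to_order_combination:
  assumes "vanishes_to_order f w n" "vanishes_to_order g w n"
    and "p holomorphic_on UNIV" "q holomorphic_on UNIV"
  shows "vanishes_to_order (\<lambda>z. p z * f z - q z * g z) w n"
proof -
  obtain f1 g1 where "f1 holomorphic_on UNIV" "\<And>z. f z = (z - w) ^ n * f1 z"
    "g1 holomorphic_on UNIV" "\<And>z. g z = (z - w) ^ n * g1 z"
    using assms by (auto simp: vanishes_to_order_def)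
  then show ?thesis
    unfolding vanishes_to_order_def using assms(3,4)
    by (intro exI[of _ "\<lambda>z. p z * f1 z - q z * g1 z"]) (auto intro!: holomorphic_intros simp: algebra_simps)
qed

lemma entire_factor_zero:
  assumes f: "f holomorphic_on UNIV" and "f z0 \<noteq> 0"
  obtains m g where "g holomorphic_on UNIV" "g w \<noteq> 0" "\<And>z. f z = (z - w) ^ m * g z"
    "m = (if f w = 0 then nat (zorder f w) else 0)"
proof -
  have *: "(if f w = 0 then 0 < zorder f w else zorder f w = 0) \<and>
    (\<exists>r>0. cball w r \<subseteq> UNIV \<and> zor_poly f w holomorphic_on cball w r \<and>
      (\<forall>v\<in>cball w r. f v = zor_poly f w v * (v - w) ^ nat (zorder f w) \<and> zor_poly f w v \<noteq> 0))"
    by (rule zorder_exist_zero[OF f]) (use assms in auto)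
  then obtain r where r: "r > 0" "zor_poly f w holomorphic_on cball w r"
    "\<And>v. v \<in> cball w r \<Longrightarrow> f v = zor_poly f w v * (v - w) ^ nat (zorder f w) \<and> zor_poly f w v \<noteq> 0"
    by blast
  have "zor_poly f w holomorphic_on ball w r"
    using r(2) by (rule holomorphic_on_subset) auto
  moreover have "f z = (z - w) ^ nat (zorder f w) * zor_poly f w z" if "z \<in> ball w r" for z
    using r(3)[of z] that by simp
  ultimately obtain g where g: "g holomorphic_on UNIV" "g w = zor_poly f w w"
    "\<And>z. f z = (z - w) ^ nat (zorder f w) * g z"
    using entire_division[OF f r(1)] by blast
  show ?thesis
    by (rule that[OF g(1) _ g(3)]) (use g(2) r * in auto)
qed

lemma vanishes_to_order_zorder:
  assumes f: "f holomorphic_on UNIV" and "f z0 \<noteq> 0"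
  shows "vanishes_to_order f w (if f w = 0 then nat (zorder f w) else 0)"
proof -
  obtain m g where "g holomorphic_on UNIV" "\<And>z. f z = (z - w) ^ m * g z"
    "m = (if f w = 0 then nat (zorder f w) else 0)"
    using entire_factor_zero[OF assms, of w] by blast
  then show ?thesis unfolding vanishes_to_order_def by blast
qed

lemma vanishes_to_order_le:
  assumes "vanishes_to_order f w n" and g: "g holomorphic_on UNIV" "g w \<noteq> 0"
    and eq: "\<And>z. f z = (z - w) ^ m * g z"
  shows "n \<le> m"
proof (rule ccontr)
  assume "\<not> n \<le> m"
  then have nm: "n - m \<noteq> 0" "n = m + (n - m)" by auto
  obtain h where h: "h holomorphic_on UNIV" "\<And>z. f z = (z - w) ^ n * h z"
    using assms by (auto simp: vanishes_to_order_def)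
  have ev: "eventually (\<lambda>z. (z - w) ^ (n - m) * h z = g z) (at w)"
    unfolding eventually_at_filter
  proof (intro always_eventually allI impI)
    fix z assume "z \<noteq> w" "z \<in> UNIV"
    have "(z - w) ^ m * ((z - w) ^ (n - m) * h z) = (z - w) ^ m * g z"
      using eq[of z] h(2)[of z] nm(2) by (metis mult.assoc power_add)
    then show "(z - w) ^ (n - m) * h z = g z" using \<open>z \<noteq> w\<close> by simp
  qed
  have "((\<lambda>z. (z - w) ^ (n - m) * h z) \<longlongrightarrow> (w - w) ^ (n - m) * h w) (at w)"
    using entire_isCont[OF h(1), of w] by (intro tendsto_intros) (simp add: isCont_def)
  then have "((\<lambda>z. (z - w) ^ (n - m) * h z) \<longlongrightarrow> 0) (at w)"
    using nm(1) by (simp add: power_0_left)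
  then have "(g \<longlongrightarrow> 0) (at w)"
    using ev by (rule Lim_transform_eventually)
  moreover have "(g \<longlongrightarrow> g w) (at w)"
    using entire_isCont[OF g(1)] by (simp add: isCont_def)
  ultimately show False using g(2) tendsto_unique[OF at_neq_bot] by blast
qed

lemma vanishes_to_order_quotient:
  assumes "vanishes_to_order f w n" and p: "p holomorphic_on UNIV" "p w \<noteq> 0"
    and g: "g holomorphic_on UNIV" and eq: "\<And>z. f z = p z * g z"
  shows "vanishes_to_order g w n"
proof -
  obtain h where h: "h holomorphic_on UNIV" "\<And>z. f z = (z - w) ^ n * h z"
    using assms by (auto simp: vanishes_to_order_def)
  obtain r where r: "r > 0" "\<And>z. dist w z < r \<Longrightarrow> p z \<noteq> 0"
    using continuous_at_avoid[OF entire_isCont[OF p(1)] p(2)] by blast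
  have "(\<lambda>z. h z / p z) holomorphic_on ball w r"
    using r(2) by (intro holomorphic_intros holomorphic_on_subset[OF h(1)] holomorphic_on_subset[OF p(1)]) auto
  moreover have "g z = (z - w) ^ n * (h z / p z)" if "z \<in> ball w r" for z
  proof -
    have "p z \<noteq> 0" using r(2)[of z] that by simp
    then show ?thesis using eq[of z] h(2)[of z] by (metis nonzero_mult_div_cancel_left times_divide_eq_right)
  qed
  ultimately obtain k where "k holomorphic_on UNIV" "\<And>z. g z = (z - w) ^ n * k z"
    using entire_division[OF g r(1), of "\<lambda>z. h z / p z" w n] by blast
  then show ?thesis unfolding vanishes_to_order_def by blast
qed

lemma entire_factor_finite:
  assumes f: "f holomorphic_on UNIV" and "finite A" and "\<And>w. w \<in> A \<Longrightarrow> vanishes_to_order f w (c w)"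
  obtains g where "g holomorphic_on UNIV" "\<And>z. f z = (\<Prod>w\<in>A. (z - w) ^ c w) * g z"
  using assms(2,3)
proof (induction A arbitrary: thesis rule: finite_induct)
  case empty
  show ?case by (rule empty.prems(1)[OF f]) auto
next
  case (insert w A)
  obtain g where g: "g holomorphic_on UNIV" "\<And>z. f z = (\<Prod>v\<in>A. (z - v) ^ c v) * g z"
    using insert.IH insert.prems(2) by blast
  have "vanishes_to_order g w (c w)"
  proof (rule vanishes_to_order_quotient[OF insert.prems(2)[of w] _ _ g])
    show "(\<lambda>z. \<Prod>v\<in>A. (z - v) ^ c v) holomorphic_on UNIV" by (intro holomorphic_intros)
    show "(\<Prod>v\<in>A. (w - v) ^ c v) \<noteq> 0" using insert.hyps by auto
  qed auto
  then obtain h where h: "h holomorphic_on UNIV" "\<And>z. g z = (z - w) ^ c w * h z"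
    by (auto simp: vanishes_to_order_def)
  show ?case
    by (rule insert.prems(1)[OF h(1)]) (use insert.hyps in \<open>simp add: g(2) h(2) mult_ac\<close>)
qed

text \<open>
  Multiplicities are prescribed point by point, while Jensen's inequality wants a product over the
  index set of an eigenvalue family; grouping the indices by their value connects the two.
\<close>
lemma entire_factor_family:
  fixes x :: "'i \<Rightarrow> complex"
  assumes f: "f holomorphic_on UNIV" and "finite I"
    and van: "\<And>w. w \<in> x ` I \<Longrightarrow> vanishes_to_order f w (card {i\<in>I. x i = w})"
  obtains g where "g holomorphic_on UNIV" "\<And>z. f z = (\<Prod>i\<in>I. z - x i) * g z"
proof -
  obtain g where g: "g holomorphic_on UNIV" "\<And>z. f z = (\<Prod>w\<in>x ` I. (z - w) ^ card {i\<in>I. x i = w}) * g z"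
    using entire_factor_finite[OF f, of "x ` I" "\<lambda>w. card {i\<in>I. x i = w}"] \<open>finite I\<close> van by blast
  have "(\<Prod>w\<in>x ` I. (z - w) ^ card {i\<in>I. x i = w}) = (\<Prod>i\<in>I. z - x i)" for z
  proof -
    have "(\<Prod>i\<in>I. z - x i) = (\<Prod>w\<in>x ` I. \<Prod>i | i \<in> I \<and> x i = w. z - x i)"
      using \<open>finite I\<close> by (rule prod.image_gen)
    also have "\<dots> = (\<Prod>w\<in>x ` I. (z - w) ^ card {i\<in>I. x i = w})"
      by (intro prod.cong refl) simp
    finally show ?thesis by simp
  qed
  with g show ?thesis by (intro that[of g]) auto
qed

section \<open>A Jensen inequality for circle bounds\<close>

text \<open>
  A Riemann sum of $\varphi$ differs from a sum of increments of an antiderivative by a uniformly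
  small error, and the increment over a full period does not depend on the starting point
  $\theta$. The uniformity in $\theta$ is what the next lemma needs.
\<close>
lemma riemann_sums_le_mean:
  fixes \<phi> :: "real \<Rightarrow> real"
  assumes cont: "continuous_on UNIV \<phi>" and per: "\<And>t. \<phi> (t + 2 * pi) = \<phi> t" and "e > 0"
  obtains N :: nat where "N > 0"
    "\<And>\<theta>. 0 \<le> \<theta> \<Longrightarrow> \<theta> \<le> 2 * pi \<Longrightarrow>
       (\<Sum>k<N. \<phi> (\<theta> + 2 * pi * real k / real N)) \<le> N * (integral {0..2*pi} \<phi> / (2 * pi) + e)"
proof -
  have "uniformly_continuous_on {0..4*pi} \<phi>"
    by (rule compact_uniformly_continuous[OF continuous_on_subset[OF cont]]) auto
  then obtain d where d: "d > 0" "\<And>s t. s \<in> {0..4*pi} \<Longrightarrow> t \<in> {0..4*pi} \<Longrightarrow> dist t s < d \<Longrightarrow> dist (\<phi> t) (\<phi> s) < e"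
    using \<open>e > 0\<close> unfolding uniformly_continuous_on_def by metis
  obtain N :: nat where N: "real N > 2 * pi / d"
    using reals_Archimedean2 by blast
  have N0: "N > 0"
    using N d by (metis divide_pos_pos gr0I less_numeral_extra(3) mult_pos_pos of_nat_0 order_less_trans pi_gt_zero zero_less_numeral)
  define h where "h = 2 * pi / real N"
  have h: "0 < h" "h < d" "real N * h = 2 * pi"
    using N N0 d by (auto simp: h_def field_simps)
  define \<Phi> where "\<Phi> x = integral {0..x} \<phi>" for x
  have der: "(\<Phi> has_real_derivative \<phi> x) (at x within {0..4*pi})" if "x \<in> {0..4*pi}" for x
    unfolding \<Phi>_def using that
    by (intro integral_has_real_derivative continuous_on_subset[OF cont]) auto
  have shift: "\<Phi> (x + 2 * pi) - \<Phi> x = \<Phi> (2 * pi)" if x: "x \<in> {0..2*pi}" for x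
  proof -
    have "((\<lambda>x. \<Phi> (x + 2 * pi) - \<Phi> x) has_vector_derivative 0) (at t within {0..2*pi})" if t: "t \<in> {0..2*pi}" for t
    proof -
      have "(\<Phi> has_real_derivative \<phi> (t + 2 * pi)) (at (t + 2*pi) within ((\<lambda>x. x + 2*pi) ` {0..2*pi}))"
        using t by (intro DERIV_subset[OF der]) auto
      moreover have "((\<lambda>x. x + 2 * pi) has_real_derivative 1) (at t within {0..2*pi})"
        by (auto intro!: derivative_eq_intros)
      ultimately have "((\<lambda>x. \<Phi> (x + 2 * pi)) has_real_derivative \<phi> (t + 2 * pi)) (at t within {0..2*pi})"
        using DERIV_image_chain[of \<Phi> "\<phi> (t + 2 * pi)" "\<lambda>x. x + 2 * pi" t "{0..2*pi}" 1]
        by (simp only: o_def mult_1_right)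
      moreover have "(\<Phi> has_real_derivative \<phi> t) (at t within {0..2*pi})"
        using t by (intro DERIV_subset[OF der]) auto
      ultimately show ?thesis
        unfolding has_real_derivative_iff_has_vector_derivative[symmetric]
        by (auto intro!: derivative_eq_intros simp: per)
    qed
    then obtain c where c: "\<And>t. t \<in> {0..2*pi} \<Longrightarrow> \<Phi> (t + 2 * pi) - \<Phi> t = c"
      using has_vector_derivative_zero_constant[OF convex_real_interval(5)[of 0 "2 * pi"], of "\<lambda>x. \<Phi> (x + 2 * pi) - \<Phi> x"] by blast
    from c[of 0] c[OF x] show ?thesis by (simp add: \<Phi>_def)
  qed
  have step: "h * \<phi> s \<le> \<Phi> (s + h) - \<Phi> s + h * e" if s: "s \<in> {0..4*pi}" "s + h \<in> {0..4*pi}" for s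
  proof -
    \<comment> \<open>Each mesh interval has a mean value point at distance less than $d$ from its left end.\<close>
    have "\<exists>z. s < z \<and> z < s + h \<and> \<Phi> (s + h) - \<Phi> s = (\<lambda>k. k * \<phi> z) (s + h - s)"
    proof (rule mvt)
      show "continuous_on {s..s + h} \<Phi>"
        using s by (intro DERIV_continuous_on[where D = \<phi>] DERIV_subset[OF der]) auto
      show "(\<Phi> has_derivative (\<lambda>k. k * \<phi> x)) (at x)" if "s < x" "x < s + h" for x
      proof -
        have "(\<Phi> has_real_derivative \<phi> x) (at x within {0<..<4*pi})"
          using s that by (intro DERIV_subset[OF der]) auto
        moreover have "x \<in> {0<..<4*pi}" using s that by auto
        ultimately have "(\<Phi> has_real_derivative \<phi> x) (at x)"
          by (metis at_within_open open_greaterThanLessThan)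
        then show ?thesis
          by (simp add: has_field_derivative_def mult.commute[of _ "\<phi> x"])
      qed
    qed (use h in auto)
    then obtain z where z: "s < z" "z < s + h" "\<Phi> (s + h) - \<Phi> s = h * \<phi> z" by auto
    have "dist (\<phi> z) (\<phi> s) < e"
      using d(2)[of s z] s z h by (auto simp: dist_real_def)
    then have "h * \<phi> s \<le> h * (\<phi> z + e)"
      using h by (intro mult_left_mono) (auto simp: dist_real_def)
    then show ?thesis using z by (simp add: algebra_simps)
  qed
  show ?thesis
  proof (rule that[OF N0])
    fix \<theta> :: real assume \<theta>: "0 \<le> \<theta>" "\<theta> \<le> 2 * pi"
    have le: "\<theta> + real k * h + h \<le> 4 * pi" if "k < N" for k
    proof -
      have "real k + 1 \<le> real N" using that by simp
      then have "(real k + 1) * h \<le> real N * h" using h by (intro mult_right_mono) auto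
      then show ?thesis using \<theta> h by (simp add: algebra_simps)
    qed
    have "h * (\<Sum>k<N. \<phi> (\<theta> + real k * h)) \<le> (\<Sum>k<N. \<Phi> (\<theta> + real (Suc k) * h) - \<Phi> (\<theta> + real k * h) + h * e)"
      unfolding sum_distrib_left
    proof (rule sum_mono)
      fix k assume "k \<in> {..<N}"
      then show "h * \<phi> (\<theta> + real k * h) \<le> \<Phi> (\<theta> + real (Suc k) * h) - \<Phi> (\<theta> + real k * h) + h * e"
        using step[of "\<theta> + real k * h"] le[of k] \<theta> h by (simp add: algebra_simps)
    qed
    also have "\<dots> = \<Phi> (\<theta> + real N * h) - \<Phi> \<theta> + real N * h * e"
      unfolding sum.distrib sum_lessThan_telescope[of "\<lambda>k. \<Phi> (\<theta> + real k * h)"] by simp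
    also have "\<dots> = \<Phi> (2 * pi) + 2 * pi * e"
      using shift[of \<theta>] \<theta> h by simp
    finally have "real N * (h * (\<Sum>k<N. \<phi> (\<theta> + real k * h))) \<le> real N * (\<Phi> (2 * pi) + 2 * pi * e)"
      using N0 by (intro mult_left_mono) auto
    then have "(2 * pi) * (\<Sum>k<N. \<phi> (\<theta> + real k * h)) \<le> real N * (\<Phi> (2 * pi) + 2 * pi * e)"
      using h by (simp add: mult.assoc[symmetric])
    then have "(\<Sum>k<N. \<phi> (\<theta> + real k * h)) \<le> real N * (\<Phi> (2 * pi) / (2 * pi) + e)"
      by (simp add: field_simps)
    then show "(\<Sum>k<N. \<phi> (\<theta> + 2 * pi * real k / real N)) \<le> N * (integral {0..2*pi} \<phi> / (2 * pi) + e)"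
      by (simp add: \<Phi>_def h_def mult.commute)
  qed
qed

text \<open>
  The product of $g$ over all rotations by $N$-th roots of unity has the value $g(0)^N$ at the
  centre, and on the circle its logarithm is bounded by a Riemann sum of $\varphi$. The maximum
  principle thus gives the mean value inequality for $\ln |g|$ without any logarithm of $g$, so that
  zeros of $g$ do no harm.
\<close>
lemma subharmonic_mean:
  assumes hol: "g holomorphic_on UNIV" and "R > 0" and "g 0 \<noteq> 0"
    and cont: "continuous_on UNIV \<phi>" and per: "\<And>t. \<phi> (t + 2 * pi) = \<phi> t"
    and bound: "\<And>t. cmod (g (of_real R * cis t)) \<le> exp (\<phi> t)"
  shows "ln (cmod (g 0)) \<le> integral {0..2*pi} \<phi> / (2 * pi)"
proof (rule field_le_epsilon)
  fix e :: real assume "e > 0"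
  let ?m = "integral {0..2*pi} \<phi> / (2 * pi)"
  obtain N :: nat where N: "N > 0" and sum: "\<And>\<theta>. 0 \<le> \<theta> \<Longrightarrow> \<theta> \<le> 2 * pi \<Longrightarrow>
       (\<Sum>k<N. \<phi> (\<theta> + 2 * pi * real k / real N)) \<le> N * (?m + e)"
    using riemann_sums_le_mean[OF cont per \<open>e > 0\<close>] by blast
  define H where "H z = (\<Prod>k<N. g (z * cis (2 * pi * real k / real N)))" for z
  have holH: "H holomorphic_on UNIV"
    unfolding H_def
    by (intro holomorphic_intros holomorphic_on_compose_gen[OF _ hol, unfolded o_def]) auto
  have "cmod (H 0) \<le> exp (N * (?m + e))"
  proof (rule maximum_modulus_frontier[of H "cball 0 R"])
    fix z :: complex assume "z \<in> frontier (cball 0 R)"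
    then have "cmod z = R" using \<open>R > 0\<close> by simp
    then obtain \<theta> where \<theta>: "0 \<le> \<theta>" "\<theta> < 2 * pi" and z: "z = of_real R * cis \<theta>"
      using complex_unimodular_polar[of "z / R"] \<open>R > 0\<close>
      by (metis (no_types, lifting) cis_conv_exp cis.ctr nonzero_divide_eq_eq mult.commute divide_self_if norm_divide norm_of_real abs_of_pos of_real_eq_0_iff less_irrefl)
    have "cmod (H z) = (\<Prod>k<N. cmod (g (of_real R * cis (\<theta> + 2 * pi * real k / real N))))"
      by (simp add: H_def prod_norm z mult.assoc cis_mult)
    also have "\<dots> \<le> (\<Prod>k<N. exp (\<phi> (\<theta> + 2 * pi * real k / real N)))"
      by (intro prod_mono) (auto intro: bound)
    also have "\<dots> = exp (\<Sum>k<N. \<phi> (\<theta> + 2 * pi * real k / real N))"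
      by (simp add: exp_sum)
    also have "\<dots> \<le> exp (N * (?m + e))"
      using sum[of \<theta>] \<theta> by simp
    finally show "cmod (H z) \<le> exp (N * (?m + e))" .
  qed (use \<open>R > 0\<close> holH in \<open>auto intro: holomorphic_on_subset holomorphic_on_imp_continuous_on\<close>)
  moreover have "cmod (H 0) = exp (N * ln (cmod (g 0)))"
    using \<open>g 0 \<noteq> 0\<close> by (simp add: H_def norm_power exp_of_nat_mult)
  ultimately have "N * ln (cmod (g 0)) \<le> N * (?m + e)" by simp
  then show "ln (cmod (g 0)) \<le> ?m + e" using N by simp
qed

text \<open>
  Each linear factor with a zero inside the circle is exchanged for the Blaschke-type factor
  $R - \bar z_i w/R$, which has the same modulus on the circle but modulus $R$ instead of $|z_i|$ at
  the centre. The mean value inequality for the new function is the claim.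
\<close>
theorem jensen_inequality:
  fixes z :: "'i \<Rightarrow> complex"
  assumes "finite I" and holg: "g holomorphic_on UNIV" and f: "\<And>w. f w = (\<Prod>i\<in>I. w - z i) * g w"
    and "f 0 \<noteq> 0" and "R > 0"
    and cont: "continuous_on UNIV \<phi>" and per: "\<And>t. \<phi> (t + 2 * pi) = \<phi> t"
    and bound: "\<And>t. cmod (f (of_real R * cis t)) \<le> exp (\<phi> t)"
  shows "ln (cmod (f 0)) + (\<Sum>i\<in>I. ln (R / cmod (z i))) \<le> integral {0..2*pi} \<phi> / (2 * pi)"
proof -
  \<comment> \<open>For $|w| = R$ both branches have modulus $|w - z_i|$.\<close>
  define b where "b i w = (if cmod (z i) < R then of_real R - cnj (z i) * w / of_real R else w - z i)" for i w
  define G where "G w = (\<Prod>i\<in>I. b i w) * g w" for w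
  have z0: "z i \<noteq> 0" if "i \<in> I" for i
    using f[of 0] \<open>f 0 \<noteq> 0\<close> that \<open>finite I\<close> by auto
  have g0: "g 0 \<noteq> 0" using f[of 0] \<open>f 0 \<noteq> 0\<close> by auto
  have b0: "cmod (b i 0) \<ge> R" for i
    using \<open>R > 0\<close> by (auto simp: b_def)
  have bR: "cmod (b i w) = cmod (w - z i)" if "cmod w = R" for i w
  proof (cases "cmod (z i) < R")
    case True
    have "w * cnj w = of_real R * of_real R"
      using that by (metis complex_norm_square power2_eq_square of_real_mult)
    then have "of_real R - cnj (z i) * w / of_real R = w / of_real R * cnj (w - z i)"
      using \<open>R > 0\<close> by (simp add: field_simps)
    then show ?thesis
      using True that \<open>R > 0\<close> by (simp add: b_def norm_mult norm_divide del: complex_cnj_diff)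
  qed (simp add: b_def)
  have "ln (cmod (G 0)) \<le> integral {0..2*pi} \<phi> / (2 * pi)"
  proof (rule subharmonic_mean[OF _ \<open>R > 0\<close> _ cont per])
    have hb: "b i holomorphic_on UNIV" for i
      unfolding b_def by (cases "cmod (z i) < R") (auto intro!: holomorphic_intros simp: \<open>R > 0\<close>)
    show "G holomorphic_on UNIV"
      unfolding G_def by (intro holomorphic_intros hb holg)
    show "G 0 \<noteq> 0"
      using b0 \<open>R > 0\<close> g0 \<open>finite I\<close> by (auto simp: G_def) (metis less_le_not_le norm_zero)
    fix t
    have "cmod (G (of_real R * cis t)) = cmod (f (of_real R * cis t))"
      using \<open>R > 0\<close> by (simp add: G_def f norm_mult prod_norm[symmetric] bR)
    then show "cmod (G (of_real R * cis t)) \<le> exp (\<phi> t)" using bound[of t] by simp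
  qed
  moreover have "ln (cmod (f 0)) + (\<Sum>i\<in>I. ln (R / cmod (z i))) \<le> ln (cmod (G 0))"
  proof -
    have "ln (cmod (f 0)) = (\<Sum>i\<in>I. ln (cmod (z i))) + ln (cmod (g 0))"
      using z0 g0 \<open>finite I\<close> by (simp add: f norm_mult prod_norm[symmetric] ln_mult ln_prod)
    moreover have "(\<Sum>i\<in>I. ln (R / cmod (z i))) = (\<Sum>i\<in>I. ln R - ln (cmod (z i)))"
      using z0 \<open>R > 0\<close> by (intro sum.cong) (auto simp: ln_div)
    moreover have "ln (cmod (G 0)) = (\<Sum>i\<in>I. ln (cmod (b i 0))) + ln (cmod (g 0))"
    proof -
      have "cmod (b i 0) > 0" for i using b0[of i] \<open>R > 0\<close> by linarith
      then show ?thesis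
        using g0 \<open>finite I\<close> by (simp add: G_def norm_mult prod_norm[symmetric] ln_mult ln_prod prod_pos)
    qed
    moreover have "(\<Sum>i\<in>I. ln R) \<le> (\<Sum>i\<in>I. ln (cmod (b i 0)))"
      using b0 \<open>R > 0\<close> by (intro sum_mono) (meson ln_le_cancel_iff less_le_trans)
    ultimately show ?thesis by (simp add: sum_subtractf)
  qed
  ultimately show ?thesis by linarith
qed

text \<open>
  Any positive slope would do below; the constant $1/4$ follows from two special values of the
  trigonometric functions.
\<close>
lemma sin_ge_quarter:
  assumes "0 \<le> t" "t \<le> pi / 2"
  shows "sin t \<ge> t / 4"
proof (cases "t \<le> pi / 3")
  case True
  show ?thesis
  proof (cases "t = 0")
    case False
    then have t: "t > 0" using assms by simp
    have "\<exists>z. 0 < z \<and> z < t \<and> sin t - sin 0 = (t - 0) * cos z"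
      using t by (intro MVT2) (auto intro!: derivative_eq_intros)
    then obtain z where z: "0 < z" "z < t" "sin t = t * cos z" by auto
    have "cos z \<ge> cos (pi / 3)"
      using z True by (intro cos_monotone_0_pi_le) auto
    then have "cos z \<ge> 1 / 4" by (simp add: cos_60)
    then show ?thesis using z t by (simp add: mult_left_mono)
  qed simp
next
  case False
  have "sin (pi / 6) \<le> sin t"
    using False assms by (intro sin_monotone_2pi_le) auto
  then have "sin t \<ge> 1 / 2" by (simp add: sin_30)
  moreover have "t \<le> 2" using assms pi_less_4 by simp
  ultimately show ?thesis by simp
qed

text \<open>
  Near both ends of a half period $|\sin|$ grows at least linearly, so two decaying exponentials
  dominate the integrand.
\<close>
lemma exp_sine_integral_le:
  assumes "A > 0" and c: "c = 0 \<or> c = pi"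
  shows "integral {c..c + pi} (\<lambda>t. exp (- (A * \<bar>sin t\<bar>))) \<le> 8 / A"
proof -
  have low: "\<bar>sin t\<bar> \<ge> min (t - c) (c + pi - t) / 4" if t: "t \<in> {c..c + pi}" for t
  proof -
    have abs: "\<bar>sin t\<bar> = \<bar>sin (t - c)\<bar>" "\<bar>sin t\<bar> = \<bar>sin (c + pi - t)\<bar>"
      using c by (auto simp: sin_diff sin_add)
    show ?thesis
    proof (cases "t - c \<le> pi / 2")
      case True
      have "\<bar>sin t\<bar> \<ge> (t - c) / 4" using sin_ge_quarter[of "t - c"] True t abs(1) by auto
      then show ?thesis by simp
    next
      case False
      have "\<bar>sin t\<bar> \<ge> (c + pi - t) / 4" using sin_ge_quarter[of "c + pi - t"] False t abs(2) by auto
      then show ?thesis by simp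
    qed
  qed
  have "((\<lambda>t. exp (- (A * (t - c) / 4)) + exp (- (A * (c + pi - t) / 4))) has_integral
     (- 4 / A * exp (- (A * (c + pi - c) / 4)) + 4 / A * exp (- (A * (c + pi - (c + pi)) / 4))
     - (- 4 / A * exp (- (A * (c - c) / 4)) + 4 / A * exp (- (A * (c + pi - c) / 4))))) {c..c + pi}"
    using \<open>A > 0\<close> by (intro fundamental_theorem_of_calculus)
      (auto simp: has_real_derivative_iff_has_vector_derivative[symmetric] field_simps intro!: derivative_eq_intros)
  then have up: "((\<lambda>t. exp (- (A * (t - c) / 4)) + exp (- (A * (c + pi - t) / 4))) has_integral
     (8 / A - 8 / A * exp (- (A * pi / 4)))) {c..c + pi}"
    by (simp add: field_simps)
  have "integral {c..c + pi} (\<lambda>t. exp (- (A * \<bar>sin t\<bar>)))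
      \<le> integral {c..c + pi} (\<lambda>t. exp (- (A * (t - c) / 4)) + exp (- (A * (c + pi - t) / 4)))"
  proof (rule integral_le)
    show "(\<lambda>t. exp (- (A * \<bar>sin t\<bar>))) integrable_on {c..c + pi}"
      by (intro integrable_continuous_real continuous_intros)
    show "(\<lambda>t. exp (- (A * (t - c) / 4)) + exp (- (A * (c + pi - t) / 4))) integrable_on {c..c + pi}"
      using up by blast
    fix t assume t: "t \<in> {c..c + pi}"
    have "A * (min (t - c) (c + pi - t) / 4) \<le> A * \<bar>sin t\<bar>"
      using low[OF t] \<open>A > 0\<close> by (intro mult_left_mono) auto
    then have "A * (t - c) / 4 \<le> A * \<bar>sin t\<bar> \<or> A * (c + pi - t) / 4 \<le> A * \<bar>sin t\<bar>"
      by (auto simp: min_def split: if_splits)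
    then have "exp (- (A * \<bar>sin t\<bar>)) \<le> exp (- (A * (t - c) / 4)) \<or> exp (- (A * \<bar>sin t\<bar>)) \<le> exp (- (A * (c + pi - t) / 4))"
      by auto
    then show "exp (- (A * \<bar>sin t\<bar>)) \<le> exp (- (A * (t - c) / 4)) + exp (- (A * (c + pi - t) / 4))"
      using exp_gt_zero[of "- (A * (t - c) / 4)"] exp_gt_zero[of "- (A * (c + pi - t) / 4)"] by linarith
  qed
  also have "\<dots> = 8 / A - 8 / A * exp (- (A * pi / 4))" using up by (rule integral_unique)
  also have "\<dots> \<le> 8 / A" using \<open>A > 0\<close> by simp
  finally show ?thesis .
qed

text \<open>
  The mean of $|\sin|$ is $2/\pi$. The exponential term costs only $O(B/A)$: this is why an
  additive polynomial term in the bound for an entire function, which dominates only near the real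
  axis, contributes $O(1)$ to the logarithmic mean instead of a multiple of $\ln R$.
\<close>
lemma circle_mean_le:
  assumes A: "A > 0" and B: "B \<ge> 0"
  shows "integral {0..2*pi} (\<lambda>t. c0 + A * \<bar>sin t\<bar> + B * exp (- (A * \<bar>sin t\<bar>))) / (2 * pi) \<le> c0 + 2 * A / pi + 8 * B / A"
proof -
  have s: "((\<lambda>t. \<bar>sin t\<bar>) has_integral 4) {0..2*pi}"
  proof -
    have "((\<lambda>t. sin t) has_integral (- cos pi - - cos 0)) {0..pi}"
      by (intro fundamental_theorem_of_calculus)
        (auto simp: has_real_derivative_iff_has_vector_derivative[symmetric] intro!: derivative_eq_intros)
    then have 1: "((\<lambda>t. \<bar>sin t\<bar>) has_integral 2) {0..pi}"
      by (intro has_integral_eq[where f = sin and g = "\<lambda>t. \<bar>sin t\<bar>"]) (auto simp: sin_ge_zero)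
    have "((\<lambda>t. - sin t) has_integral (cos (2 * pi) - cos pi)) {pi..2*pi}"
      by (intro fundamental_theorem_of_calculus)
        (auto simp: has_real_derivative_iff_has_vector_derivative[symmetric] intro!: derivative_eq_intros)
    then have 2: "((\<lambda>t. \<bar>sin t\<bar>) has_integral 2) {pi..2*pi}"
    proof (intro has_integral_eq[where f = "\<lambda>t. - sin t" and g = "\<lambda>t. \<bar>sin t\<bar>"])
      show "- sin t = \<bar>sin t\<bar>" if "t \<in> {pi..2*pi}" for t
        using sin_ge_zero[of "t - pi"] that by (simp add: sin_diff)
    qed simp
    show ?thesis using has_integral_combine[OF _ _ 1 2] by simp
  qed
  define I where "I = integral {0..2*pi} (\<lambda>t. exp (- (A * \<bar>sin t\<bar>)))"
  have int: "(\<lambda>t. exp (- (A * \<bar>sin t\<bar>))) integrable_on {0..2*pi}"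
    by (intro integrable_continuous_real continuous_intros)
  have "I = integral {0..pi} (\<lambda>t. exp (- (A * \<bar>sin t\<bar>))) + integral {pi..2*pi} (\<lambda>t. exp (- (A * \<bar>sin t\<bar>)))"
    unfolding I_def by (rule Henstock_Kurzweil_Integration.integral_combine[symmetric, OF _ _ int]) auto
  also have "\<dots> \<le> 8 / A + 8 / A"
    using exp_sine_integral_le[OF A, of 0] exp_sine_integral_le[OF A, of pi] by (intro add_mono) auto
  finally have I: "I \<le> 16 / A" by simp
  have "((\<lambda>t. c0 + A * \<bar>sin t\<bar> + B * exp (- (A * \<bar>sin t\<bar>))) has_integral (2 * pi * c0 + A * 4 + B * I)) {0..2*pi}"
  proof (intro has_integral_add has_integral_mult_right s)
    show "((\<lambda>t. c0) has_integral 2 * pi * c0) {0..2*pi}"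
      using has_integral_const_real[of c0 0 "2 * pi"] by simp
    show "((\<lambda>t. exp (- (A * \<bar>sin t\<bar>))) has_integral I) {0..2*pi}"
      using int by (simp add: I_def has_integral_integral)
  qed
  then have "integral {0..2*pi} (\<lambda>t. c0 + A * \<bar>sin t\<bar> + B * exp (- (A * \<bar>sin t\<bar>))) / (2 * pi)
      = (2 * pi * c0 + A * 4 + B * I) / (2 * pi)"
    by (simp add: integral_unique)
  also have "\<dots> = c0 + 2 * A / pi + B * I / (2 * pi)" by (simp add: field_simps)
  also have "B * I / (2 * pi) \<le> B * (16 / A) / 2"
  proof -
    have "B * I / (2 * pi) \<le> B * (16 / A) / (2 * pi)" using I B by (intro divide_right_mono mult_left_mono) auto
    also have "\<dots> \<le> B * (16 / A) / 2" using A B pi_gt3 by (intro divide_left_mono) auto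
    finally show ?thesis .
  qed
  finally show ?thesis by simp
qed

section \<open>Logarithmic sums over asymptotically periodic families\<close>

text \<open>
  Stirling's upper bound including the half logarithm. A cruder bound would lose a multiple of
  $\ln R$ in the zero count, which is just the size of the surplus that decides the theorem.
\<close>
lemma ln_fact_le:
  assumes "n \<ge> 1"
  shows "ln (fact n) \<le> (real n + 1/2) * ln (real n) - real n + 1"
  using assms
proof (induction n rule: dec_induct)
  case (step n)
  have "2 * (real (Suc n) - real n) / (real n + real (Suc n)) \<le> ln (real (Suc n)) - ln (real n)"
    using step by (intro ln_inverse_approx_ge) auto
  then have "(real n + 1/2) * (2 / (2 * real n + 1)) \<le> (real n + 1/2) * (ln (real (Suc n)) - ln (real n))"
    by (intro mult_left_mono) (auto simp: add_ac)
  moreover have "(real n + 1/2) * (2 / (2 * real n + 1)) = 1" by (simp add: field_simps)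
  ultimately have "1 \<le> (real n + 1/2) * (ln (real (Suc n)) - ln (real n))" by linarith
  moreover have "ln (fact (Suc n)) = ln (real (Suc n)) + ln (fact n)"
    by (simp add: ln_mult)
  ultimately show ?case using step.IH by (simp add: algebra_simps)
qed simp

text \<open>
  From $(n - 1/2)^2 = n (n-1) \bigl(1 + \frac{1}{4 n (n-1)}\bigr)$: each term is the average of
  two consecutive logarithms up to a telescoping error.
\<close>
lemma sum_ln_half_le:
  assumes "N \<ge> 1"
  shows "(\<Sum>n=2..N. ln (real n - 1/2)) \<le> ln (fact N) - ln (real N) / 2 + (1 - 1 / real N) / 8"
  using assms
proof (induction N rule: dec_induct)
  case (step N)
  have N: "real N \<ge> 1" using step by simp
  define p where "p = real N * (real N + 1)"
  define r where "r = 1 / real N - 1 / (real N + 1)"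
  define L where "L = ln (real N + 1/2)"
  have p: "p > 0" using N by (simp add: p_def)
  have "2 * L = ln ((real N + 1/2)\<^sup>2)"
    using N by (simp add: L_def ln_realpow)
  also have "(real N + 1/2)\<^sup>2 = p * (1 + 1 / (4 * p))"
    using p by (simp add: field_simps power2_eq_square) (simp add: p_def algebra_simps)
  also have "ln \<dots> = ln p + ln (1 + 1 / (4 * p))"
    using p by (intro ln_mult_pos add_pos_pos) auto
  also have "\<dots> \<le> ln (real N) + ln (real N + 1) + 1 / (4 * p)"
    using N p ln_add_one_self_le_self[of "1 / (4 * p)"] by (simp add: p_def ln_mult)
  also have "1 / (4 * p) = r / 4"
    using N by (simp add: p_def r_def field_simps)
  finally have "2 * L \<le> ln (real N) + ln (real N + 1) + r / 4" .
  then have "L \<le> (ln (real N) + ln (real N + 1)) / 2 + r / 8"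
    by argo
  moreover have "(1 - 1 / real (Suc N)) / 8 = (1 - 1 / real N) / 8 + r / 8"
    unfolding r_def by (simp add: diff_divide_distrib add.commute)
  moreover have "(\<Sum>n=2..Suc N. ln (real n - 1/2)) = (\<Sum>n=2..N. ln (real n - 1/2)) + L"
    using step by (simp add: L_def algebra_simps)
  moreover have "ln (fact (Suc N)) = ln (real N + 1) + ln (fact N)"
    using N by (simp add: ln_mult add.commute)
  moreover have "ln (real (Suc N)) = ln (real N + 1)" by (simp add: add.commute)
  ultimately show ?case using step.IH by argo
qed simp

text \<open>
  The two shifts are those of the unperturbed eigenvalues: $|k| - 1/2$ when there is one zero at
  the origin and $k$ runs over all integers, and $|k| - 1$ when $0$ is left out.
\<close>
lemma sum_ln_shift_le:
  fixes h :: real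
  assumes "N \<ge> 1" and "h = 1/2 \<or> h = 1"
  shows "(\<Sum>n=2..N. ln (real n - h)) \<le> real N * ln (real N) - real N + 2 - (h - 1/2) * ln (real N)"
proof -
  note st = ln_fact_le[OF assms(1)]
  have N: "real N \<ge> 1" using assms by simp
  from assms(2) show ?thesis
  proof
    assume h: "h = 1/2"
    have "(1 - 1 / real N) / 8 \<le> 1" using N by (simp add: field_simps)
    then have "(\<Sum>n=2..N. ln (real n - 1/2)) \<le> ln (fact N) - ln (real N) / 2 + 1"
      by (intro order_trans[OF sum_ln_half_le[OF assms(1)]] add_left_mono)
    moreover have "(real N + 1/2) * ln (real N) = real N * ln (real N) + ln (real N) / 2"
      by (simp add: algebra_simps)
    ultimately show ?thesis using st unfolding h by simp
  next
    assume h: "h = 1"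
    have "(\<Sum>n=2..N. ln (real n - 1)) = ln (fact N) - ln (real N)"
      using assms(1)
    proof (induction N rule: dec_induct)
      case (step n)
      then show ?case by (simp add: ln_mult)
    qed simp
    then show ?thesis using st unfolding h by (simp add: algebra_simps)
  qed
qed

lemma sum_inverse_squares_le: "(\<Sum>n=2..N. 1 / (real n)\<^sup>2) \<le> (1::real)"
proof -
  have "(\<Sum>n=2..N. 1 / (real n)\<^sup>2) \<le> 1 - 1 / real N" if "N \<ge> 1"
    using that
  proof (induction N rule: dec_induct)
    case (step n)
    have "1 / (real (Suc n))\<^sup>2 \<le> 1 / real n - 1 / real (Suc n)"
    proof -
      have "1 / (real (Suc n))\<^sup>2 \<le> 1 / (real n * real (Suc n))"
        using step by (intro divide_left_mono) (auto simp: power2_eq_square)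
      also have "\<dots> = 1 / real n - 1 / real (Suc n)" using step by (simp add: field_simps)
      finally show ?thesis .
    qed
    then show ?case using step by simp
  qed simp
  moreover have "1 - 1 / real N \<le> 1" by simp
  ultimately show ?thesis by (cases "N \<ge> 1") (metis order_trans, simp)
qed

text \<open>
  With the value $1$ at the origin, a zero there contributes $\ln R$ to a sum of $\ln (R/|z|)$,
  which is its true share in Jensen's formula.
\<close>
definition nz_norm :: "complex \<Rightarrow> real" where
  "nz_norm z = (if z = 0 then 1 else cmod z)"

text \<open>
  The point $w$ is compared with $v$, whose modulus is essentially $x = |\mathrm{Re}\,v|$. If
  $w \neq 0$, the triangle inequality and $\ln (1 + t) \le t$ suffice. If $w = 0$, the distance to
  $v$ is at least $x$, so that the term with $K$ outweighs a negative $\ln x$.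
\<close>
lemma ln_nz_norm_le:
  fixes x y :: real
  assumes x: "x > 0" "exp (- K) \<le> x" and K: "K \<ge> 0" and v: "\<bar>Re v\<bar> = x" "\<bar>Im v\<bar> = y"
  shows "ln (nz_norm w) \<le> ln x + y\<^sup>2 / (2 * x\<^sup>2) + (1 + K) * (cmod (w - v) / x)"
proof (cases "w = 0")
  case True
  have "cmod (w - v) / x \<ge> 1" using abs_Re_le_cmod[of v] v x True by (simp add: norm_minus_commute)
  then have "(1 + K) * 1 \<le> (1 + K) * (cmod (w - v) / x)" using K by (intro mult_left_mono) auto
  moreover have "- K \<le> ln x" using x by (simp add: ln_ge_iff)
  moreover have "0 \<le> y\<^sup>2 / (2 * x\<^sup>2)" by simp
  moreover have "ln (nz_norm w) = 0" using True by (simp add: nz_norm_def)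
  ultimately show ?thesis unfolding mult_1_right by (smt (verit))
next
  case False
  have "cmod v \<le> x * (1 + y\<^sup>2 / (2 * x\<^sup>2))"
  proof -
    have "(cmod v)\<^sup>2 = x\<^sup>2 + y\<^sup>2" using v by (simp add: cmod_power2 flip: v)
    also have "\<dots> \<le> (x * (1 + y\<^sup>2 / (2 * x\<^sup>2)))\<^sup>2"
    proof -
      have "x * (1 + y\<^sup>2 / (2 * x\<^sup>2)) = x + y\<^sup>2 / (2 * x)"
        using x by (simp add: power2_eq_square field_simps)
      moreover have "2 * x * (y\<^sup>2 / (2 * x)) = y\<^sup>2" using x by simp
      ultimately show ?thesis by (simp add: power2_sum)
    qed
    finally show ?thesis by (rule power2_le_imp_le) (use x in auto)
  qed
  then have "cmod w \<le> x * (1 + y\<^sup>2 / (2 * x\<^sup>2)) + cmod (w - v)"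
    using norm_triangle_ineq[of v "w - v"] by simp
  also have "\<dots> = x * (1 + (y\<^sup>2 / (2 * x\<^sup>2) + cmod (w - v) / x))"
    using x by (simp add: field_simps)
  finally have "ln (cmod w) \<le> ln (x * (1 + (y\<^sup>2 / (2 * x\<^sup>2) + cmod (w - v) / x)))"
    using False x by (intro ln_mono) auto
  also have "\<dots> = ln x + ln (1 + (y\<^sup>2 / (2 * x\<^sup>2) + cmod (w - v) / x))"
    using x by (intro ln_mult_pos add_pos_nonneg) auto
  also have "\<dots> \<le> ln x + (y\<^sup>2 / (2 * x\<^sup>2) + cmod (w - v) / x)"
    using x by (intro add_left_mono ln_add_one_self_le_self) auto
  also have "\<dots> \<le> ln x + y\<^sup>2 / (2 * x\<^sup>2) + (1 + K) * (cmod (w - v) / x)"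
  proof -
    have "1 * (cmod (w - v) / x) \<le> (1 + K) * (cmod (w - v) / x)"
      using K x by (intro mult_right_mono) auto
    then show ?thesis by simp
  qed
  finally show ?thesis using False by (simp add: nz_norm_def)
qed

text \<open>
  For $|j| \ge 2$ the comparison point $a\mu_j/b$ has real part $\pm\frac{\pi}{|b|}(|j| - h)$ and a
  fixed imaginary part. The logarithm of $|X_j|$ therefore exceeds that of this real part by at most
  $O(1/j^2)$ plus a multiple of the $j$-th term of the convergent series. Stirling's bound for the
  remaining sum, taken up to $N \approx |b| R/\pi$ where the terms change sign, gives the main
  term. In both cases of the numbering the indices $|j| \le 1$ and the logarithmic term of
  Stirling's bound combine to one surplus $\ln R$.
\<close>
lemma eigenvalue_family_log_sum:
  fixes a b \<alpha>0 \<alpha> s :: real and X :: "int \<Rightarrow> complex"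
  assumes "a > 0" "b \<noteq> 0" and ne: "(\<alpha>0 - 1) * (1 - \<alpha>) \<noteq> 0"
    and sm: "(\<lambda>j. cmod (X j - a * mu s a \<alpha>0 \<alpha> j / b) / (\<bar>real_of_int j\<bar> + 1)) summable_on Z1 \<alpha>0 \<alpha>"
  obtains C where "\<And>R. R \<ge> 1 \<Longrightarrow> \<exists>F. finite F \<and> F \<subseteq> Z1 \<alpha>0 \<alpha> \<and>
      (\<Sum>j\<in>F. ln (R / nz_norm (X j))) \<ge> 2 * \<bar>b\<bar> * R / pi + ln R - C"
proof -
  define h :: real where "h = (if (\<alpha>0 - 1) * (1 - \<alpha>) > 0 then 1/2 else 1)"
  have h: "h = 1/2 \<or> h = 1" by (simp add: h_def)
  define Z where "Z = Z1 \<alpha>0 \<alpha>"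
  define E where "E = Z \<inter> {-1, 0, 1}"
  have cardE: "real (card E) = 4 - 2 * h"
  proof (cases "(\<alpha>0 - 1) * (1 - \<alpha>) > 0")
    case True
    then have "E = {-1, 0, 1}" by (auto simp: E_def Z_def Z1_def)
    then show ?thesis using True by (simp add: h_def)
  next
    case False
    then have "E = {-1, 1}" using ne by (auto simp: E_def Z_def Z1_def)
    then show ?thesis using False by (simp add: h_def)
  qed
  have finE: "finite E" by (simp add: E_def)
  have big: "j \<in> Z" if "\<bar>j\<bar> \<ge> 2" for j using that by (auto simp: Z_def Z1_def)
  define c where "c = pi / \<bar>b\<bar>"
  have c: "c > 0" using \<open>b \<noteq> 0\<close> by (simp add: c_def)
  \<comment> \<open>Makes $e^{-K} \le c$, a lower bound for all distances $x$ below.\<close>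
  define K where "K = \<bar>ln c\<bar>"
  define y where "y = \<bar>P0 s \<alpha>0 \<alpha> / (2 * b)\<bar>"
  define \<delta> where "\<delta> j = cmod (X j - a * mu s a \<alpha>0 \<alpha> j / b) / (\<bar>real_of_int j\<bar> + 1)" for j
  define D where "D j = 2 * y\<^sup>2 / c\<^sup>2 * (1 / (real_of_int j)\<^sup>2) + (1 + K) * 3 / c * \<delta> j" for j
  \<comment> \<open>The main estimate: $c (|j| - h)$ is the real part of the comparison point up to sign.\<close>
  have lnX: "ln (nz_norm (X j)) \<le> ln c + ln (\<bar>real_of_int j\<bar> - h) + D j" if j: "\<bar>j\<bar> \<ge> 2" for j
  proof -
    define t where "t = \<bar>real_of_int j\<bar>"
    have t: "t \<ge> 2" using j unfolding t_def by linarith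
    have th: "t - h \<ge> t / 2" "t - h \<ge> (t + 1) / 3" "t - h \<ge> 1" using t h by auto
    define x where "x = c * (t - h)"
    have x: "x > 0" using c th t unfolding x_def by (intro mult_pos_pos) auto
    define v where "v = of_real a * mu s a \<alpha>0 \<alpha> j / of_real b"
    have mu: "mu s a \<alpha>0 \<alpha> j = Complex (pi / a * (t - h) * sgn (real_of_int j)) (P0 s \<alpha>0 \<alpha> / (2 * a))"
      using j by (auto simp: mu_def h_def t_def)
    have v: "\<bar>Re v\<bar> = x" "\<bar>Im v\<bar> = y"
      using j th \<open>a > 0\<close> \<open>b \<noteq> 0\<close> t
      by (auto simp: v_def mu x_def c_def y_def abs_mult abs_sgn_eq)
    have "c * 1 \<le> x" unfolding x_def using c th by (intro mult_left_mono) auto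
    then have "ln c \<le> ln x" using c x by simp
    then have "exp (- K) \<le> x" using x unfolding K_def by (subst ln_ge_iff[symmetric]) auto
    then have "ln (nz_norm (X j)) \<le> ln x + y\<^sup>2 / (2 * x\<^sup>2) + (1 + K) * (cmod (X j - v) / x)"
      using x v by (intro ln_nz_norm_le) (auto simp: K_def)
    moreover have "ln x = ln c + ln (t - h)" unfolding x_def using c th t by (intro ln_mult_pos) auto
    moreover have "y\<^sup>2 / (2 * x\<^sup>2) \<le> 2 * y\<^sup>2 / c\<^sup>2 * (1 / (real_of_int j)\<^sup>2)"
    proof -
      have "(c * (t / 2))\<^sup>2 \<le> x\<^sup>2" unfolding x_def using c th t by (intro power_mono mult_left_mono) auto
      then have "y\<^sup>2 / (2 * x\<^sup>2) \<le> y\<^sup>2 / (2 * (c * (t / 2))\<^sup>2)"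
        using c t x by (intro divide_left_mono) auto
      also have "\<dots> = 2 * y\<^sup>2 / c\<^sup>2 * (1 / (real_of_int j)\<^sup>2)"
        using c t by (simp add: t_def field_simps power2_eq_square)
      finally show ?thesis .
    qed
    moreover have "cmod (X j - v) / x \<le> 3 / c * \<delta> j"
    proof -
      have "cmod (X j - v) / x \<le> cmod (X j - v) / (c * ((t + 1) / 3))"
        unfolding x_def using c t th by (intro divide_left_mono mult_left_mono) auto
      then show ?thesis using c t by (simp add: \<delta>_def v_def t_def field_simps)
    qed
    then have "(1 + K) * (cmod (X j - v) / x) \<le> (1 + K) * (3 / c * \<delta> j)"
      by (intro mult_left_mono) (auto simp: K_def)
    ultimately show ?thesis by (simp add: D_def t_def algebra_simps)
  qed
  define S where "S = infsum \<delta> Z"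
  have sumd: "(\<Sum>n=2..N. \<delta> (int n) + \<delta> (- int n)) \<le> S" for N
  proof -
    have "(\<Sum>n=2..N. \<delta> (int n) + \<delta> (- int n)) = sum \<delta> (int ` {2..N}) + sum \<delta> ((\<lambda>n. - int n) ` {2..N})"
      by (subst (1 2) sum.reindex) (auto simp: inj_on_def sum.distrib)
    also have "\<dots> = sum \<delta> (int ` {2..N} \<union> (\<lambda>n. - int n) ` {2..N})"
      by (rule sum.union_disjoint[symmetric]) auto
    also have "\<dots> \<le> S"
      unfolding S_def
    proof (rule finite_sum_le_infsum)
      show "\<delta> summable_on Z" using sm unfolding Z_def \<delta>_def[abs_def] .
    qed (auto intro!: big simp: \<delta>_def)
    finally show ?thesis .
  qed
  have sumD: "(\<Sum>n=2..N. D (int n) + D (- int n)) \<le> 4 * y\<^sup>2 / c\<^sup>2 + (1 + K) * 3 / c * S" for N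
  proof -
    have "(\<Sum>n=2..N. D (int n) + D (- int n)) =
        4 * y\<^sup>2 / c\<^sup>2 * (\<Sum>n=2..N. 1 / (real n)\<^sup>2) + (1 + K) * 3 / c * (\<Sum>n=2..N. \<delta> (int n) + \<delta> (- int n))"
    proof -
      have "D (int n) + D (- int n) = 4 * y\<^sup>2 / c\<^sup>2 * (1 / (real n)\<^sup>2)
          + (1 + K) * 3 / c * (\<delta> (int n) + \<delta> (- int n))" for n
        by (simp add: D_def distrib_left)
      then show ?thesis unfolding sum_distrib_left
        by (subst sum.distrib[symmetric]) (intro sum.cong refl, simp)
    qed
    also have "\<dots> \<le> 4 * y\<^sup>2 / c\<^sup>2 * 1 + (1 + K) * 3 / c * S"
      by (intro add_mono mult_left_mono sumd sum_inverse_squares_le) (use c in \<open>auto simp: K_def\<close>)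
    finally show ?thesis by simp
  qed
  define CE where "CE = (\<Sum>j\<in>E. ln (nz_norm (X j)))"
  define DT where "DT = 4 * y\<^sup>2 / c\<^sup>2 + (1 + K) * 3 / c * S"
  define C where "C = CE + DT + 4 + 2 * (1 + c) + 3 * K"
  show ?thesis
  proof (rule that[of C])
    fix R :: real assume R: "R \<ge> 1"
    define T where "T = R / c"
    have T: "T > 0" "1 / c \<le> T" using R c by (auto simp: T_def divide_right_mono)
    have lnT: "ln T = ln R - ln c" using R c by (simp add: T_def ln_div)
    \<comment> \<open>The terms $\ln (T/(n - h))$ are positive for $n - h < T$, so this cutoff is nearly optimal.\<close>
    define N where "N = nat \<lceil>T\<rceil>"
    have N: "N \<ge> 1" "real N \<ge> T" "real N \<le> T + 1"
      using T unfolding N_def by linarith+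
    define P where "P = {2..N}"
    define F where "F = E \<union> (int ` P \<union> (\<lambda>n. - int n) ` P)"
    have split: "(\<Sum>j\<in>F. f j) = (\<Sum>j\<in>E. f j) + (\<Sum>n=2..N. f (int n) + f (- int n))" for f :: "int \<Rightarrow> real"
    proof -
      have "(\<Sum>j\<in>F. f j) = (\<Sum>j\<in>E. f j) + ((\<Sum>j\<in>int ` P. f j) + (\<Sum>j\<in>(\<lambda>n. - int n) ` P. f j))"
        unfolding F_def using finE
        by (subst sum.union_disjoint, simp, simp add: P_def, force simp: E_def P_def,
            subst sum.union_disjoint) (auto simp: P_def)
      also have "(\<Sum>j\<in>int ` P. f j) + (\<Sum>j\<in>(\<lambda>n. - int n) ` P. f j) = (\<Sum>n=2..N. f (int n) + f (- int n))"
        by (subst (1 2) sum.reindex) (auto simp: inj_on_def sum.distrib P_def)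
      finally show ?thesis .
    qed
    have nzpos: "nz_norm w > 0" for w by (simp add: nz_norm_def)
    have "(\<Sum>j\<in>F. ln (R / nz_norm (X j))) = (\<Sum>j\<in>F. ln R - ln (nz_norm (X j)))"
      using R nzpos by (intro sum.cong refl ln_divide_pos) auto
    also have "\<dots> = real (card E) * ln R - CE
        + (\<Sum>n=2..N. 2 * ln R - (ln (nz_norm (X (int n))) + ln (nz_norm (X (- int n)))))"
    proof -
      have "(\<Sum>j\<in>E. ln R - ln (nz_norm (X j))) = real (card E) * ln R - CE"
        by (simp add: sum_subtractf CE_def)
      moreover have "(\<Sum>n=2..N. ln R - ln (nz_norm (X (int n))) + (ln R - ln (nz_norm (X (- int n)))))
          = (\<Sum>n=2..N. 2 * ln R - (ln (nz_norm (X (int n))) + ln (nz_norm (X (- int n)))))"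
        by (intro sum.cong) auto
      ultimately show ?thesis by (simp only: split)
    qed
    finally have eq: "(\<Sum>j\<in>F. ln (R / nz_norm (X j))) = real (card E) * ln R - CE
        + (\<Sum>n=2..N. 2 * ln R - (ln (nz_norm (X (int n))) + ln (nz_norm (X (- int n)))))" .
    have ge: "(\<Sum>n=2..N. 2 * ln R - (ln (nz_norm (X (int n))) + ln (nz_norm (X (- int n)))))
        \<ge> (\<Sum>n=2..N. 2 * ln T - 2 * ln (real n - h) - (D (int n) + D (- int n)))"
    proof (rule sum_mono)
      fix n assume n: "n \<in> {2..N}"
      show "2 * ln T - 2 * ln (real n - h) - (D (int n) + D (- int n))
          \<le> 2 * ln R - (ln (nz_norm (X (int n))) + ln (nz_norm (X (- int n))))"
        using lnX[of "int n"] lnX[of "- int n"] n unfolding lnT by simp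
    qed
    have "(\<Sum>n=2..N. 2 * ln T - 2 * ln (real n - h) - (D (int n) + D (- int n)))
        = 2 * (real N - 1) * ln T - 2 * (\<Sum>n=2..N. ln (real n - h)) - (\<Sum>n=2..N. D (int n) + D (- int n))"
      using N by (simp add: sum_subtractf sum_distrib_left of_nat_diff)
    then have low: "(\<Sum>j\<in>F. ln (R / nz_norm (X j))) \<ge> real (card E) * ln R - CE
        + (2 * (real N - 1) * ln T - 2 * (\<Sum>n=2..N. ln (real n - h)) - (\<Sum>n=2..N. D (int n) + D (- int n)))"
      unfolding eq using ge by (smt (verit))
    have stir: "(\<Sum>n=2..N. ln (real n - h)) \<le> real N * ln (real N) - real N + 2 - (h - 1/2) * ln (real N)"
      by (rule sum_ln_shift_le[OF N(1) h])
    have main: "real N * (ln T - ln (real N)) \<ge> - (1 + c)"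
    proof -
      have "ln (real N / T) \<le> real N / T - 1"
        using N T by (intro ln_le_minus_one) auto
      then have "ln T - ln (real N) \<ge> - ((real N - T) / T)"
        using N T by (simp add: ln_div field_simps)
      moreover have "(real N - T) / T \<le> 1 / T" using N T by (intro divide_right_mono) auto
      ultimately have "- (1 / T) \<le> ln T - ln (real N)" by linarith
      then have "real N * (- (1 / T)) \<le> real N * (ln T - ln (real N))" by (intro mult_left_mono) auto
      moreover have "real N * (1 / T) \<le> (T + 1) * (1 / T)" using N T by (intro mult_right_mono) auto
      moreover have "(T + 1) * (1 / T) = 1 + 1 / T" using T by (simp add: field_simps)
      moreover have "1 / T \<le> c" using T c by (simp add: field_simps)
      ultimately show ?thesis by linarith
    qed
    have lnN: "ln (real N) \<ge> ln T" using N T by (intro ln_mono) auto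
    have Kc: "\<bar>ln c\<bar> = K" by (simp add: K_def)
    \<comment> \<open>Three indices with shift $1/2$ or two with shift $1$ give the same surplus.\<close>
    have hN: "real (card E) * ln R - 2 * ln T + 2 * (h - 1/2) * ln (real N) \<ge> ln R - 3 * K"
      using h
    proof
      assume h: "h = 1/2" show ?thesis unfolding cardE lnT h using Kc by simp
    next
      assume h: "h = 1" show ?thesis unfolding cardE h using Kc lnN lnT by simp
    qed
    define U where "U = real N * ln T"
    define V where "V = real N * ln (real N)"
    define Q where "Q = (h - 1/2) * ln (real N)"
    have "2 * (real N - 1) * ln T = 2 * U - 2 * ln T" by (simp add: U_def algebra_simps)
    note low' = low[unfolded this]
    have "U - V \<ge> - (1 + c)" using main by (simp add: U_def V_def algebra_simps)
    moreover have "(\<Sum>n=2..N. ln (real n - h)) \<le> V - real N + 2 - Q" using stir by (simp add: V_def Q_def)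
    moreover have "real (card E) * ln R - 2 * ln T + 2 * Q \<ge> ln R - 3 * K"
      using hN unfolding Q_def by (simp only: mult.assoc)
    moreover have "(\<Sum>n=2..N. D (int n) + D (- int n)) \<le> DT" using sumD[of N] by (simp add: DT_def)
    ultimately have "2 * T + ln R - C \<le> (\<Sum>j\<in>F. ln (R / nz_norm (X j)))"
      using low' N(2) unfolding C_def by (smt (verit))
    moreover have "2 * \<bar>b\<bar> * R / pi = 2 * T" using \<open>b \<noteq> 0\<close> by (simp add: T_def c_def)
    ultimately have "2 * \<bar>b\<bar> * R / pi + ln R - C \<le> (\<Sum>j\<in>F. ln (R / nz_norm (X j)))"
      by simp
    moreover have "finite F" using finE by (simp add: F_def P_def)
    moreover have "F \<subseteq> Z"
      unfolding F_def by (intro Un_least image_subsetI big) (auto simp: E_def P_def)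
    ultimately show "\<exists>F. finite F \<and> F \<subseteq> Z1 \<alpha>0 \<alpha> \<and>
      (\<Sum>j\<in>F. ln (R / nz_norm (X j))) \<ge> 2 * \<bar>b\<bar> * R / pi + ln R - C"
      unfolding Z_def by blast
  qed
qed

section \<open>Entire functions with too many zeros\<close>

text \<open>
  Jensen's inequality compares two sides that are both linear in $R$, and the hypothesis on the
  types makes the zeros win at linear order or tie. In the tie the logarithmic terms decide: the
  families bring $2 \ln R$, and the subtraction in the order at $0$ costs one $\ln R$.
\<close>
lemma entire_zero_if_too_many_zeros:
  fixes Xp Xm :: "int \<Rightarrow> complex" and b bp bm K :: real
  assumes hol: "W holomorphic_on UNIV" and b: "b > 0" and types: "\<bar>bp\<bar> + \<bar>bm\<bar> \<ge> 2 * b"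
    and growth: "\<And>l. cmod l \<ge> 1 \<Longrightarrow> cmod (W l) \<le> K * (1 + cmod l + exp (2 * b * \<bar>Im l\<bar>))"
    and fin: "\<And>w. finite {j \<in> Zp. Xp j = w}" "\<And>w. finite {j \<in> Zm. Xm j = w}"
    and van: "\<And>w. w \<noteq> 0 \<Longrightarrow> vanishes_to_order W w (card {j \<in> Zp. Xp j = w} + card {j \<in> Zm. Xm j = w})"
    and van0: "vanishes_to_order W 0 (card {j \<in> Zp. Xp j = 0} + card {j \<in> Zm. Xm j = 0} - 1)"
    and low_p: "\<And>R. R \<ge> 1 \<Longrightarrow> \<exists>F. finite F \<and> F \<subseteq> Zp \<and>
      (\<Sum>j\<in>F. ln (R / nz_norm (Xp j))) \<ge> 2 * \<bar>bp\<bar> * R / pi + ln R - Cp"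
    and low_m: "\<And>R. R \<ge> 1 \<Longrightarrow> \<exists>F. finite F \<and> F \<subseteq> Zm \<and>
      (\<Sum>j\<in>F. ln (R / nz_norm (Xm j))) \<ge> 2 * \<bar>bm\<bar> * R / pi + ln R - Cm"
  shows "W l = 0"
proof (rule ccontr)
  assume "W l \<noteq> 0"
  then obtain m g where g: "g holomorphic_on UNIV" "g 0 \<noteq> 0" and Wg: "\<And>z. W z = (z - 0) ^ m * g z"
    using entire_factor_zero[OF hol, of l 0] by metis
  define n where "n = card {j \<in> Zp. Xp j = 0} + card {j \<in> Zm. Xm j = 0}"
  have nm: "n \<le> m + 1"
    using vanishes_to_order_le[OF van0 g Wg] by (simp add: n_def)
  define K1 where "K1 = max K 1"
  have K1: "K1 > 0" "K \<le> K1" by (auto simp: K1_def)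
  have bound: "ln R \<le> ln K1 + 8 / b + Cp + Cm - ln (cmod (g 0))" if R: "R \<ge> 1" for R
  proof -
    have R0: "R > 0" using R by simp
    obtain Fp where Fp: "finite Fp" "Fp \<subseteq> Zp" "(\<Sum>j\<in>Fp. ln (R / nz_norm (Xp j))) \<ge> 2 * \<bar>bp\<bar> * R / pi + ln R - Cp"
      using low_p[OF R] by blast
    obtain Fm where Fm: "finite Fm" "Fm \<subseteq> Zm" "(\<Sum>j\<in>Fm. ln (R / nz_norm (Xm j))) \<ge> 2 * \<bar>bm\<bar> * R / pi + ln R - Cm"
      using low_m[OF R] by blast
    \<comment> \<open>Removing the zeros at the origin costs $\ln R$ for each of them.\<close>
    have nonzero: "(\<Sum>j\<in>{j \<in> F. X j \<noteq> 0}. ln (R / cmod (X j))) \<ge> (\<Sum>j\<in>F. ln (R / nz_norm (X j))) - card {j \<in> Z. X j = 0} * ln R"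
      if "finite F" "F \<subseteq> Z" "finite {j \<in> Z. X j = 0}" for F Z :: "int set" and X :: "int \<Rightarrow> complex"
    proof -
      have "(\<Sum>j\<in>F. ln (R / nz_norm (X j))) = (\<Sum>j\<in>{j \<in> F. X j \<noteq> 0}. ln (R / nz_norm (X j))) + (\<Sum>j\<in>{j \<in> F. X j = 0}. ln (R / nz_norm (X j)))"
        using that(1) by (subst sum.union_disjoint[symmetric]) (auto intro!: sum.cong)
      also have "(\<Sum>j\<in>{j \<in> F. X j = 0}. ln (R / nz_norm (X j))) = card {j \<in> F. X j = 0} * ln R"
        by (simp add: nz_norm_def)
      also have "\<dots> \<le> card {j \<in> Z. X j = 0} * ln R"
        using R that by (intro mult_right_mono of_nat_mono card_mono) auto
      also have "(\<Sum>j\<in>{j \<in> F. X j \<noteq> 0}. ln (R / nz_norm (X j))) = (\<Sum>j\<in>{j \<in> F. X j \<noteq> 0}. ln (R / cmod (X j)))"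
        by (intro sum.cong) (auto simp: nz_norm_def)
      finally show ?thesis by simp
    qed
    define I where "I = {j \<in> Fp. Xp j \<noteq> 0} <+> {j \<in> Fm. Xm j \<noteq> 0}"
    define x where "x = case_sum Xp Xm"
    have finI: "finite I" using Fp Fm by (simp add: I_def)
    obtain h where h: "h holomorphic_on UNIV" "\<And>z. g z = (\<Prod>i\<in>I. z - x i) * h z"
    proof (rule entire_factor_family[OF g(1) finI])
      fix w assume w: "w \<in> x ` I"
      then have w0: "w \<noteq> 0" by (auto simp: I_def x_def)
      have "vanishes_to_order g w (card {j \<in> Zp. Xp j = w} + card {j \<in> Zm. Xm j = w})"
        by (rule vanishes_to_order_quotient[OF van[OF w0] _ _ g(1) Wg]) (use w0 in \<open>auto intro!: holomorphic_intros\<close>)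
      moreover have "card {i \<in> I. x i = w} \<le> card {j \<in> Zp. Xp j = w} + card {j \<in> Zm. Xm j = w}"
      proof -
        have "{i \<in> I. x i = w} \<subseteq> {j \<in> Zp. Xp j = w} <+> {j \<in> Zm. Xm j = w}"
          using Fp(2) Fm(2) by (auto simp: I_def x_def)
        from card_mono[OF _ this] show ?thesis using fin by (simp add: card_Plus)
      qed
      ultimately show "vanishes_to_order g w (card {i \<in> I. x i = w})" by (rule vanishes_to_order_mono)
    qed blast
    define A where "A = 2 * b * R"
    have A: "A > 0" using b R by (simp add: A_def)
    define c0 where "c0 = ln K1 - m * ln R"
    \<comment> \<open>From $K (1 + R + E) \le K E \exp ((1 + R)/E)$ with $E = e^{A |\sin t|}$; dividing out the zero at the origin gives $- m \ln R$.\<close>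
    define \<phi> where "\<phi> t = c0 + A * \<bar>sin t\<bar> + (1 + R) * exp (- (A * \<bar>sin t\<bar>))" for t
    have "ln (cmod (g 0)) + (\<Sum>i\<in>I. ln (R / cmod (x i))) \<le> integral {0..2*pi} \<phi> / (2 * pi)"
    proof (rule jensen_inequality[OF finI h g(2) R0])
      show "continuous_on UNIV \<phi>" unfolding \<phi>_def by (intro continuous_intros)
      show "\<phi> (t + 2 * pi) = \<phi> t" for t by (simp add: \<phi>_def)
      fix t
      define z where "z = of_real R * cis t"
      have z: "cmod z = R" "\<bar>Im z\<bar> = R * \<bar>sin t\<bar>" using R0 by (auto simp: z_def norm_mult abs_mult)
      define E where "E = exp (A * \<bar>sin t\<bar>)"
      have E: "E > 0" "exp (- (A * \<bar>sin t\<bar>)) = 1 / E" by (simp_all add: E_def exp_minus inverse_eq_divide)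
      have "R ^ m * cmod (g z) = cmod (W z)" using z by (simp add: Wg norm_mult norm_power)
      also have "\<dots> \<le> K * (1 + R + E)" using growth[of z] z R by (simp add: A_def E_def mult.assoc)
      also have "\<dots> \<le> K1 * (1 + R + E)" using K1 R E by (intro mult_right_mono) auto
      also have "\<dots> = K1 * E * (1 + (1 + R) / E)" using E by (simp add: field_simps)
      also have "\<dots> \<le> K1 * E * exp ((1 + R) / E)"
        using K1 E by (intro mult_left_mono exp_ge_add_one_self) auto
      also have "\<dots> = R ^ m * exp (\<phi> t)"
      proof -
        have "R ^ m * exp (\<phi> t) = R ^ m * (exp (ln K1) / exp (m * ln R) * E * exp ((1 + R) / E))"
          by (simp add: \<phi>_def c0_def exp_add exp_diff E E_def[symmetric])
        then show ?thesis using K1 R0 by (simp add: exp_of_nat_mult)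
      qed
      finally show "cmod (g (of_real R * cis t)) \<le> exp (\<phi> t)" using R0 by (simp add: z_def)
    qed
    also have "\<dots> \<le> c0 + 2 * A / pi + 8 * (1 + R) / A"
      unfolding \<phi>_def[abs_def] by (rule circle_mean_le[OF A]) (use R in simp)
    also have "8 * (1 + R) / A \<le> 8 / b"
      using b R by (simp add: A_def field_simps)
    finally have J: "ln (cmod (g 0)) + (\<Sum>i\<in>I. ln (R / cmod (x i))) \<le> ln K1 - m * ln R + 4 * b * R / pi + 8 / b"
      by (simp add: c0_def A_def)
    have "(\<Sum>i\<in>I. ln (R / cmod (x i))) = (\<Sum>j\<in>{j \<in> Fp. Xp j \<noteq> 0}. ln (R / cmod (Xp j))) + (\<Sum>j\<in>{j \<in> Fm. Xm j \<noteq> 0}. ln (R / cmod (Xm j)))"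
      unfolding I_def using Fp(1) Fm(1) by (subst sum.Plus) (auto simp: x_def)
    then have S: "(\<Sum>i\<in>I. ln (R / cmod (x i))) \<ge> 2 * \<bar>bp\<bar> * R / pi + 2 * \<bar>bm\<bar> * R / pi + 2 * ln R - Cp - Cm - n * ln R"
      using nonzero[OF Fp(1,2) fin(1)] nonzero[OF Fm(1,2) fin(2)] Fp(3) Fm(3)
      by (simp add: n_def distrib_right)
    have "4 * b * R / pi \<le> 2 * \<bar>bp\<bar> * R / pi + 2 * \<bar>bm\<bar> * R / pi"
    proof -
      have "(2 * b) * (2 * R / pi) \<le> (\<bar>bp\<bar> + \<bar>bm\<bar>) * (2 * R / pi)" using types R0 by (intro mult_right_mono) auto
      moreover have "(2 * b) * (2 * R / pi) = 4 * b * R / pi" by simp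
      moreover have "(\<bar>bp\<bar> + \<bar>bm\<bar>) * (2 * R / pi) = 2 * \<bar>bp\<bar> * R / pi + 2 * \<bar>bm\<bar> * R / pi"
        by (simp add: field_simps)
      ultimately show ?thesis by simp
    qed
    moreover have "n * ln R \<le> (m + 1) * ln R"
    proof -
      have "real n \<le> real m + 1" using nm by linarith
      then show ?thesis using R by (intro mult_right_mono) auto
    qed
    moreover have "(m + 1) * ln R = m * ln R + ln R" by (simp add: distrib_right)
    ultimately show ?thesis using J S by linarith
  qed
  define C where "C = ln K1 + 8 / b + Cp + Cm - ln (cmod (g 0))"
  have "ln (exp (\<bar>C\<bar> + 1)) \<le> C" unfolding C_def by (rule bound) simp
  then show False by simp
qed

section \<open>Square integrable potentials and integration by parts\<close>

text \<open>
  Integrability of the square makes exponentially weighted integrals of $|p|$ small in a quantitative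
  way.
\<close>
definition potential :: "real \<Rightarrow> (real \<Rightarrow> complex) \<Rightarrow> bool" where
  "potential L p \<longleftrightarrow> p absolutely_integrable_on {0..L} \<and> (\<lambda>t. (cmod (p t))\<^sup>2) integrable_on {0..L}"

lemma absolutely_integrable_mult_continuous:
  fixes p g :: "real \<Rightarrow> complex"
  assumes "p absolutely_integrable_on {a..b}" "continuous_on {a..b} g"
  shows "(\<lambda>t. p t * g t) absolutely_integrable_on {a..b}"
proof -
  have "(\<lambda>t. g t * p t) absolutely_integrable_on {a..b}"
  proof (rule absolutely_integrable_bounded_measurable_product[OF bilinear_times _ _ _ assms(1)])
    show "g \<in> borel_measurable (lebesgue_on {a..b})"
      using assms(2) by (rule continuous_imp_measurable_on_sets_lebesgue) simp
    show "bounded (g ` {a..b})"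
      using compact_continuous_image[OF assms(2)] compact_imp_bounded by blast
  qed simp
  then show ?thesis by (simp add: mult.commute)
qed

lemma potential_subinterval:
  assumes "potential L p" "b \<le> L"
  shows "potential b p"
proof -
  have "p absolutely_integrable_on {0..b}"
    using absolutely_integrable_on_subinterval[where S = "{0..L}" and f = p and a = 0 and b = b] assms by (auto simp: potential_def)
  moreover have "(\<lambda>t. (cmod (p t))\<^sup>2) integrable_on {0..b}"
    using integrable_on_subinterval[of "\<lambda>t. (cmod (p t))\<^sup>2" "{0..L}" 0 b] assms by (auto simp: potential_def)
  ultimately show ?thesis by (simp add: potential_def)
qed

lemma potential_absolutely_integrable:
  assumes "potential L p" "x \<in> {0..L}"
  shows "p absolutely_integrable_on {0..x}"
  using potential_subinterval[of L p x] assms by (simp add: potential_def)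

lemma potential_mult_integrable:
  assumes "potential L p" "x \<in> {0..L}" "continuous_on {0..x} g"
  shows "(\<lambda>t. p t * g t) integrable_on {0..x}" "(\<lambda>t. cmod (p t) * cmod (g t)) integrable_on {0..x}"
  using absolutely_integrable_mult_continuous[OF potential_absolutely_integrable[OF assms(1,2)] assms(3)]
  by (simp_all add: absolutely_integrable_on_def norm_mult)

lemma potential_add_const:
  assumes "potential L p"
  shows "potential L (\<lambda>t. p t + c)"
proof -
  have "(\<lambda>t. p t + c) absolutely_integrable_on {0..L}"
    using assms by (intro set_integral_add(1) absolutely_integrable_continuous_real[of _ _ "\<lambda>t. c"])
      (auto simp: potential_def)
  moreover have "(\<lambda>t. (cmod (p t + c))\<^sup>2) integrable_on {0..L}"
  proof (rule measurable_bounded_by_integrable_imp_integrable)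
    have "p \<in> borel_measurable (lebesgue_on {0..L})"
      using assms by (auto simp: potential_def intro: absolutely_integrable_imp_borel_measurable)
    then show "(\<lambda>t. (cmod (p t + c))\<^sup>2) \<in> borel_measurable (lebesgue_on {0..L})"
      by measurable
    show "(\<lambda>t. 2 * (cmod (p t))\<^sup>2 + 2 * (cmod c)\<^sup>2) integrable_on {0..L}"
      using assms by (intro integrable_add integrable_on_cmult_left) (auto simp: potential_def)
    fix t
    have "(cmod (p t + c))\<^sup>2 \<le> (cmod (p t) + cmod c)\<^sup>2"
      by (intro power_mono norm_triangle_ineq) auto
    also have "\<dots> \<le> 2 * (cmod (p t))\<^sup>2 + 2 * (cmod c)\<^sup>2"
      using sum_squares_bound[of "cmod (p t)" "cmod c"] by (simp add: power2_sum)
    finally show "norm ((cmod (p t + c))\<^sup>2) \<le> 2 * (cmod (p t))\<^sup>2 + 2 * (cmod c)\<^sup>2" by simp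
  qed simp
  ultimately show ?thesis by (simp add: potential_def)
qed

lemma has_integral_reflect_interval:
  fixes f :: "real \<Rightarrow> 'b::euclidean_space"
  assumes "(f has_integral i) {c..d}"
  shows "((\<lambda>t. f (L - t)) has_integral i) {L - d..L - c}"
proof -
  have "((\<lambda>t. f (- 1 *\<^sub>R t + L)) has_integral (1 / \<bar>- 1\<bar> ^ DIM(real)) *\<^sub>R i) ((\<lambda>t. (1 / - 1) *\<^sub>R t + - ((1 / - 1) *\<^sub>R L)) ` cbox c d)"
    using assms by (intro has_integral_affinity) auto
  moreover have "(\<lambda>t. (1 / - 1) *\<^sub>R t + - ((1 / - 1) *\<^sub>R L)) ` cbox c d = {L - d..L - c}"
    by (auto simp: image_iff intro!: bexI[of _ "L - _"])
  ultimately show ?thesis by simp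
qed

lemma potential_reflect:
  assumes "potential L p"
  shows "potential L (\<lambda>t. p (L - t))"
proof -
  have "(\<lambda>t. p (L - t)) integrable_on {0..L}"
    using assms has_integral_reflect_interval[of p _ 0 L L]
    unfolding potential_def absolutely_integrable_on_def by fastforce
  moreover have "(\<lambda>t. cmod (p (L - t))) integrable_on {0..L}"
    using assms has_integral_reflect_interval[of "\<lambda>t. cmod (p t)" _ 0 L L]
    unfolding potential_def absolutely_integrable_on_def by fastforce
  moreover have "(\<lambda>t. (cmod (p (L - t)))\<^sup>2) integrable_on {0..L}"
    using assms has_integral_reflect_interval[of "\<lambda>t. (cmod (p t))\<^sup>2" _ 0 L L]
    unfolding potential_def by fastforce
  ultimately show ?thesis
    unfolding potential_def absolutely_integrable_on_def by auto
qed

lemma has_integral_norm_le: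
  fixes f :: "real \<Rightarrow> complex"
  assumes "(f has_integral i) S" "(g has_integral j) S" "\<And>x. x \<in> S \<Longrightarrow> cmod (f x) \<le> g x"
  shows "cmod i \<le> j"
  using integral_norm_bound_integral[of f S g] assms by (auto simp: has_integral_iff)

text \<open>
  Weights $e^{Mt}$ turn the integral operators of the theory into contractions. In
  $|p| e^{M (t - x)} \le d |p|^2 + e^{2M (t - x)}/(4d)$ the first part has a small integral for small
  $d$, and the second part, a pure exponential, for large $M$.
\<close>
lemma exp_weighted_integral_le:
  assumes p: "potential L p" and "e > 0"
  obtains M0 where "M0 > 0" "\<And>M x. M \<ge> M0 \<Longrightarrow> x \<in> {0..L} \<Longrightarrow>
    integral {0..x} (\<lambda>t. cmod (p t) * exp (M * t)) \<le> e * exp (M * x)"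
proof -
  define Q where "Q = integral {0..L} (\<lambda>t. (cmod (p t))\<^sup>2)"
  have Q: "Q \<ge> 0" unfolding Q_def by (rule integral_nonneg) (use p in \<open>auto simp: potential_def\<close>)
  \<comment> \<open>This $d$ gives the quadratic part half of the allowance, and $M_0$ the exponential part.\<close>
  define d where "d = e / (2 * (Q + 1))"
  have d: "d > 0" "d * Q \<le> e / 2" using Q \<open>e > 0\<close> by (auto simp: d_def field_simps)
  define M0 where "M0 = 1 / (4 * d * e)"
  have M0: "M0 > 0" using d \<open>e > 0\<close> by (simp add: M0_def)
  show ?thesis
  proof (rule that[OF M0])
    fix M x :: real assume M: "M \<ge> M0" and x: "x \<in> {0..L}"
    then have M0': "M > 0" using M0 by linarith
    have sq: "(\<lambda>t. (cmod (p t))\<^sup>2) integrable_on {0..x}"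
      using potential_subinterval[of L p x] p x by (simp add: potential_def)
    have Qx: "integral {0..x} (\<lambda>t. (cmod (p t))\<^sup>2) \<le> Q"
      unfolding Q_def by (rule integral_subset_le) (use sq p x in \<open>auto simp: potential_def\<close>)
    have ex: "((\<lambda>t. exp (2 * M * t - M * x)) has_integral (exp (M * x) / (2 * M) - exp (- (M * x)) / (2 * M))) {0..x}"
    proof -
      have "((\<lambda>t. exp (2 * M * t - M * x)) has_integral
          (exp (2 * M * x - M * x) / (2 * M) - exp (2 * M * 0 - M * x) / (2 * M))) {0..x}"
        using x M0' by (intro fundamental_theorem_of_calculus)
          (auto simp: has_real_derivative_iff_has_vector_derivative[symmetric] intro!: derivative_eq_intros)
      then show ?thesis by (simp add: algebra_simps)
    qed
    have "integral {0..x} (\<lambda>t. cmod (p t) * exp (M * t))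
      \<le> integral {0..x} (\<lambda>t. d * exp (M * x) * (cmod (p t))\<^sup>2 + exp (2 * M * t - M * x) / (4 * d))"
    proof (rule integral_le)
      show "(\<lambda>t. cmod (p t) * exp (M * t)) integrable_on {0..x}"
        using potential_mult_integrable(2)[OF p x, of "\<lambda>t. of_real (exp (M * t))"]
        by (simp add: continuous_intros)
      show "(\<lambda>t. d * exp (M * x) * (cmod (p t))\<^sup>2 + exp (2 * M * t - M * x) / (4 * d)) integrable_on {0..x}"
        using sq ex by (intro integrable_add integrable_on_divide integrable_on_mult_right) auto
      fix t
      have "0 \<le> d * (cmod (p t) - exp (M * t - M * x) / (2 * d))\<^sup>2" using d by simp
      also have "\<dots> = d * (cmod (p t))\<^sup>2 - cmod (p t) * exp (M * t - M * x) + (exp (M * t - M * x))\<^sup>2 / (4 * d)"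
        using d by (simp add: power2_eq_square field_simps)
      finally have "exp (M * x) * (cmod (p t) * exp (M * t - M * x))
        \<le> exp (M * x) * (d * (cmod (p t))\<^sup>2 + (exp (M * t - M * x))\<^sup>2 / (4 * d))"
        by (intro mult_left_mono) auto
      also have "exp (M * x) * (cmod (p t) * exp (M * t - M * x)) = cmod (p t) * exp (M * t)"
        by (simp add: exp_diff)
      also have "exp (M * x) * (d * (cmod (p t))\<^sup>2 + (exp (M * t - M * x))\<^sup>2 / (4 * d))
        = d * exp (M * x) * (cmod (p t))\<^sup>2 + exp (2 * M * t - M * x) / (4 * d)"
      proof -
        have "exp (M * x) * (exp (M * t - M * x))\<^sup>2 = exp (2 * M * t - M * x)"
          by (simp add: power2_eq_square exp_add[symmetric])
        then show ?thesis by (simp add: distrib_left)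
      qed
      finally show "cmod (p t) * exp (M * t) \<le> d * exp (M * x) * (cmod (p t))\<^sup>2 + exp (2 * M * t - M * x) / (4 * d)" .
    qed
    also have "\<dots> = d * exp (M * x) * integral {0..x} (\<lambda>t. (cmod (p t))\<^sup>2)
        + (exp (M * x) / (2 * M) - exp (- (M * x)) / (2 * M)) / (4 * d)"
    proof (rule integral_unique, rule has_integral_add)
      show "((\<lambda>t. d * exp (M * x) * (cmod (p t))\<^sup>2) has_integral d * exp (M * x) * integral {0..x} (\<lambda>t. (cmod (p t))\<^sup>2)) {0..x}"
        using sq by (intro has_integral_mult_right) (simp add: has_integral_integral)
      show "((\<lambda>t. exp (2 * M * t - M * x) / (4 * d)) has_integral (exp (M * x) / (2 * M) - exp (- (M * x)) / (2 * M)) / (4 * d)) {0..x}"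
        using ex by (rule has_integral_divide)
    qed
    also have "\<dots> \<le> exp (M * x) * (e / 2) + exp (M * x) * (e / 2)"
    proof (rule add_mono)
      have "d * integral {0..x} (\<lambda>t. (cmod (p t))\<^sup>2) \<le> d * Q" using Qx d by (intro mult_left_mono) auto
      then have "d * integral {0..x} (\<lambda>t. (cmod (p t))\<^sup>2) \<le> e / 2" using d by linarith
      then have "exp (M * x) * (d * integral {0..x} (\<lambda>t. (cmod (p t))\<^sup>2)) \<le> exp (M * x) * (e / 2)"
        by (intro mult_left_mono) auto
      then show "d * exp (M * x) * integral {0..x} (\<lambda>t. (cmod (p t))\<^sup>2) \<le> exp (M * x) * (e / 2)"
        by (simp add: mult_ac)
      have le: "1 / (2 * M * (4 * d)) \<le> e / 2"
        using M M0' d \<open>e > 0\<close> by (simp add: M0_def field_simps)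
      have "(exp (M * x) / (2 * M) - exp (- (M * x)) / (2 * M)) / (4 * d) \<le> exp (M * x) / (2 * M) / (4 * d)"
        using M0' d by (intro divide_right_mono) auto
      also have "\<dots> = exp (M * x) * (1 / (2 * M * (4 * d)))" by simp
      also have "\<dots> \<le> exp (M * x) * (e / 2)" by (intro mult_left_mono le) simp
      finally show "(exp (M * x) / (2 * M) - exp (- (M * x)) / (2 * M)) / (4 * d) \<le> exp (M * x) * (e / 2)" .
    qed
    finally show "integral {0..x} (\<lambda>t. cmod (p t) * exp (M * t)) \<le> e * exp (M * x)" by simp
  qed
qed

lemma has_integral_increment:
  fixes f :: "real \<Rightarrow> 'a::banach"
  assumes F: "\<And>t. t \<in> {0..L} \<Longrightarrow> (f has_integral F t) {0..t}" and st: "0 \<le> s" "s \<le> t" "t \<le> L"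
  shows "(f has_integral (F t - F s)) {s..t}"
proof -
  have ft: "(f has_integral F t) {0..t}" and fs: "(f has_integral F s) {0..s}" using F st by auto
  have int: "f integrable_on {s..t}"
    by (rule integrable_on_subinterval[OF has_integral_integrable[OF ft]]) (use st in auto)
  have "F s + integral {s..t} f = F t"
    using has_integral_combine[OF st(1,2) fs integrable_integral[OF int]] ft by (rule has_integral_unique)
  then have "integral {s..t} f = F t - F s" by (metis add_diff_cancel_left')
  then show ?thesis using int by (simp add: has_integral_iff)
qed

text \<open>
  Over a partition into $n$ equal pieces the total increment is at most
  $C \frac{x}{n} (A(x) - A(0))$, which tends to zero. This replaces a vanishing derivative for
  functions that are only indefinite integrals.
\<close>
lemma eq_endpoints_if_superlinear:
  fixes H :: "real \<Rightarrow> complex" and A :: "real \<Rightarrow> real"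
  assumes "x \<ge> 0" and le: "\<And>s t. 0 \<le> s \<Longrightarrow> s \<le> t \<Longrightarrow> t \<le> x \<Longrightarrow> cmod (H t - H s) \<le> C * (t - s) * (A t - A s)"
  shows "H x = H 0"
proof -
  have "cmod (H x - H 0) \<le> C * x * (A x - A 0) / real n" if n: "n > 0" for n
  proof -
    define s where "s k = x * real k / real n" for k
    have "H x - H 0 = (\<Sum>k<n. H (s (Suc k)) - H (s k))"
      using n by (simp add: sum_lessThan_telescope[of "\<lambda>k. H (s k)"]) (simp add: s_def)
    also have "cmod \<dots> \<le> (\<Sum>k<n. C * (x / real n) * (A (s (Suc k)) - A (s k)))"
    proof (rule sum_norm_le)
      fix k assume k: "k \<in> {..<n}"
      have "cmod (H (s (Suc k)) - H (s k)) \<le> C * (s (Suc k) - s k) * (A (s (Suc k)) - A (s k))"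
      proof (rule le)
        show "0 \<le> s k" using \<open>x \<ge> 0\<close> by (simp add: s_def)
        show "s k \<le> s (Suc k)" unfolding s_def using \<open>x \<ge> 0\<close> by (intro divide_right_mono mult_left_mono) auto
        have "x * real (Suc k) \<le> x * real n" using k \<open>x \<ge> 0\<close> by (intro mult_left_mono) auto
        then show "s (Suc k) \<le> x" using n by (simp add: s_def field_simps)
      qed
      also have "s (Suc k) - s k = x / real n" using n by (simp add: s_def field_simps)
      finally show "cmod (H (s (Suc k)) - H (s k)) \<le> C * (x / real n) * (A (s (Suc k)) - A (s k))" .
    qed
    also have "\<dots> = C * (x / real n) * (A (s n) - A (s 0))"
      by (simp only: sum_distrib_left[symmetric] sum_lessThan_telescope[of "\<lambda>k. A (s k)"])
    also have "\<dots> = C * x * (A x - A 0) / real n" using n by (simp add: s_def)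
    finally show ?thesis .
  qed
  then have ev: "\<forall>\<^sub>F n in sequentially. cmod (H x - H 0) \<le> C * x * (A x - A 0) / real n"
    by (intro eventually_mono[OF eventually_gt_at_top[of "0::nat"]])
  have "(\<lambda>n. C * x * (A x - A 0) / real n) \<longlonglongrightarrow> 0"
    by (rule lim_const_over_n)
  then have "cmod (H x - H 0) \<le> 0"
    using ev by (rule tendsto_lowerbound) simp
  then show ?thesis by simp
qed

text \<open>
  Integration by parts for an indefinite integral $F$ of an absolutely integrable $f$ and a
  continuously differentiable $G$. On a short interval the difference of both sides is an integral of
  $f(r) (G(t) - G(r)) + (F(s) - F(r)) G'(r)$, hence bounded by the length times the increment of
  $\int |f|$; no differentiation of $F$ is involved.
\<close>
lemma has_integral_product_rule:
  fixes F G f G' :: "real \<Rightarrow> complex"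
  assumes f: "f absolutely_integrable_on {0..L}"
    and F: "\<And>x. x \<in> {0..L} \<Longrightarrow> (f has_integral (F x - F 0)) {0..x}"
    and G: "\<And>x. x \<in> {0..L} \<Longrightarrow> (G has_vector_derivative G' x) (at x within {0..L})"
    and G': "continuous_on {0..L} G'" and x: "x \<in> {0..L}"
  shows "((\<lambda>t. f t * G t + F t * G' t) has_integral (F x * G x - F 0 * G 0)) {0..x}"
proof -
  have x0: "0 \<le> x" "x \<le> L" using x by auto
  have contG: "continuous_on {0..L} G"
    unfolding continuous_on_eq_continuous_within using G has_vector_derivative_continuous by blast
  have fint: "f integrable_on {s..t}" "(\<lambda>r. cmod (f r)) integrable_on {s..t}" if "0 \<le> s" "t \<le> L" for s t
    using absolutely_integrable_on_subinterval[OF f] that by (auto simp: absolutely_integrable_on_def)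
  have Fdiff: "(f has_integral (F t - F s)) {s..t}" if "0 \<le> s" "s \<le> t" "t \<le> L" for s t
    using has_integral_increment[OF F that] by simp
  have contF: "continuous_on {0..L} F"
  proof (rule continuous_on_eq)
    show "continuous_on {0..L} (\<lambda>x. F 0 + integral {0..x} f)"
      by (intro continuous_intros indefinite_integral_continuous_1 fint) auto
  qed (simp add: integral_unique[OF F])
  define A where "A t = integral {0..t} (\<lambda>r. cmod (f r))" for t
  have Adiff: "((\<lambda>r. cmod (f r)) has_integral (A t - A s)) {s..t}" if "0 \<le> s" "s \<le> t" "t \<le> L" for s t
    by (rule has_integral_increment[OF _ that]) (simp add: A_def integrable_integral fint)
  obtain B where B: "\<forall>t\<in>{0..L}. cmod (G' t) \<le> B"
    using compact_imp_bounded[OF compact_continuous_image[OF G' compact_Icc]] by (auto simp: bounded_iff)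
  then have B0: "B \<ge> 0" using x by (meson norm_ge_zero order_trans)
  note B = B[rule_format]
  define k where "k t = f t * G t + F t * G' t" for t
  have kint: "k integrable_on {s..t}" if "0 \<le> s" "t \<le> L" for s t
  proof -
    have "(\<lambda>t. f t * G t) absolutely_integrable_on {s..t}"
      using that by (intro absolutely_integrable_mult_continuous absolutely_integrable_on_subinterval[OF f]
          continuous_on_subset[OF contG]) auto
    moreover have "(\<lambda>t. F t * G' t) integrable_on {s..t}"
      using that by (intro integrable_continuous_real continuous_intros continuous_on_subset[OF contF] continuous_on_subset[OF G']) auto
    ultimately show ?thesis
      unfolding k_def by (intro integrable_add) (auto simp: absolutely_integrable_on_def)
  qed
  define H where "H t = F t * G t - integral {0..t} k" for t
  have "H x = H 0"
  proof (rule eq_endpoints_if_superlinear[OF x0(1)])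
    fix s t assume st: "0 \<le> s" "s \<le> t" "t \<le> x"
    have stL: "t \<le> L" using st x by auto
    have G1: "(G' has_integral (G r - G q)) {q..r}" if "s \<le> q" "q \<le> r" "r \<le> t" for q r
      using that st stL by (intro fundamental_theorem_of_calculus has_vector_derivative_within_subset[OF G]) auto
    have Gb: "cmod (G t - G r) \<le> B * (t - s)" if r: "r \<in> {s..t}" for r
    proof -
      have "cmod (G t - G r) \<le> B * (t - r)"
        using has_integral_bound_real[OF B0 finite.emptyI G1[of r t]] B st stL r by auto
      also have "\<dots> \<le> B * (t - s)" using B0 r by (intro mult_left_mono) auto
      finally show ?thesis .
    qed
    have Fb: "cmod (F s - F r) \<le> A t - A s" if r: "r \<in> {s..t}" for r
    proof -
      have "cmod (F r - F s) \<le> A r - A s"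
        using r st stL by (intro has_integral_norm_le[OF Fdiff Adiff]) auto
      moreover have "0 \<le> A t - A r"
        using r st stL by (intro has_integral_nonneg[OF Adiff[of r t]]) auto
      ultimately show ?thesis by (simp add: norm_minus_commute)
    qed
    have i1: "((\<lambda>r. f r * G t) has_integral (F t - F s) * G t) {s..t}"
      using Fdiff[of s t] st stL by (intro has_integral_mult_left) auto
    have i2: "((\<lambda>r. F s * G' r) has_integral F s * (G t - G s)) {s..t}"
      using G1[of s t] st by (intro has_integral_mult_right) auto
    have i3: "(k has_integral (integral {0..t} k - integral {0..s} k)) {s..t}"
      by (rule has_integral_increment[OF _ st(1,2) stL]) (simp add: integrable_integral kint)
    have "((\<lambda>r. f r * (G t - G r) + (F s - F r) * G' r) has_integral (H t - H s)) {s..t}"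
      using has_integral_diff[OF has_integral_add[OF i1 i2] i3]
      by (simp add: k_def H_def algebra_simps)
    moreover have "((\<lambda>r. cmod (f r) * (B * (t - s)) + (A t - A s) * B) has_integral
        ((A t - A s) * (B * (t - s)) + (t - s) * ((A t - A s) * B))) {s..t}"
      using Adiff[of s t] st stL has_integral_const_real[of "(A t - A s) * B" s t]
      by (intro has_integral_add has_integral_mult_left) auto
    ultimately have "cmod (H t - H s) \<le> (A t - A s) * (B * (t - s)) + (t - s) * ((A t - A s) * B)"
    proof (rule has_integral_norm_le)
      fix r assume r: "r \<in> {s..t}"
      show "cmod (f r * (G t - G r) + (F s - F r) * G' r) \<le> cmod (f r) * (B * (t - s)) + (A t - A s) * B"
      proof (rule norm_triangle_le, rule add_mono)
        show "cmod (f r * (G t - G r)) \<le> cmod (f r) * (B * (t - s))"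
          unfolding norm_mult by (intro mult_left_mono Gb r) auto
        show "cmod ((F s - F r) * G' r) \<le> (A t - A s) * B"
          unfolding norm_mult using r st stL order_trans[OF norm_ge_zero Fb[OF r]]
          by (intro mult_mono Fb B) auto
      qed
    qed
    then show "cmod (H t - H s) \<le> 2 * B * (t - s) * (A t - A s)" by (simp add: algebra_simps)
  qed
  then have "integral {0..x} k = F x * G x - F 0 * G 0" by (simp add: H_def algebra_simps)
  then have "(k has_integral (F x * G x - F 0 * G 0)) {0..x}" using kint[of 0 x] x0 by (simp add: has_integral_iff)
  then show ?thesis by (simp add: k_def[abs_def])
qed

text \<open>
  Integrability of $|q|$ comes from $|q| \le 1 + |q|^2$ and the boundedness of the interval.
\<close>
lemma L2_on_imp_potential:
  assumes "L2_on {0<..<a} q"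
  shows "potential a q"
proof -
  have m: "q \<in> borel_measurable (lebesgue_on {0<..<a})"
    and sq: "integrable (lebesgue_on {0<..<a}) (\<lambda>x. (cmod (q x))\<^sup>2)"
    using assms by (auto simp: L2_on_def)
  have one: "integrable (lebesgue_on {0<..<a}) (\<lambda>x. 1 :: real)"
  proof -
    have "(\<lambda>x. 1 :: real) absolutely_integrable_on {0<..<a}"
      by (intro absolutely_integrable_on_const) simp
    then show ?thesis
      by (subst (asm) absolutely_integrable_measurable) (simp_all add: o_def)
  qed
  have "integrable (lebesgue_on {0<..<a}) (\<lambda>x. cmod (q x))"
  proof (rule Bochner_Integration.integrable_bound[OF Bochner_Integration.integrable_add[OF one sq]])
    show "(\<lambda>x. cmod (q x)) \<in> borel_measurable (lebesgue_on {0<..<a})" using m by measurable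
    have "cmod (q x) \<le> 1 + (cmod (q x))\<^sup>2" for x
      using sum_squares_bound[of 1 "cmod (q x)"] by (simp add: power2_eq_square) (smt (verit) mult_nonneg_nonneg norm_ge_zero)
    then show "AE x in lebesgue_on {0<..<a}. norm (cmod (q x)) \<le> norm (1 + (cmod (q x))\<^sup>2)"
      by (intro AE_I2) (simp add: abs_of_nonneg)
  qed
  then have "q absolutely_integrable_on {0<..<a}"
    using m by (simp add: absolutely_integrable_measurable o_def)
  then have "q absolutely_integrable_on {0..a}"
    by (simp only: absolutely_integrable_on_Icc_iff_Ioo)
  moreover have "(\<lambda>x. (cmod (q x))\<^sup>2) absolutely_integrable_on {0<..<a}"
    using sq m by (simp add: absolutely_integrable_measurable o_def)
  then have "(\<lambda>x. (cmod (q x))\<^sup>2) absolutely_integrable_on {0..a}"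
    by (simp add: absolutely_integrable_on_Icc_iff_Ioo)
  ultimately show ?thesis
    unfolding potential_def by (simp add: absolutely_integrable_on_def)
qed

section \<open>Entire dependence of solutions on the spectral parameter\<close>

text \<open>
  The initial value problem of the theorem with an arbitrary value $u$ at $0$, so that the
  cosine and sine type solutions are covered as well.
\<close>
definition sl_solution ::
  "real \<Rightarrow> (real \<Rightarrow> complex) \<Rightarrow> complex \<Rightarrow> complex \<Rightarrow> complex \<Rightarrow> (real \<Rightarrow> complex) \<Rightarrow> (real \<Rightarrow> complex) \<Rightarrow> bool"
where
  "sl_solution L p l u v y dy \<longleftrightarrow> y 0 = u \<and> dy 0 = v \<and>
     (\<forall>x\<in>{0..L}. (y has_vector_derivative dy x) (at x within {0..L}) \<and>
        ((\<lambda>t. (p t - l\<^sup>2) * y t) has_integral (dy x - v)) {0..x})"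

text \<open>
  Polynomials in $l$ whose coefficients are continuous functions of $x$. The cong rule makes the class
  depend only on the values on $[0,L]$. Membership gives holomorphy in $l$ and
  continuity in $x$ at once, and the class is stable under integration against an integrable kernel.
\<close>
inductive analytic_family :: "real \<Rightarrow> (complex \<Rightarrow> real \<Rightarrow> complex) \<Rightarrow> bool" for L where
  coefficient: "continuous_on {0..L} c \<Longrightarrow> analytic_family L (\<lambda>l x. c x)"
| times: "analytic_family L f \<Longrightarrow> analytic_family L (\<lambda>l x. l * f l x)"
| plus: "analytic_family L f \<Longrightarrow> analytic_family L g \<Longrightarrow> analytic_family L (\<lambda>l x. f l x + g l x)"
| cong: "analytic_family L f \<Longrightarrow> (\<And>l x. x \<in> {0..L} \<Longrightarrow> g l x = f l x) \<Longrightarrow> analytic_family L g"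

lemma analytic_family_continuous: "analytic_family L f \<Longrightarrow> continuous_on {0..L} (f l)"
proof (induction rule: analytic_family.induct)
  case (cong f g)
  then show ?case using continuous_on_cong[of "{0..L}" "{0..L}" "g l" "f l"] by simp
qed (auto intro!: continuous_intros)

lemma analytic_family_holomorphic:
  "analytic_family L f \<Longrightarrow> x \<in> {0..L} \<Longrightarrow> (\<lambda>l. f l x) holomorphic_on UNIV"
proof (induction rule: analytic_family.induct)
  case (cong f g)
  then show ?case using holomorphic_cong[of UNIV UNIV "\<lambda>l. g l x" "\<lambda>l. f l x"] by simp
qed (auto intro!: holomorphic_intros)

lemma analytic_family_integral:
  assumes k: "k absolutely_integrable_on {0..L}"
  shows "analytic_family L f \<Longrightarrow> analytic_family L (\<lambda>l x. integral {0..x} (\<lambda>t. k t * f l t))"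
proof (induction rule: analytic_family.induct)
  case (coefficient c)
  have "(\<lambda>t. k t * c t) integrable_on {0..L}"
    using absolutely_integrable_mult_continuous[OF k coefficient] by (simp add: absolutely_integrable_on_def)
  then show ?case by (intro analytic_family.coefficient indefinite_integral_continuous_1)
next
  case (times f)
  have "(\<lambda>t. k t * (l * f l t)) = (\<lambda>t. l * (k t * f l t))" for l
    by (simp add: mult.left_commute)
  then show ?case using analytic_family.times[OF times.IH] by simp
next
  case (plus f g)
  show ?case
  proof (rule analytic_family.cong[OF analytic_family.plus[OF plus.IH]])
    fix l x assume x: "x \<in> {0..L}"
    have "(\<lambda>t. k t * h l t) integrable_on {0..x}" if "analytic_family L h" for h
    proof -
      have "(\<lambda>t. k t * h l t) absolutely_integrable_on {0..L}"
        by (intro absolutely_integrable_mult_continuous k analytic_family_continuous that)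
      then show ?thesis
        using x integrable_on_subinterval[of "\<lambda>t. k t * h l t" "{0..L}" 0 x] by (simp add: absolutely_integrable_on_def)
    qed
    then show "integral {0..x} (\<lambda>t. k t * (f l t + g l t))
      = integral {0..x} (\<lambda>t. k t * f l t) + integral {0..x} (\<lambda>t. k t * g l t)"
      using plus.hyps by (simp add: distrib_left integral_add)
  qed
next
  case (cong f g)
  show ?case
    by (rule analytic_family.cong[OF cong.IH]) (auto intro!: integral_cong simp: cong.hyps)
qed

text \<open>
  Picard iteration for the first order system with the unknowns $y$ and $y'$. Starting values that are
  polynomials in $l$ keep all iterates polynomial in $l$.
\<close>
primrec picard ::
  "(real \<Rightarrow> complex) \<Rightarrow> complex \<Rightarrow> (complex \<Rightarrow> complex) \<Rightarrow> nat \<Rightarrow> complex \<Rightarrow> real \<Rightarrow> complex \<times> complex"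
where
  "picard p u v 0 = (\<lambda>l x. (u, v l))"
| "picard p u v (Suc n) = (\<lambda>l x. (u + integral {0..x} (\<lambda>t. snd (picard p u v n l t)),
      v l + integral {0..x} (\<lambda>t. (p t - l\<^sup>2) * fst (picard p u v n l t))))"

lemma analytic_family_initial: "analytic_family L (\<lambda>l x. v0 + v1 * l)"
  by (rule analytic_family.cong[OF analytic_family.plus[OF analytic_family.coefficient[of L "\<lambda>x. v0"]
        analytic_family.times[OF analytic_family.coefficient[of L "\<lambda>x. v1"]]]]) auto

lemma analytic_family_picard:
  assumes p: "p absolutely_integrable_on {0..L}"
  shows "analytic_family L (\<lambda>l x. fst (picard p u (\<lambda>l. v0 + v1 * l) n l x)) \<and>
         analytic_family L (\<lambda>l x. snd (picard p u (\<lambda>l. v0 + v1 * l) n l x))"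
proof (induction n)
  case 0
  show ?case by (auto intro: analytic_family.coefficient analytic_family_initial)
next
  case (Suc n)
  define Y where "Y = (\<lambda>l x. fst (picard p u (\<lambda>l. v0 + v1 * l) n l x))"
  define D where "D = (\<lambda>l x. snd (picard p u (\<lambda>l. v0 + v1 * l) n l x))"
  have Y: "analytic_family L Y" and D: "analytic_family L D" using Suc by (simp_all add: Y_def D_def)
  have "analytic_family L (\<lambda>l x. u + integral {0..x} (\<lambda>t. 1 * D l t))"
    by (intro analytic_family.plus analytic_family.coefficient analytic_family_integral D
        absolutely_integrable_continuous_real) auto
  moreover have "analytic_family L (\<lambda>l x. v0 + v1 * l + integral {0..x} (\<lambda>t. (p t - l\<^sup>2) * Y l t))"
  proof (rule analytic_family.cong)
    show "analytic_family L (\<lambda>l x. v0 + v1 * l + (integral {0..x} (\<lambda>t. p t * Y l t)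
        + l * (l * integral {0..x} (\<lambda>t. - 1 * Y l t))))"
      by (intro analytic_family.plus analytic_family.times analytic_family_initial analytic_family_integral p Y
        absolutely_integrable_continuous_real) auto
    fix l x assume x: "x \<in> {0..L}"
    have cont: "continuous_on {0..x} (Y l)"
      using continuous_on_subset[OF analytic_family_continuous[OF Y]] x by auto
    have "(\<lambda>t. p t * Y l t) integrable_on {0..x}"
    proof -
      have "(\<lambda>t. p t * Y l t) absolutely_integrable_on {0..L}"
        by (intro absolutely_integrable_mult_continuous p analytic_family_continuous Y)
      then show ?thesis
        using x integrable_on_subinterval[of "\<lambda>t. p t * Y l t" "{0..L}" 0 x] by (simp add: absolutely_integrable_on_def)
    qed
    moreover have "(\<lambda>t. l\<^sup>2 * Y l t) integrable_on {0..x}"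
      by (intro integrable_continuous_real continuous_intros cont)
    ultimately show "v0 + v1 * l + integral {0..x} (\<lambda>t. (p t - l\<^sup>2) * Y l t) =
        v0 + v1 * l + (integral {0..x} (\<lambda>t. p t * Y l t) + l * (l * integral {0..x} (\<lambda>t. - 1 * Y l t)))"
      by (simp add: left_diff_distrib integral_diff power2_eq_square mult.assoc)
  qed
  ultimately show ?case by (simp add: Y_def D_def)
qed

text \<open>
  With a weight $e^{Mt}$ both integral operators of the Picard iteration have norm at most $1/2$,
  uniformly for $|l| \le \Lambda$; the constant $M$ depends on $\Lambda$.
\<close>
lemma volterra_contraction:
  assumes p: "potential L p" and "\<Lambda> \<ge> 0"
  obtains M where "M > 0" "\<And>l w d N x. cmod l \<le> \<Lambda> \<Longrightarrow> continuous_on {0..L} w \<Longrightarrow> continuous_on {0..L} d \<Longrightarrow>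
     (\<And>t. t \<in> {0..L} \<Longrightarrow> cmod (w t) \<le> N * exp (M * t)) \<Longrightarrow> (\<And>t. t \<in> {0..L} \<Longrightarrow> cmod (d t) \<le> N * exp (M * t)) \<Longrightarrow>
     x \<in> {0..L} \<Longrightarrow> cmod (integral {0..x} d) \<le> N / 2 * exp (M * x) \<and>
       cmod (integral {0..x} (\<lambda>t. (p t - l\<^sup>2) * w t)) \<le> N / 2 * exp (M * x)"
proof -
  obtain M0 where M0: "M0 > 0" "\<And>M x. M \<ge> M0 \<Longrightarrow> x \<in> {0..L} \<Longrightarrow>
    integral {0..x} (\<lambda>t. cmod (p t) * exp (M * t)) \<le> 1 / 4 * exp (M * x)"
    using exp_weighted_integral_le[OF p, of "1/4"] by auto
  \<comment> \<open>A quarter each for the potential and for $l^2$, and a half for the plain integral.\<close>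
  define M where "M = max M0 (4 * \<Lambda>\<^sup>2 + 2)"
  have "4 * \<Lambda>\<^sup>2 + 2 \<le> M" by (simp add: M_def)
  moreover have "0 \<le> \<Lambda>\<^sup>2" by simp
  ultimately have "M \<ge> 2" "4 * \<Lambda>\<^sup>2 \<le> M" by linarith+
  then have M: "M > 0" "M \<ge> M0" "1 / M \<le> 1 / 2" "\<Lambda>\<^sup>2 / M \<le> 1 / 4"
    by (auto simp: M_def[symmetric] field_simps) (simp add: M_def)
  show ?thesis
  proof (rule that[OF M(1)])
    fix l w d N x
    assume l: "cmod l \<le> \<Lambda>" and cont: "continuous_on {0..L} w" "continuous_on {0..L} d"
      and w: "\<And>t. t \<in> {0..L} \<Longrightarrow> cmod (w t) \<le> N * exp (M * t)"
      and d: "\<And>t. t \<in> {0..L} \<Longrightarrow> cmod (d t) \<le> N * exp (M * t)" and x: "x \<in> {0..L}"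
    have N: "N \<ge> 0" using order_trans[OF norm_ge_zero w[OF x]] by (simp add: zero_le_mult_iff)
    have cx: "continuous_on {0..x} w" "continuous_on {0..x} d"
      using cont x by (auto intro: continuous_on_subset)
    have ex: "((\<lambda>t. exp (M * t)) has_integral (exp (M * x) / M - 1 / M)) {0..x}"
    proof -
      have "((\<lambda>t. exp (M * t)) has_integral (exp (M * x) / M - exp (M * 0) / M)) {0..x}"
        using x M by (intro fundamental_theorem_of_calculus)
          (auto simp: has_real_derivative_iff_has_vector_derivative[symmetric] intro!: derivative_eq_intros)
      then show ?thesis by simp
    qed
    have "cmod (integral {0..x} d) \<le> N * (exp (M * x) / M - 1 / M)"
      using d x by (intro has_integral_norm_le[OF integrable_integral has_integral_mult_right[OF ex]]
        integrable_continuous_real cx) auto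
    also have "\<dots> \<le> N * (exp (M * x) * (1 / M))" using M N by (intro mult_left_mono) auto
    also have "\<dots> \<le> N * (exp (M * x) * (1 / 2))" using M N by (intro mult_left_mono) auto
    finally have 1: "cmod (integral {0..x} d) \<le> N / 2 * exp (M * x)" by simp
    have pe: "(\<lambda>t. cmod (p t) * exp (M * t)) integrable_on {0..x}"
      using potential_mult_integrable(2)[OF p x, of "\<lambda>t. of_real (exp (M * t))"]
      by (simp add: continuous_intros)
    have int: "(\<lambda>t. (p t - l\<^sup>2) * w t) integrable_on {0..x}"
      using potential_mult_integrable(1)[OF potential_add_const[OF p, of "- l\<^sup>2"] x cx(1)] by simp
    have "cmod (integral {0..x} (\<lambda>t. (p t - l\<^sup>2) * w t))
        \<le> N * integral {0..x} (\<lambda>t. cmod (p t) * exp (M * t)) + N * \<Lambda>\<^sup>2 * (exp (M * x) / M - 1 / M)"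
    proof (rule has_integral_norm_le[OF integrable_integral[OF int]
          has_integral_add[OF has_integral_mult_right[OF integrable_integral[OF pe]] has_integral_mult_right[OF ex]]])
      fix t assume t: "t \<in> {0..x}"
      have "cmod (p t - l\<^sup>2) \<le> cmod (p t) + \<Lambda>\<^sup>2"
        using norm_triangle_ineq4[of "p t" "l\<^sup>2"] power_mono[OF l, of 2] by (simp add: norm_power)
      then have "cmod ((p t - l\<^sup>2) * w t) \<le> (cmod (p t) + \<Lambda>\<^sup>2) * (N * exp (M * t))"
        unfolding norm_mult using t x w[of t] by (intro mult_mono) auto
      then show "cmod ((p t - l\<^sup>2) * w t) \<le> N * (cmod (p t) * exp (M * t)) + N * \<Lambda>\<^sup>2 * exp (M * t)"
        by (simp add: algebra_simps)
    qed
    also have "\<dots> \<le> N * (1 / 4 * exp (M * x)) + N * (exp (M * x) * (1 / 4))"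
    proof (rule add_mono)
      show "N * integral {0..x} (\<lambda>t. cmod (p t) * exp (M * t)) \<le> N * (1 / 4 * exp (M * x))"
        using M0(2)[OF M(2) x] N by (intro mult_left_mono) auto
      have "N * \<Lambda>\<^sup>2 * (exp (M * x) / M - 1 / M) \<le> N * \<Lambda>\<^sup>2 * (exp (M * x) / M)"
        using M N by (intro mult_left_mono) auto
      also have "\<dots> = N * (exp (M * x) * (\<Lambda>\<^sup>2 / M))" by simp
      also have "\<dots> \<le> N * (exp (M * x) * (1 / 4))" using M N by (intro mult_left_mono) auto
      finally show "N * \<Lambda>\<^sup>2 * (exp (M * x) / M - 1 / M) \<le> N * (exp (M * x) * (1 / 4))" .
    qed
    finally have 2: "cmod (integral {0..x} (\<lambda>t. (p t - l\<^sup>2) * w t)) \<le> N / 2 * exp (M * x)" by simp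
    from 1 2 show "cmod (integral {0..x} d) \<le> N / 2 * exp (M * x) \<and>
       cmod (integral {0..x} (\<lambda>t. (p t - l\<^sup>2) * w t)) \<le> N / 2 * exp (M * x)" by blast
  qed
qed

text \<open>
  Successive iterates differ by at most a multiple of $2^{-n} e^{Mx}$, uniformly for
  $|l| \le \Lambda$, so the series of their differences converges by the Weierstrass test. The
  limit does not depend on $\Lambda$.
\<close>
lemma picard_uniform_limit:
  assumes p: "potential L p" and "L \<ge> 0"
  obtains Y D :: "complex \<Rightarrow> real \<Rightarrow> complex" where
    "\<And>\<Lambda>. uniform_limit (cball 0 \<Lambda> \<times> {0..L}) (\<lambda>n (l, x). fst (picard p u (\<lambda>l. v0 + v1 * l) n l x)) (\<lambda>(l, x). Y l x) sequentially"
    "\<And>\<Lambda>. uniform_limit (cball 0 \<Lambda> \<times> {0..L}) (\<lambda>n (l, x). snd (picard p u (\<lambda>l. v0 + v1 * l) n l x)) (\<lambda>(l, x). D l x) sequentially"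
proof -
  define y where "y n l x = fst (picard p u (\<lambda>l. v0 + v1 * l) n l x)" for n l x
  define d where "d n l x = snd (picard p u (\<lambda>l. v0 + v1 * l) n l x)" for n l x
  have ps: "y (Suc n) l x = u + integral {0..x} (d n l)"
    "d (Suc n) l x = v0 + v1 * l + integral {0..x} (\<lambda>t. (p t - l\<^sup>2) * y n l t)" for n l x
    by (simp_all add: y_def d_def[abs_def])
  have pabs: "p absolutely_integrable_on {0..L}" using p by (simp add: potential_def)
  have fam: "analytic_family L (y n)" "analytic_family L (d n)" for n
    using analytic_family_picard[OF pabs, of u v0 v1 n] by (simp_all add: y_def[abs_def] d_def[abs_def])
  have cy: "continuous_on {0..L} (y n l)" and cd: "continuous_on {0..L} (d n l)" for n l
    using fam analytic_family_continuous by blast+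
  have inty: "(\<lambda>t. (p t - l\<^sup>2) * y n l t) integrable_on {0..x}" if "x \<in> {0..L}" for n l x
    using potential_mult_integrable(1)[OF potential_add_const[OF p, of "- l\<^sup>2"] that, of "y n l"]
      continuous_on_subset[OF cy, of "{0..x}"] that by simp
  have intd: "d n l integrable_on {0..x}" if "x \<in> {0..L}" for n l x
    using integrable_continuous_real[OF continuous_on_subset[OF cd, of "{0..x}"]] that by simp
  have geo: "\<exists>N M. \<forall>n l x. cmod l \<le> \<Lambda> \<longrightarrow> x \<in> {0..L} \<longrightarrow>
      cmod (y (Suc n) l x - y n l x) \<le> N * (1/2) ^ n * exp (M * L) \<and>
      cmod (d (Suc n) l x - d n l x) \<le> N * (1/2) ^ n * exp (M * L)" if "\<Lambda> \<ge> 0" for \<Lambda>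
  proof -
    obtain M where M: "M > 0" "\<And>l w d N x. cmod l \<le> \<Lambda> \<Longrightarrow> continuous_on {0..L} w \<Longrightarrow> continuous_on {0..L} d \<Longrightarrow>
     (\<And>t. t \<in> {0..L} \<Longrightarrow> cmod (w t) \<le> N * exp (M * t)) \<Longrightarrow> (\<And>t. t \<in> {0..L} \<Longrightarrow> cmod (d t) \<le> N * exp (M * t)) \<Longrightarrow>
     x \<in> {0..L} \<Longrightarrow> cmod (integral {0..x} d) \<le> N / 2 * exp (M * x) \<and>
       cmod (integral {0..x} (\<lambda>t. (p t - l\<^sup>2) * w t)) \<le> N / 2 * exp (M * x)"
      using volterra_contraction[OF p \<open>\<Lambda> \<ge> 0\<close>] by blast
    define N0 where "N0 = cmod u + cmod v0 + cmod v1 * \<Lambda>"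
    have N0: "N0 \<ge> 0" using \<open>\<Lambda> \<ge> 0\<close> by (simp add: N0_def)
    have base: "cmod (y 0 l t) \<le> N0 * exp (M * t)" "cmod (d 0 l t) \<le> N0 * exp (M * t)"
      if l: "cmod l \<le> \<Lambda>" and t: "t \<in> {0..L}" for l t
    proof -
      have "cmod (v0 + v1 * l) \<le> cmod v0 + cmod v1 * \<Lambda>"
        using l by (intro norm_triangle_le add_left_mono) (simp add: norm_mult mult_left_mono)
      moreover have "0 \<le> cmod v1 * \<Lambda>" using \<open>\<Lambda> \<ge> 0\<close> by simp
      moreover have "y 0 l t = u" "d 0 l t = v0 + v1 * l" by (simp_all add: y_def d_def)
      ultimately have "cmod (y 0 l t) \<le> N0" "cmod (d 0 l t) \<le> N0"
        unfolding N0_def by (smt (verit) norm_ge_zero)+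
      moreover have "N0 * 1 \<le> N0 * exp (M * t)" using N0 M t by (intro mult_left_mono) auto
      ultimately show "cmod (y 0 l t) \<le> N0 * exp (M * t)" "cmod (d 0 l t) \<le> N0 * exp (M * t)" by linarith+
    qed
    have step: "cmod l \<le> \<Lambda> \<Longrightarrow> x \<in> {0..L} \<Longrightarrow>
      cmod (y (Suc n) l x - y n l x) \<le> (3 * N0) * (1/2) ^ n * exp (M * x) \<and>
      cmod (d (Suc n) l x - d n l x) \<le> (3 * N0) * (1/2) ^ n * exp (M * x)" for n l x
    proof (induction n arbitrary: x)
      case 0
      have "cmod (integral {0..x} (d 0 l)) \<le> N0 / 2 * exp (M * x)"
        "cmod (integral {0..x} (\<lambda>t. (p t - l\<^sup>2) * y 0 l t)) \<le> N0 / 2 * exp (M * x)"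
        using M(2)[OF 0(1) cy cd base(1)[OF 0(1)] base(2)[OF 0(1)] 0(2)] by auto
      moreover have "N0 / 2 * exp (M * x) \<le> N0 * exp (M * x)" using N0 by (simp add: mult_right_mono)
      moreover have "N0 * exp (M * x) \<ge> 0" using N0 by simp
      ultimately show ?case
        by (simp add: ps) (simp add: y_def d_def)
    next
      case (Suc n)
      let ?w = "\<lambda>t. y (Suc n) l t - y n l t" and ?d = "\<lambda>t. d (Suc n) l t - d n l t"
      have "cmod (integral {0..x} ?d) \<le> (3 * N0) * (1/2) ^ n / 2 * exp (M * x) \<and>
        cmod (integral {0..x} (\<lambda>t. (p t - l\<^sup>2) * ?w t)) \<le> (3 * N0) * (1/2) ^ n / 2 * exp (M * x)"
        by (intro M(2) continuous_intros cy cd Suc.prems) (use Suc.IH Suc.prems in auto)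
      moreover have "y (Suc (Suc n)) l x - y (Suc n) l x = integral {0..x} ?d"
        unfolding ps(1)[of "Suc n"] ps(1)[of n] using integral_diff[OF intd intd] Suc.prems by simp
      moreover have "d (Suc (Suc n)) l x - d (Suc n) l x = integral {0..x} (\<lambda>t. (p t - l\<^sup>2) * ?w t)"
        unfolding ps(2)[of "Suc n"] ps(2)[of n] right_diff_distrib
        using integral_diff[OF inty inty] Suc.prems by simp
      ultimately show ?case by simp
    qed
    have "exp (M * x) \<le> exp (M * L)" if "x \<in> {0..L}" for x using M that by simp
    then have mono: "(3 * N0) * (1/2) ^ n * exp (M * x) \<le> (3 * N0) * (1/2) ^ n * exp (M * L)" if "x \<in> {0..L}" for x n
      using that N0 by (intro mult_left_mono) auto
    show ?thesis
    proof (rule exI[of _ "3 * N0"], rule exI[of _ M], intro allI impI)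
      fix n and l :: complex and x :: real assume "cmod l \<le> \<Lambda>" "x \<in> {0..L}"
      then show "cmod (y (Suc n) l x - y n l x) \<le> 3 * N0 * (1/2) ^ n * exp (M * L) \<and>
          cmod (d (Suc n) l x - d n l x) \<le> 3 * N0 * (1/2) ^ n * exp (M * L)"
        using step[of l x n] mono[of x n] by (smt (verit))
    qed
  qed
  have lim: "uniform_limit (cball 0 \<Lambda> \<times> {0..L}) (\<lambda>n (l, x). f n l x) (\<lambda>(l, x). f 0 l x + (\<Sum>k. f (Suc k) l x - f k l x)) sequentially"
    if f: "\<And>\<Lambda>. \<Lambda> \<ge> 0 \<Longrightarrow> \<exists>N M. \<forall>n l x. cmod l \<le> \<Lambda> \<longrightarrow> x \<in> {0..L} \<longrightarrow> cmod (f (Suc n) l x - f n l x) \<le> N * (1/2) ^ n * exp (M * L)"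
    for f :: "nat \<Rightarrow> complex \<Rightarrow> real \<Rightarrow> complex" and \<Lambda>
  proof (cases "\<Lambda> \<ge> 0")
    case True
    then obtain N M where NM: "\<And>n l x. cmod l \<le> \<Lambda> \<Longrightarrow> x \<in> {0..L} \<Longrightarrow> cmod (f (Suc n) l x - f n l x) \<le> N * (1/2) ^ n * exp (M * L)"
      using f by blast
    have "uniform_limit (cball 0 \<Lambda> \<times> {0..L}) (\<lambda>n z. \<Sum>k<n. f (Suc k) (fst z) (snd z) - f k (fst z) (snd z))
      (\<lambda>z. \<Sum>k. f (Suc k) (fst z) (snd z) - f k (fst z) (snd z)) sequentially"
    proof (rule Weierstrass_m_test)
      show "summable (\<lambda>n. N * (1/2) ^ n * exp (M * L))"
        by (intro summable_mult summable_mult2 summable_geometric) auto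
    qed (use NM in auto)
    then have "uniform_limit (cball 0 \<Lambda> \<times> {0..L}) (\<lambda>n z. f 0 (fst z) (snd z) + (\<Sum>k<n. f (Suc k) (fst z) (snd z) - f k (fst z) (snd z)))
      (\<lambda>z. f 0 (fst z) (snd z) + (\<Sum>k. f (Suc k) (fst z) (snd z) - f k (fst z) (snd z))) sequentially"
      by (intro uniform_limit_intros)
    then show ?thesis
      by (simp add: sum_lessThan_telescope[of "\<lambda>k. f k _ _"] case_prod_beta')
  next
    case False
    then have "cball (0::complex) \<Lambda> = {}" by simp
    then show ?thesis by simp
  qed
  show ?thesis
  proof (rule that)
    show "uniform_limit (cball 0 \<Lambda> \<times> {0..L}) (\<lambda>n (l, x). fst (picard p u (\<lambda>l. v0 + v1 * l) n l x))
      (\<lambda>(l, x). y 0 l x + (\<Sum>k. y (Suc k) l x - y k l x)) sequentially" for \<Lambda>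
      using lim[of y \<Lambda>] geo unfolding y_def by meson
    show "uniform_limit (cball 0 \<Lambda> \<times> {0..L}) (\<lambda>n (l, x). snd (picard p u (\<lambda>l. v0 + v1 * l) n l x))
      (\<lambda>(l, x). d 0 l x + (\<Sum>k. d (Suc k) l x - d k l x)) sequentially" for \<Lambda>
      using lim[of d \<Lambda>] geo unfolding d_def by meson
  qed
qed

lemma integral_limit_uniform:
  fixes k :: "real \<Rightarrow> complex"
  assumes k: "k absolutely_integrable_on {a..b}" and f: "\<And>n. continuous_on {a..b} (f n)"
    and lim: "uniform_limit {a..b} f g sequentially"
  shows "(\<lambda>n. integral {a..b} (\<lambda>t. k t * f n t)) \<longlonglongrightarrow> integral {a..b} (\<lambda>t. k t * g t)"
proof (rule LIMSEQ_I)
  fix e :: real assume e: "e > 0"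
  have g: "continuous_on {a..b} g"
    by (rule uniform_limit_theorem[OF _ lim]) (use f in auto)
  have int: "(\<lambda>t. k t * h t) integrable_on {a..b}" if "continuous_on {a..b} h" for h
    using absolutely_integrable_mult_continuous[OF k that] by (simp add: absolutely_integrable_on_def)
  define J where "J = integral {a..b} (\<lambda>t. cmod (k t))"
  have J: "J \<ge> 0" unfolding J_def using k by (intro integral_nonneg) (auto simp: absolutely_integrable_on_def)
  have "\<forall>\<^sub>F n in sequentially. \<forall>t\<in>{a..b}. dist (f n t) (g t) < e / (J + 1)"
    using uniform_limitD[OF lim, of "e / (J + 1)"] e J by simp
  then obtain n0 where n0: "\<And>n t. n \<ge> n0 \<Longrightarrow> t \<in> {a..b} \<Longrightarrow> dist (f n t) (g t) < e / (J + 1)"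
    unfolding eventually_sequentially by blast
  have "cmod (integral {a..b} (\<lambda>t. k t * f n t) - integral {a..b} (\<lambda>t. k t * g t)) < e" if n: "n \<ge> n0" for n
  proof -
    have "integral {a..b} (\<lambda>t. k t * f n t) - integral {a..b} (\<lambda>t. k t * g t) = integral {a..b} (\<lambda>t. k t * f n t - k t * g t)"
      by (intro integral_diff[symmetric] int f g)
    also have "cmod \<dots> \<le> J * (e / (J + 1))"
    proof (rule has_integral_norm_le[OF integrable_integral has_integral_mult_left])
      show "(\<lambda>t. k t * f n t - k t * g t) integrable_on {a..b}" by (intro integrable_diff int f g)
      show "((\<lambda>t. cmod (k t)) has_integral J) {a..b}"
        using k unfolding J_def by (simp add: absolutely_integrable_on_def integrable_integral)
      fix t assume "t \<in> {a..b}"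
      then have "cmod (f n t - g t) \<le> e / (J + 1)" using n0[OF n, of t] by (simp add: dist_norm)
      then show "cmod (k t * f n t - k t * g t) \<le> cmod (k t) * (e / (J + 1))"
        unfolding right_diff_distrib[symmetric] norm_mult by (intro mult_left_mono) auto
    qed
    also have "\<dots> < e" using e J by (simp add: field_simps)
    finally show ?thesis .
  qed
  then show "\<exists>n0. \<forall>n\<ge>n0. norm (integral {a..b} (\<lambda>t. k t * f n t) - integral {a..b} (\<lambda>t. k t * g t)) < e" by auto
qed

text \<open>
  The limits of the iterates are entire in $l$ because locally uniform limits of polynomials are.
  The initial slope is affine in $l$, as in the boundary condition at $0$.
\<close>
theorem sl_solution_exists:
  assumes p: "potential L p" and "L \<ge> 0"
  obtains Y D :: "complex \<Rightarrow> real \<Rightarrow> complex" where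
    "\<And>l. sl_solution L p l u (v0 + v1 * l) (Y l) (D l)"
    "\<And>x. x \<in> {0..L} \<Longrightarrow> (\<lambda>l. Y l x) holomorphic_on UNIV"
    "\<And>x. x \<in> {0..L} \<Longrightarrow> (\<lambda>l. D l x) holomorphic_on UNIV"
proof -
  define y where "y n l x = fst (picard p u (\<lambda>l. v0 + v1 * l) n l x)" for n l x
  define d where "d n l x = snd (picard p u (\<lambda>l. v0 + v1 * l) n l x)" for n l x
  have ps: "y (Suc n) l x = u + integral {0..x} (\<lambda>t. 1 * d n l t)"
    "d (Suc n) l x = v0 + v1 * l + integral {0..x} (\<lambda>t. (p t - l\<^sup>2) * y n l t)" for n l x
    by (simp_all add: y_def d_def[abs_def])
  have pabs: "p absolutely_integrable_on {0..L}" using p by (simp add: potential_def)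
  have fam: "analytic_family L (y n)" "analytic_family L (d n)" for n
    using analytic_family_picard[OF pabs, of u v0 v1 n] by (simp_all add: y_def[abs_def] d_def[abs_def])
  obtain Y D :: "complex \<Rightarrow> real \<Rightarrow> complex" where
    Y: "\<And>\<Lambda>. uniform_limit (cball 0 \<Lambda> \<times> {0..L}) (\<lambda>n (l, x). y n l x) (\<lambda>(l, x). Y l x) sequentially" and
    D: "\<And>\<Lambda>. uniform_limit (cball 0 \<Lambda> \<times> {0..L}) (\<lambda>n (l, x). d n l x) (\<lambda>(l, x). D l x) sequentially"
    using picard_uniform_limit[OF p \<open>L \<ge> 0\<close>, of u v0 v1] unfolding y_def d_def by blast
  have hol: "(\<lambda>l. F l x) holomorphic_on UNIV"
    if lim: "\<And>\<Lambda>. uniform_limit (cball 0 \<Lambda> \<times> {0..L}) (\<lambda>n (l, x). f n l x) (\<lambda>(l, x). F l x) sequentially"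
      and f: "\<And>n. analytic_family L (f n)" and x: "x \<in> {0..L}"
    for f :: "nat \<Rightarrow> complex \<Rightarrow> real \<Rightarrow> complex" and F x
  proof (rule holomorphic_uniform_sequence[OF open_UNIV])
    show "(\<lambda>l. f n l x) holomorphic_on UNIV" for n using analytic_family_holomorphic[OF f x] .
    fix z :: complex
    have sub: "l \<in> cball 0 (cmod z + 1)" if "l \<in> cball z 1" for l
      using that norm_triangle_ineq[of z "l - z"] by (simp add: dist_norm norm_minus_commute)
    have "uniform_limit (cball z 1) (\<lambda>n l. f n l x) (\<lambda>l. F l x) sequentially"
      unfolding uniform_limit_iff
    proof (intro allI impI)
      fix e :: real assume "e > 0"
      then have "\<forall>\<^sub>F n in sequentially. \<forall>w\<in>cball 0 (cmod z + 1) \<times> {0..L}. dist (case w of (l, x) \<Rightarrow> f n l x) (case w of (l, x) \<Rightarrow> F l x) < e"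
        using lim unfolding uniform_limit_iff by blast
      then show "\<forall>\<^sub>F n in sequentially. \<forall>l\<in>cball z 1. dist (f n l x) (F l x) < e"
        by (rule eventually_mono) (use sub x in auto)
    qed
    then show "\<exists>r>0. cball z r \<subseteq> UNIV \<and> uniform_limit (cball z r) (\<lambda>n l. f n l x) (\<lambda>l. F l x) sequentially"
      by (intro exI[of _ 1]) auto
  qed
  have ul: "uniform_limit {0..x} (\<lambda>n. f n l) (F l) sequentially"
    if lim: "\<And>\<Lambda>. uniform_limit (cball 0 \<Lambda> \<times> {0..L}) (\<lambda>n (l, x). f n l x) (\<lambda>(l, x). F l x) sequentially" and x: "x \<in> {0..L}"
    for f :: "nat \<Rightarrow> complex \<Rightarrow> real \<Rightarrow> complex" and F l x
    unfolding uniform_limit_iff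
  proof (intro allI impI)
    fix e :: real assume "e > 0"
    then have "\<forall>\<^sub>F n in sequentially. \<forall>w\<in>cball 0 (cmod l) \<times> {0..L}. dist (case w of (l, x) \<Rightarrow> f n l x) (case w of (l, x) \<Rightarrow> F l x) < e"
      using lim unfolding uniform_limit_iff by blast
    then show "\<forall>\<^sub>F n in sequentially. \<forall>t\<in>{0..x}. dist (f n l t) (F l t) < e"
      by (rule eventually_mono) (use x in auto)
  qed
  have cy: "continuous_on {0..x} (y n l)" and cd: "continuous_on {0..x} (d n l)" if "x \<in> {0..L}" for n l x
    using continuous_on_subset[OF analytic_family_continuous[OF fam(1)]]
      continuous_on_subset[OF analytic_family_continuous[OF fam(2)]] that by auto
  have pw: "(\<lambda>n. f n l x) \<longlonglongrightarrow> F l x"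
    if "uniform_limit {0..x} (\<lambda>n. f n l) (F l) sequentially" "x \<in> {0..L}"
    for f :: "nat \<Rightarrow> complex \<Rightarrow> real \<Rightarrow> complex" and F l x
    using tendsto_uniform_limitI[OF that(1), of x] that(2) by simp
  have LL: "L \<in> {0..L}" using \<open>L \<ge> 0\<close> by simp
  have cD: "continuous_on {0..L} (D l)" for l
    by (rule uniform_limit_theorem[OF _ ul[OF D LL]]) (use cd[OF LL] in auto)
  have cY: "continuous_on {0..L} (Y l)" for l
    by (rule uniform_limit_theorem[OF _ ul[OF Y LL]]) (use cy[OF LL] in auto)
  have eqY: "Y l x = u + integral {0..x} (D l)" if x: "x \<in> {0..L}" for l x
  proof (rule LIMSEQ_unique[OF LIMSEQ_Suc[OF pw[OF ul[OF Y x] x]]])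
    have "(\<lambda>n. integral {0..x} (\<lambda>t. 1 * d n l t)) \<longlonglongrightarrow> integral {0..x} (\<lambda>t. 1 * D l t)"
      by (intro integral_limit_uniform ul[OF D x] cd[OF x] absolutely_integrable_continuous_real) auto
    then show "(\<lambda>n. y (Suc n) l x) \<longlonglongrightarrow> u + integral {0..x} (D l)"
      unfolding ps(1) by (intro tendsto_intros) simp
  qed
  have eqD: "D l x = v0 + v1 * l + integral {0..x} (\<lambda>t. (p t - l\<^sup>2) * Y l t)" if x: "x \<in> {0..L}" for l x
  proof (rule LIMSEQ_unique[OF LIMSEQ_Suc[OF pw[OF ul[OF D x] x]]])
    have "(\<lambda>t. p t - l\<^sup>2) absolutely_integrable_on {0..x}"
      using potential_absolutely_integrable[OF potential_add_const[OF p, of "- l\<^sup>2"] x] by simp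
    then have "(\<lambda>n. integral {0..x} (\<lambda>t. (p t - l\<^sup>2) * y n l t)) \<longlonglongrightarrow> integral {0..x} (\<lambda>t. (p t - l\<^sup>2) * Y l t)"
      by (intro integral_limit_uniform ul[OF Y x] cy[OF x])
    then show "(\<lambda>n. d (Suc n) l x) \<longlonglongrightarrow> v0 + v1 * l + integral {0..x} (\<lambda>t. (p t - l\<^sup>2) * Y l t)"
      unfolding ps(2) by (intro tendsto_intros)
  qed
  have "sl_solution L p l u (v0 + v1 * l) (Y l) (D l)" for l
    unfolding sl_solution_def
  proof (intro conjI ballI)
    show "Y l 0 = u" "D l 0 = v0 + v1 * l" using eqY[of 0 l] eqD[of 0 l] \<open>L \<ge> 0\<close> by auto
    fix x assume x: "x \<in> {0..L}"
    have "((\<lambda>x. u + integral {0..x} (D l)) has_vector_derivative D l x) (at x within {0..L})"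
      using integral_has_vector_derivative[OF cD x] by (auto intro!: derivative_eq_intros)
    then show "(Y l has_vector_derivative D l x) (at x within {0..L})"
      by (rule has_vector_derivative_transform[OF x, rotated]) (simp add: eqY)
    have "(\<lambda>t. (p t - l\<^sup>2) * Y l t) integrable_on {0..x}"
      using potential_mult_integrable(1)[OF potential_add_const[OF p, of "- l\<^sup>2"] x, of "Y l"]
        continuous_on_subset[OF cY, of "{0..x}"] x by simp
    then show "((\<lambda>t. (p t - l\<^sup>2) * Y l t) has_integral (D l x - (v0 + v1 * l))) {0..x}"
      using eqD[OF x] by (simp add: has_integral_iff)
  qed
  then show ?thesis using that hol[OF Y fam(1)] hol[OF D fam(2)] by blast
qed

section \<open>Growth and uniqueness of solutions\<close>

lemma cmod_cos_le: "cmod (cos (l * of_real t)) \<le> exp (\<bar>Im l\<bar> * \<bar>t\<bar>)"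
  and cmod_sin_le: "cmod (sin (l * of_real t)) \<le> exp (\<bar>Im l\<bar> * \<bar>t\<bar>)"
proof -
  have e: "cmod (exp (\<i> * z)) \<le> exp \<bar>Im z\<bar>" "cmod (exp (- (\<i> * z))) \<le> exp \<bar>Im z\<bar>" for z
    by (auto simp: norm_exp_eq_Re)
  have "cmod (exp (\<i> * z) + exp (- (\<i> * z))) \<le> 2 * exp \<bar>Im z\<bar>"
    "cmod (exp (\<i> * z) - exp (- (\<i> * z))) \<le> 2 * exp \<bar>Im z\<bar>" for z
    using e[of z] norm_triangle_ineq[of "exp (\<i> * z)" "exp (- (\<i> * z))"]
      norm_triangle_ineq4[of "exp (\<i> * z)" "exp (- (\<i> * z))"] by linarith+
  note 2 = this
  have "cmod (cos z) \<le> exp \<bar>Im z\<bar>" "cmod (sin z) \<le> exp \<bar>Im z\<bar>" for z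
    using 2(1)[of z] 2(2)[of z] by (simp_all add: cos_exp_eq sin_exp_eq norm_divide norm_mult)
  from this[of "l * of_real t"]
  show "cmod (cos (l * of_real t)) \<le> exp (\<bar>Im l\<bar> * \<bar>t\<bar>)" "cmod (sin (l * of_real t)) \<le> exp (\<bar>Im l\<bar> * \<bar>t\<bar>)"
    by (auto simp: abs_mult)
qed

lemma sl_solution_continuous:
  assumes "sl_solution L p l u v y dy"
  shows "continuous_on {0..L} y"
  unfolding continuous_on_eq_continuous_within
proof
  fix x assume "x \<in> {0..L}"
  then have "(y has_vector_derivative dy x) (at x within {0..L})"
    using assms by (simp add: sl_solution_def)
  then show "continuous (at x within {0..L}) y" by (rule has_vector_derivative_continuous)
qed

lemma sl_solution_deriv_continuous:
  assumes p: "potential L p" and s: "sl_solution L p l u v y dy"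
  shows "continuous_on {0..L} dy"
proof (cases "L \<ge> 0")
  case True
  have "(\<lambda>t. (p t - l\<^sup>2) * y t) integrable_on {0..L}"
    using s True unfolding sl_solution_def by auto
  then have "continuous_on {0..L} (\<lambda>x. v + integral {0..x} (\<lambda>t. (p t - l\<^sup>2) * y t))"
    by (intro continuous_intros indefinite_integral_continuous_1)
  moreover have "v + integral {0..x} (\<lambda>t. (p t - l\<^sup>2) * y t) = dy x" if "x \<in> {0..L}" for x
  proof -
    have "integral {0..x} (\<lambda>t. (p t - l\<^sup>2) * y t) = dy x - v"
      using s that unfolding sl_solution_def by (intro integral_unique) auto
    then show ?thesis by simp
  qed
  ultimately show ?thesis by (rule continuous_on_eq)
qed simp

lemma sl_solution_product_rule:
  assumes p: "potential L p" and s: "sl_solution L p l u v y dy"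
    and G: "\<And>x. x \<in> {0..L} \<Longrightarrow> (G has_vector_derivative G' x) (at x within {0..L})"
    and G': "continuous_on {0..L} G'" and x: "x \<in> {0..L}"
  shows "((\<lambda>t. (p t - l\<^sup>2) * y t * G t + dy t * G' t) has_integral (dy x * G x - v * G 0)) {0..x}"
proof -
  have "(\<lambda>t. p t - l\<^sup>2) absolutely_integrable_on {0..L}"
    using potential_add_const[OF p, of "- l\<^sup>2"] by (simp add: potential_def)
  then have "(\<lambda>t. (p t - l\<^sup>2) * y t) absolutely_integrable_on {0..L}"
    by (intro absolutely_integrable_mult_continuous sl_solution_continuous[OF s])
  from has_integral_product_rule[OF this _ G G' x, of dy]
  show ?thesis using s unfolding sl_solution_def by simp
qed

text \<open>
  Integrating $y_1 y_2''$ and $y_1'' y_2$ by parts and subtracting, the terms with $l^2$ and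
  with $y_1' y_2'$ cancel.
\<close>
lemma wronskian_identity:
  assumes p1: "potential L p1" and s1: "sl_solution L p1 l u1 v1 y1 dy1"
    and p2: "potential L p2" and s2: "sl_solution L p2 l u2 v2 y2 dy2" and x: "x \<in> {0..L}"
  shows "((\<lambda>t. (p2 t - p1 t) * (y1 t * y2 t)) has_integral
     (y1 x * dy2 x - dy1 x * y2 x - (u1 * v2 - v1 * u2))) {0..x}"
proof -
  have "((\<lambda>t. (p2 t - l\<^sup>2) * y2 t * y1 t + dy2 t * dy1 t) has_integral (dy2 x * y1 x - v2 * y1 0)) {0..x}"
    using s1 by (intro sl_solution_product_rule[OF p2 s2 _ sl_solution_deriv_continuous[OF p1 s1] x])
      (auto simp: sl_solution_def)
  moreover have "((\<lambda>t. (p1 t - l\<^sup>2) * y1 t * y2 t + dy1 t * dy2 t) has_integral (dy1 x * y2 x - v1 * y2 0)) {0..x}"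
    using s2 by (intro sl_solution_product_rule[OF p1 s1 _ sl_solution_deriv_continuous[OF p2 s2] x])
      (auto simp: sl_solution_def)
  ultimately have "((\<lambda>t. ((p2 t - l\<^sup>2) * y2 t * y1 t + dy2 t * dy1 t) - ((p1 t - l\<^sup>2) * y1 t * y2 t + dy1 t * dy2 t))
      has_integral (dy2 x * y1 x - v2 * y1 0 - (dy1 x * y2 x - v1 * y2 0))) {0..x}"
    by (rule has_integral_diff)
  moreover have "((p2 t - l\<^sup>2) * y2 t * y1 t + dy2 t * dy1 t) - ((p1 t - l\<^sup>2) * y1 t * y2 t + dy1 t * dy2 t)
      = (p2 t - p1 t) * (y1 t * y2 t)" for t
    by (simp add: algebra_simps)
  moreover have "dy2 x * y1 x - v2 * y1 0 - (dy1 x * y2 x - v1 * y2 0) = y1 x * dy2 x - dy1 x * y2 x - (u1 * v2 - v1 * u2)"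
    using s1 s2 by (simp add: sl_solution_def algebra_simps)
  ultimately show ?thesis by simp
qed

text \<open>
  The function $y'(t) \frac{\sin l (x-t)}{l} + y(t) \cos l (x-t)$ runs from
  $u \cos lx + v \frac{\sin lx}{l}$ at $t = 0$ to $y(x)$ at $t = x$, and in its derivative only
  the term with the potential survives.
\<close>
lemma variation_of_constants:
  assumes p: "potential L p" and s: "sl_solution L p l u v y dy" and "l \<noteq> 0" and x: "x \<in> {0..L}"
  shows "((\<lambda>t. p t * y t * (sin (l * of_real (x - t)) / l)) has_integral
     (y x - (u * cos (l * of_real x) + v * (sin (l * of_real x) / l)))) {0..x}"
proof -
  define G where "G t = sin (l * of_real (x - t)) / l" for t
  define C where "C t = cos (l * of_real (x - t))" for t
  have dG: "(G has_vector_derivative - C t) (at t within T)" for t T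
  proof -
    have "((\<lambda>z. sin (l * (of_real x - z)) / l) has_field_derivative - cos (l * (of_real x - of_real t))) (at (of_real t))"
      using \<open>l \<noteq> 0\<close> by (auto intro!: derivative_eq_intros)
    from has_vector_derivative_real_field[OF this]
    show ?thesis by (simp add: G_def[abs_def] C_def of_real_diff)
  qed
  have dC: "(C has_vector_derivative l * l * G t) (at t within T)" for t T
  proof -
    have "((\<lambda>z. cos (l * (of_real x - z))) has_field_derivative l * sin (l * (of_real x - of_real t))) (at (of_real t))"
      by (auto intro!: derivative_eq_intros)
    from has_vector_derivative_real_field[OF this]
    show ?thesis using \<open>l \<noteq> 0\<close> by (simp add: G_def C_def[abs_def] of_real_diff)
  qed
  have contC: "continuous_on {0..L} C"
    unfolding continuous_on_eq_continuous_within using dC has_vector_derivative_continuous by blast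
  have "((\<lambda>t. (p t - l\<^sup>2) * y t * G t + dy t * (- C t)) has_integral (dy x * G x - v * G 0)) {0..x}"
    by (intro sl_solution_product_rule[OF p s dG _ x] continuous_intros contC)
  moreover have "((\<lambda>t. dy t * C t + y t * (l * l * G t)) has_integral (y x * C x - y 0 * C 0)) {0..x}"
  proof (rule fundamental_theorem_of_calculus)
    fix t assume t: "t \<in> {0..x}"
    have "(y has_vector_derivative dy t) (at t within {0..L})"
      using s t x by (simp add: sl_solution_def)
    then have "(y has_vector_derivative dy t) (at t within {0..x})"
      by (rule has_vector_derivative_within_subset) (use x in auto)
    from has_vector_derivative_mult[OF this dC]
    show "((\<lambda>t. y t * C t) has_vector_derivative dy t * C t + y t * (l * l * G t)) (at t within {0..x})"
      by (simp only: add.commute)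
  qed (use x in simp)
  ultimately have H: "((\<lambda>t. ((p t - l\<^sup>2) * y t * G t + dy t * (- C t)) + (dy t * C t + y t * (l * l * G t))) has_integral
      ((dy x * G x - v * G 0) + (y x * C x - y 0 * C 0))) {0..x}"
    by (rule has_integral_add)
  have E1: "((p t - l\<^sup>2) * y t * G t + dy t * (- C t)) + (dy t * C t + y t * (l * l * G t)) = p t * y t * G t" for t
    by (simp add: algebra_simps power2_eq_square)
  have E2: "(dy x * G x - v * G 0) + (y x * C x - y 0 * C 0) = y x - (u * cos (l * of_real x) + v * (sin (l * of_real x) / l))"
    using s by (simp add: sl_solution_def G_def C_def)
  show ?thesis using H unfolding E1 E2 unfolding G_def .
qed

text \<open>
  The exponential rate is that of the solutions without potential, and the constant is uniform in
  $l$ and in the initial data. The second bound says that the potential only matters at relative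
  order $1/|l|$.
\<close>
definition growth_constant :: "real \<Rightarrow> (real \<Rightarrow> complex) \<Rightarrow> real \<Rightarrow> bool" where
  "growth_constant L p C \<longleftrightarrow> C > 0 \<and>
    (\<forall>l u v y dy x. sl_solution L p l u v y dy \<longrightarrow> cmod l \<ge> 1 \<longrightarrow> x \<in> {0..L} \<longrightarrow>
      cmod (y x) \<le> C * (cmod u + cmod v / cmod l) * exp (\<bar>Im l\<bar> * x) \<and>
      cmod (y x - (u * cos (l * of_real x) + v * (sin (l * of_real x) / l)))
        \<le> C * (cmod u + cmod v / cmod l) * exp (\<bar>Im l\<bar> * x) / cmod l)"

lemma growth_constantD:
  assumes "growth_constant L p C" "sl_solution L p l u v y dy" "cmod l \<ge> 1" "x \<in> {0..L}"
  shows "cmod (y x) \<le> C * (cmod u + cmod v / cmod l) * exp (\<bar>Im l\<bar> * x)"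
    "cmod (y x - (u * cos (l * of_real x) + v * (sin (l * of_real x) / l)))
      \<le> C * (cmod u + cmod v / cmod l) * exp (\<bar>Im l\<bar> * x) / cmod l"
  using assms unfolding growth_constant_def by blast+

text \<open>
  Let $N$ be the maximum of $|y(t)| e^{-(|\mathrm{Im}\,l| + M) t}$. In the variation of constants
  formula the kernel contributes $e^{|\mathrm{Im}\,l| (x-t)}$, so the factors with $\mathrm{Im}\,l$
  combine to $e^{|\mathrm{Im}\,l| x}$, and $M$, chosen independently of $l$, makes the integral at
  most half of the maximum. This yields $N \le 2K$ with
  $K = |u| + |v|/|l|$. Inserting the bound once more gives the second
  estimate.
\<close>
theorem growth_constant_exists:
  assumes p: "potential L p"
  shows "\<exists>C. growth_constant L p C"
proof -
  obtain M where M: "M > 0" "\<And>x. x \<in> {0..L} \<Longrightarrow> integral {0..x} (\<lambda>t. cmod (p t) * exp (M * t)) \<le> 1 / 2 * exp (M * x)"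
  proof -
    obtain M0 where "M0 > 0" "\<And>M x. M \<ge> M0 \<Longrightarrow> x \<in> {0..L} \<Longrightarrow>
        integral {0..x} (\<lambda>t. cmod (p t) * exp (M * t)) \<le> 1 / 2 * exp (M * x)"
      using exp_weighted_integral_le[OF p, of "1/2"] by auto
    then show ?thesis using that[of M0] by simp
  qed
  define P where "P = integral {0..L} (\<lambda>t. cmod (p t))"
  have pint: "(\<lambda>t. cmod (p t)) integrable_on {0..x}" if "x \<in> {0..L}" for x
    using potential_absolutely_integrable[OF p that] by (simp add: absolutely_integrable_on_def)
  have P: "integral {0..x} (\<lambda>t. cmod (p t)) \<le> P" if "x \<in> {0..L}" for x
    unfolding P_def using that pint by (intro integral_subset_le) auto
  have P0: "P \<ge> 0" unfolding P_def using p
    by (intro integral_nonneg) (auto simp: potential_def absolutely_integrable_on_def)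
  define C1 where "C1 = 2 * exp (M * \<bar>L\<bar>)"
  have C1: "C1 \<ge> 2" using M by (simp add: C1_def)
  define C where "C = C1 * (1 + P)"
  have "C > 0" unfolding C_def using C1 P0 by (intro mult_pos_pos) auto
  moreover have "C = C1 + P * C1" by (simp add: C_def algebra_simps)
  moreover have "P * C1 \<ge> 0" using C1 P0 by simp
  ultimately have C: "C > 0" "C1 \<le> C" "P * C1 \<le> C" using C1 by linarith+
  have kernel: "cmod (sin (l * of_real (x - t)) / l) \<le> exp (\<bar>Im l\<bar> * (x - t)) / cmod l" if "t \<le> x" for l x t
  proof -
    have "cmod (sin (l * of_real (x - t))) \<le> exp (\<bar>Im l\<bar> * (x - t))"
      using cmod_sin_le[of l "x - t"] that by (simp only: abs_of_nonneg diff_ge_0_iff_ge)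
    then show ?thesis unfolding norm_divide by (intro divide_right_mono) auto
  qed
  have one: "cmod (y x) \<le> C1 * (cmod u + cmod v / cmod l) * exp (\<bar>Im l\<bar> * x)"
    if s: "sl_solution L p l u v y dy" and l: "cmod l \<ge> 1" and x: "x \<in> {0..L}" for l u v y dy x
  proof -
    define \<tau> where "\<tau> = \<bar>Im l\<bar>"
    define K where "K = cmod u + cmod v / cmod l"
    have K: "K \<ge> 0" by (simp add: K_def)
    have l0: "l \<noteq> 0" using l by auto
    define g where "g t = cmod (y t) * exp (- ((\<tau> + M) * t))" for t
    have "continuous_on {0..L} g"
      unfolding g_def using sl_solution_continuous[OF s] by (intro continuous_intros)
    then obtain x0 where x0: "x0 \<in> {0..L}" "\<And>t. t \<in> {0..L} \<Longrightarrow> g t \<le> g x0"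
      using continuous_attains_sup[OF compact_Icc _ \<open>continuous_on {0..L} g\<close>] x by blast
    define N where "N = g x0"
    have yg: "cmod (y t) = g t * exp ((\<tau> + M) * t)" for t
      by (simp add: g_def mult.assoc exp_add[symmetric])
    have yN: "cmod (y t) \<le> N * exp ((\<tau> + M) * t)" if "t \<in> {0..L}" for t
      unfolding yg N_def using x0(2)[OF that] by (intro mult_right_mono) auto
    have N: "N \<ge> 0" by (simp add: N_def g_def)
    have y0: "cmod (u * cos (l * of_real x0) + v * (sin (l * of_real x0) / l)) \<le> K * exp (\<tau> * x0)"
    proof -
      have "cmod (cos (l * of_real x0)) \<le> exp (\<tau> * x0)"
        using cmod_cos_le[of l x0] x0(1) by (simp add: \<tau>_def)
      then have 1: "cmod (u * cos (l * of_real x0)) \<le> cmod u * exp (\<tau> * x0)"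
        unfolding norm_mult by (intro mult_left_mono) auto
      have "cmod (sin (l * of_real x0) / l) \<le> exp (\<tau> * x0) / cmod l"
        using kernel[of 0 x0 l] x0(1) unfolding \<tau>_def by simp
      then have "cmod (v * (sin (l * of_real x0) / l)) \<le> cmod v * (exp (\<tau> * x0) / cmod l)"
        unfolding norm_mult by (intro mult_left_mono) auto
      also have "\<dots> = cmod v / cmod l * exp (\<tau> * x0)" by simp
      finally have "cmod (u * cos (l * of_real x0)) + cmod (v * (sin (l * of_real x0) / l)) \<le> K * exp (\<tau> * x0)"
        using 1 unfolding K_def distrib_right by linarith
      then show ?thesis by (rule norm_triangle_le)
    qed
    have pe: "(\<lambda>t. cmod (p t) * exp (M * t)) integrable_on {0..x0}"
      using potential_mult_integrable(2)[OF p x0(1), of "\<lambda>t. of_real (exp (M * t))"]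
      by (simp add: continuous_intros)
    have "cmod (y x0 - (u * cos (l * of_real x0) + v * (sin (l * of_real x0) / l)))
        \<le> N * exp (\<tau> * x0) * integral {0..x0} (\<lambda>t. cmod (p t) * exp (M * t))"
    proof (rule has_integral_norm_le[OF variation_of_constants[OF p s l0 x0(1)] has_integral_mult_right[OF integrable_integral[OF pe]]])
      fix t assume t: "t \<in> {0..x0}"
      have "cmod (sin (l * of_real (x0 - t)) / l) \<le> exp (\<tau> * (x0 - t)) / cmod l"
        using kernel[of t x0 l] t by (simp add: \<tau>_def)
      also have "\<dots> \<le> exp (\<tau> * (x0 - t))"
        using l by (simp add: divide_le_eq)
      finally have "cmod (p t * y t * (sin (l * of_real (x0 - t)) / l))
          \<le> cmod (p t) * (N * exp ((\<tau> + M) * t)) * exp (\<tau> * (x0 - t))"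
        unfolding norm_mult using yN[of t] t x0(1) by (intro mult_mono mult_left_mono) (auto intro!: mult_nonneg_nonneg N)
      also have "\<dots> = N * exp (\<tau> * x0) * (cmod (p t) * exp (M * t))"
      proof -
        have "exp ((\<tau> + M) * t) * exp (\<tau> * (x0 - t)) = exp (\<tau> * x0) * exp (M * t)"
          unfolding mult_exp_exp by (simp add: algebra_simps)
        then have "cmod (p t) * N * (exp ((\<tau> + M) * t) * exp (\<tau> * (x0 - t))) = cmod (p t) * N * (exp (\<tau> * x0) * exp (M * t))"
          by simp
        then show ?thesis by (simp only: mult_ac)
      qed
      finally show "cmod (p t * y t * (sin (l * of_real (x0 - t)) / l)) \<le> N * exp (\<tau> * x0) * (cmod (p t) * exp (M * t))" .
    qed
    also have "\<dots> \<le> N * exp (\<tau> * x0) * (1 / 2 * exp (M * x0))"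
      using M(2)[OF x0(1)] N by (intro mult_left_mono) auto
    finally have "cmod (y x0) \<le> K * exp (\<tau> * x0) + N * exp (\<tau> * x0) * (1 / 2 * exp (M * x0))"
      using y0 norm_triangle_ineq2[of "y x0" "u * cos (l * of_real x0) + v * (sin (l * of_real x0) / l)"] by linarith
    also have "K * exp (\<tau> * x0) \<le> K * exp (\<tau> * x0) * exp (M * x0)"
      using K M x0(1) mult_left_mono[of 1 "exp (M * x0)" "K * exp (\<tau> * x0)"] by simp
    finally have le: "cmod (y x0) \<le> K * exp (\<tau> * x0) * exp (M * x0) + N * exp (\<tau> * x0) * (1 / 2 * exp (M * x0))"
      by simp
    have "cmod (y x0) \<le> (K + N / 2) * exp ((\<tau> + M) * x0)"
    proof -
      have "exp ((\<tau> + M) * x0) = exp (\<tau> * x0) * exp (M * x0)" by (simp add: exp_add distrib_right)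
      then have "(K + N / 2) * exp ((\<tau> + M) * x0) = K * exp (\<tau> * x0) * exp (M * x0) + N * exp (\<tau> * x0) * (1 / 2 * exp (M * x0))"
        by (simp add: distrib_right)
      with le show ?thesis by simp
    qed
    then have "N * exp ((\<tau> + M) * x0) \<le> (K + N / 2) * exp ((\<tau> + M) * x0)"
      unfolding yg N_def .
    then have "N \<le> K + N / 2" by (rule mult_right_le_imp_le) simp
    then have NK: "N \<le> 2 * K" by simp
    have "cmod (y x) \<le> N * exp ((\<tau> + M) * x)" by (rule yN[OF x])
    also have "\<dots> \<le> (2 * K) * exp ((\<tau> + M) * x)" using NK by (intro mult_right_mono) auto
    also have "\<dots> = 2 * exp (M * x) * K * exp (\<tau> * x)" by (simp add: exp_add distrib_right)
    also have "\<dots> \<le> C1 * K * exp (\<tau> * x)"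
      unfolding C1_def using K M x by (intro mult_right_mono mult_left_mono) auto
    finally show ?thesis by (simp add: K_def \<tau>_def)
  qed
  have two: "cmod (y x) \<le> C * (cmod u + cmod v / cmod l) * exp (\<bar>Im l\<bar> * x)"
      "cmod (y x - (u * cos (l * of_real x) + v * (sin (l * of_real x) / l)))
        \<le> C * (cmod u + cmod v / cmod l) * exp (\<bar>Im l\<bar> * x) / cmod l"
    if s: "sl_solution L p l u v y dy" and l: "cmod l \<ge> 1" and x: "x \<in> {0..L}" for l u v y dy x
  proof -
    define \<tau> where "\<tau> = \<bar>Im l\<bar>"
    define K where "K = cmod u + cmod v / cmod l"
    have K: "K \<ge> 0" by (simp add: K_def)
    have l0: "l \<noteq> 0" using l by auto
    have "cmod (y x) \<le> C1 * K * exp (\<tau> * x)" using one[OF s l x] by (simp add: K_def \<tau>_def)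
    also have "\<dots> \<le> C * K * exp (\<tau> * x)" using C K by (intro mult_right_mono) auto
    finally show "cmod (y x) \<le> C * (cmod u + cmod v / cmod l) * exp (\<bar>Im l\<bar> * x)" by (simp add: K_def \<tau>_def)
    have "cmod (y x - (u * cos (l * of_real x) + v * (sin (l * of_real x) / l)))
        \<le> C1 * K * exp (\<tau> * x) / cmod l * integral {0..x} (\<lambda>t. cmod (p t))"
    proof (rule has_integral_norm_le[OF variation_of_constants[OF p s l0 x] has_integral_mult_right[OF integrable_integral[OF pint[OF x]]]])
      fix t assume t: "t \<in> {0..x}"
      have "cmod (p t * y t * (sin (l * of_real (x - t)) / l))
          \<le> cmod (p t) * (C1 * K * exp (\<tau> * t)) * (exp (\<tau> * (x - t)) / cmod l)"
        unfolding norm_mult[of "p t * y t"] norm_mult[of "p t"]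
        using one[OF s l, of t] kernel[of t x l] t x C1 K
        by (intro mult_mono mult_left_mono) (auto simp: K_def \<tau>_def intro!: mult_nonneg_nonneg)
      also have "\<dots> = C1 * K * exp (\<tau> * x) / cmod l * cmod (p t)"
      proof -
        have "exp (\<tau> * t) * exp (\<tau> * (x - t)) = exp (\<tau> * x)" unfolding mult_exp_exp by (simp add: algebra_simps)
        then have "cmod (p t) * C1 * K / cmod l * (exp (\<tau> * t) * exp (\<tau> * (x - t))) = cmod (p t) * C1 * K / cmod l * exp (\<tau> * x)"
          by simp
        then show ?thesis by (simp add: mult_ac)
      qed
      finally show "cmod (p t * y t * (sin (l * of_real (x - t)) / l)) \<le> C1 * K * exp (\<tau> * x) / cmod l * cmod (p t)" .
    qed
    also have "\<dots> \<le> C1 * K * exp (\<tau> * x) / cmod l * P"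
      using P[OF x] C1 K by (intro mult_left_mono) auto
    also have "\<dots> = (P * C1) * K * exp (\<tau> * x) / cmod l" by simp
    also have "\<dots> \<le> C * K * exp (\<tau> * x) / cmod l"
      using C K by (intro divide_right_mono mult_right_mono) auto
    finally show "cmod (y x - (u * cos (l * of_real x) + v * (sin (l * of_real x) / l)))
        \<le> C * (cmod u + cmod v / cmod l) * exp (\<bar>Im l\<bar> * x) / cmod l" by (simp add: K_def \<tau>_def)
  qed
  show ?thesis
    unfolding growth_constant_def using C(1) two by (intro exI[of _ C]) blast
qed

lemma growth_constant_fundamental:
  assumes "growth_constant b p C" "cmod l \<ge> 1" "x \<in> {0..b}"
  shows "sl_solution b p l 1 0 y dy \<Longrightarrow> cmod (y x) \<le> C * exp (\<bar>Im l\<bar> * x)"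
    "sl_solution b p l 0 1 y dy \<Longrightarrow> cmod (y x) \<le> C * exp (\<bar>Im l\<bar> * x) / cmod l"
    "sl_solution b p l 1 0 y dy \<Longrightarrow> cmod (y x - cos (l * of_real x)) \<le> C * exp (\<bar>Im l\<bar> * x) / cmod l"
  using growth_constantD(1)[OF assms(1) _ assms(2,3), of 1 0 y dy] growth_constantD(1)[OF assms(1) _ assms(2,3), of 0 1 y dy]
    growth_constantD(2)[OF assms(1) _ assms(2,3), of 1 0 y dy] by simp_all

lemma growth_constant_robin:
  fixes \<alpha>0 :: real
  assumes G: "growth_constant b p C" and \<alpha>0: "\<alpha>0 \<ge> 0" and l: "cmod l \<ge> 1" and x: "x \<in> {0..b}"
    and s: "sl_solution b p l 1 (\<i> * \<alpha>0 * l + \<beta>0) y dy"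
  shows "cmod (y x) \<le> C * (1 + \<alpha>0 + cmod \<beta>0) * exp (\<bar>Im l\<bar> * x)"
    "cmod (y x - (1 * cos (l * of_real x) + (\<i> * \<alpha>0 * l + \<beta>0) * (sin (l * of_real x) / l)))
      \<le> C * (1 + \<alpha>0 + cmod \<beta>0) * exp (\<bar>Im l\<bar> * x) / cmod l"
proof -
  have "cmod (\<i> * \<alpha>0 * l + \<beta>0) \<le> cmod (\<i> * \<alpha>0 * l) + cmod \<beta>0" by (rule norm_triangle_ineq)
  also have "\<dots> = \<alpha>0 * cmod l + cmod \<beta>0" using \<alpha>0 by (simp add: norm_mult)
  also have "\<dots> \<le> (\<alpha>0 + cmod \<beta>0) * cmod l"
    using mult_left_mono[OF l, of "cmod \<beta>0"] by (simp add: distrib_right)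
  finally have "cmod (\<i> * \<alpha>0 * l + \<beta>0) / cmod l \<le> \<alpha>0 + cmod \<beta>0"
    using l by (subst divide_le_eq) auto
  then have 1: "C * (cmod 1 + cmod (\<i> * \<alpha>0 * l + \<beta>0) / cmod l) * exp (\<bar>Im l\<bar> * x)
      \<le> C * (1 + \<alpha>0 + cmod \<beta>0) * exp (\<bar>Im l\<bar> * x)"
    using G unfolding growth_constant_def by (intro mult_right_mono mult_left_mono) auto
  show "cmod (y x) \<le> C * (1 + \<alpha>0 + cmod \<beta>0) * exp (\<bar>Im l\<bar> * x)"
    by (rule order_trans[OF growth_constantD(1)[OF G s l x] 1])
  show "cmod (y x - (1 * cos (l * of_real x) + (\<i> * \<alpha>0 * l + \<beta>0) * (sin (l * of_real x) / l)))
      \<le> C * (1 + \<alpha>0 + cmod \<beta>0) * exp (\<bar>Im l\<bar> * x) / cmod l"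
    by (rule order_trans[OF growth_constantD(2)[OF G s l x] divide_right_mono[OF 1]]) simp
qed

lemma sl_solution_shift: "sl_solution L p l u v y dy \<longleftrightarrow> sl_solution L (\<lambda>t. p t - l\<^sup>2 + m\<^sup>2) m u v y dy"
  by (simp add: sl_solution_def)

lemma sl_solution_diff:
  assumes s1: "sl_solution L p l u1 v1 y1 dy1" and s2: "sl_solution L p l u2 v2 y2 dy2"
  shows "sl_solution L p l (c1 * u1 - c2 * u2) (c1 * v1 - c2 * v2) (\<lambda>x. c1 * y1 x - c2 * y2 x) (\<lambda>x. c1 * dy1 x - c2 * dy2 x)"
  unfolding sl_solution_def
proof (intro conjI ballI)
  fix x assume x: "x \<in> {0..L}"
  show "((\<lambda>x. c1 * y1 x - c2 * y2 x) has_vector_derivative c1 * dy1 x - c2 * dy2 x) (at x within {0..L})"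
    using s1 s2 x unfolding sl_solution_def by (auto intro!: derivative_intros)
  have "((\<lambda>t. c1 * ((p t - l\<^sup>2) * y1 t) - c2 * ((p t - l\<^sup>2) * y2 t)) has_integral (c1 * (dy1 x - v1) - c2 * (dy2 x - v2))) {0..x}"
    using s1 s2 x unfolding sl_solution_def by (intro has_integral_diff has_integral_mult_right) auto
  then show "((\<lambda>t. (p t - l\<^sup>2) * (c1 * y1 t - c2 * y2 t)) has_integral c1 * dy1 x - c2 * dy2 x - (c1 * v1 - c2 * v2)) {0..x}"
    by (simp add: algebra_simps)
qed (use s1 s2 in \<open>auto simp: sl_solution_def\<close>)

text \<open>
  The growth bound for zero initial data forces the difference to vanish. It is available for
  $|l| \ge 1$, so the spectral parameter is first shifted to $1$.
\<close>
theorem sl_solution_unique: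
  assumes p: "potential L p" and s1: "sl_solution L p l u v y1 dy1" and s2: "sl_solution L p l u v y2 dy2"
    and x: "x \<in> {0..L}"
  shows "y1 x = y2 x" "dy1 x = dy2 x"
proof -
  have s: "sl_solution L p l 0 0 (\<lambda>x. y1 x - y2 x) (\<lambda>x. dy1 x - dy2 x)"
    using sl_solution_diff[OF s1 s2, of 1 1] by simp
  have pot: "potential L (\<lambda>t. p t - l\<^sup>2 + 1\<^sup>2)"
    using potential_add_const[OF p, of "- l\<^sup>2 + 1"] by (simp add: algebra_simps)
  obtain C where G: "growth_constant L (\<lambda>t. p t - l\<^sup>2 + 1\<^sup>2) C"
    using growth_constant_exists[OF pot] by blast
  have s': "sl_solution L (\<lambda>t. p t - l\<^sup>2 + 1\<^sup>2) 1 0 0 (\<lambda>x. y1 x - y2 x) (\<lambda>x. dy1 x - dy2 x)"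
    using s sl_solution_shift[of L p l 0 0 _ _ 1] by blast
  have eq: "y1 t = y2 t" if t: "t \<in> {0..L}" for t
    using growth_constantD(1)[OF G s' _ t] by simp
  show "y1 x = y2 x" by (rule eq[OF x])
  have "((\<lambda>t. (p t - l\<^sup>2) * (y1 t - y2 t)) has_integral (dy1 x - dy2 x)) {0..x}"
    using s x unfolding sl_solution_def by simp
  then have "((\<lambda>t. 0) has_integral (dy1 x - dy2 x)) {0..x}"
    by (rule has_integral_eq[rotated]) (use x eq in auto)
  then show "dy1 x = dy2 x" using has_integral_0_eq by fastforce
qed

lemma sl_solution_subinterval:
  assumes "sl_solution L p l u v y dy" "b \<le> L"
  shows "sl_solution b p l u v y dy"
  unfolding sl_solution_def
proof (intro conjI ballI)
  fix x assume x: "x \<in> {0..b}"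
  then have xL: "x \<in> {0..L}" using assms(2) by auto
  then have "(y has_vector_derivative dy x) (at x within {0..L})"
    using assms by (simp add: sl_solution_def)
  then show "(y has_vector_derivative dy x) (at x within {0..b})"
    by (rule has_vector_derivative_within_subset) (use assms(2) in auto)
  show "((\<lambda>t. (p t - l\<^sup>2) * y t) has_integral dy x - v) {0..x}"
    using assms xL by (simp add: sl_solution_def)
qed (use assms in \<open>simp_all add: sl_solution_def\<close>)

text \<open>
  The transfer argument needs solutions that start at the right end; reflection provides them without a second existence theory.
\<close>
lemma sl_solution_reflect:
  assumes p: "potential b p" and s: "sl_solution b p l u v y dy" and "b \<ge> 0"
  shows "sl_solution b (\<lambda>t. p (b - t)) l (y b) (- dy b) (\<lambda>t. y (b - t)) (\<lambda>t. - dy (b - t))"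
  unfolding sl_solution_def
proof (intro conjI ballI)
  fix x assume x: "x \<in> {0..b}"
  have "(y has_vector_derivative dy (b - x)) (at (b - x) within {0..b})"
    using s x by (simp add: sl_solution_def)
  then have "(y has_vector_derivative dy (b - x)) (at (b - x) within (\<lambda>t. b - t) ` {0..b})"
    by (rule has_vector_derivative_within_subset) auto
  moreover have "((\<lambda>t. b - t) has_vector_derivative - 1) (at x within {0..b})"
    by (auto intro!: derivative_eq_intros)
  ultimately have "(y \<circ> (\<lambda>t. b - t) has_vector_derivative - 1 *\<^sub>R dy (b - x)) (at x within {0..b})"
    by (intro vector_diff_chain_within)
  then show "((\<lambda>t. y (b - t)) has_vector_derivative - dy (b - x)) (at x within {0..b})"
    by (simp add: o_def)
  define f where "f t = (p t - l\<^sup>2) * y t" for t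
  have f: "(f has_integral (dy t - v)) {0..t}" if "t \<in> {0..b}" for t
    using s that by (simp add: sl_solution_def f_def[abs_def])
  have "(f has_integral (dy b - dy (b - x))) {b - x..b}"
    using has_integral_increment[of b f "\<lambda>t. dy t - v" "b - x" b] f x by simp
  from has_integral_reflect_interval[OF this, of b]
  show "((\<lambda>t. (p (b - t) - l\<^sup>2) * y (b - t)) has_integral - dy (b - x) - - dy b) {0..x}"
    by (simp add: f_def)
qed auto

text \<open>
  For $z = lb$ the main part $\cos z + i \alpha_0 \sin z$ is
  $\frac{1 + \alpha_0}{2} e^{iz} + \frac{1 - \alpha_0}{2} e^{-iz}$. Both coefficients are nonzero,
  so in either half plane the growing exponential is present, and far from the real axis it beats the
  decaying one and the relative errors of order $1/|l|$.
\<close>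
lemma robin_solution_lower_bound:
  fixes \<alpha>0 b :: real and \<beta>0 :: complex
  assumes p: "potential b p" and "b > 0" and \<alpha>0: "\<alpha>0 \<ge> 0" "\<alpha>0 \<noteq> 1"
  obtains c M where "c > 0" "M \<ge> 1"
    "\<And>l y dy. sl_solution b p l 1 (\<i> * \<alpha>0 * l + \<beta>0) y dy \<Longrightarrow> \<bar>Im l\<bar> \<ge> M \<Longrightarrow> cmod (y b) \<ge> c * exp (\<bar>Im l\<bar> * b)"
proof -
  obtain C where G: "growth_constant b p C" using growth_constant_exists[OF p] by blast
  then have C: "C > 0" by (simp add: growth_constant_def)
  define \<kappa> where "\<kappa> = \<bar>1 - \<alpha>0\<bar> / 2"
  define \<sigma> where "\<sigma> = (1 + \<alpha>0) / 2"
  have \<kappa>: "\<kappa> > 0" "\<kappa> \<le> \<sigma>" using \<alpha>0 by (auto simp: \<kappa>_def \<sigma>_def)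
  define B where "B = cmod \<beta>0 + C * (1 + \<alpha>0 + cmod \<beta>0)"
  have B: "B \<ge> 0" using C \<alpha>0 by (simp add: B_def)
  \<comment> \<open>For $|\mathrm{Im}\,l| \ge M$ all errors together are at most half of the main coefficient.\<close>
  define M where "M = 1 + 2 * (\<sigma> / (2 * b) + B) / \<kappa>"
  have M: "M \<ge> 1" "\<sigma> / (2 * b) + B \<le> M * (\<kappa> / 2)"
    using \<kappa> B \<open>b > 0\<close> by (auto simp: M_def field_simps)
  show ?thesis
  proof (rule that[of "\<kappa> / 2" M])
    fix l y dy assume s: "sl_solution b p l 1 (\<i> * \<alpha>0 * l + \<beta>0) y dy" and Ml: "\<bar>Im l\<bar> \<ge> M"
    define T where "T = \<bar>Im l\<bar> * b"
    have T: "T \<ge> M * b" "T > 0" using Ml M \<open>b > 0\<close> by (auto simp: T_def mult_right_mono)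
    have lM: "cmod l \<ge> M" using Ml abs_Im_le_cmod[of l] by linarith
    have l1: "cmod l \<ge> 1" "l \<noteq> 0" using lM M by auto
    define z where "z = l * of_real b"
    have Tz: "T = \<bar>Im z\<bar>" using \<open>b > 0\<close> by (simp add: T_def z_def abs_mult)
    define main where "main = cos z + \<i> * \<alpha>0 * sin z"
    have main: "cmod main \<ge> \<kappa> * exp T - \<sigma> * exp (- T)"
    proof -
      have eq: "main = of_real \<sigma> * exp (\<i> * z) + of_real ((1 - \<alpha>0) / 2) * exp (- (\<i> * z))"
        by (simp add: main_def \<sigma>_def cos_exp_eq sin_exp_eq field_simps)
      have n: "cmod (of_real \<sigma> * exp (\<i> * z)) = \<sigma> * exp (- Im z)"
        "cmod (of_real ((1 - \<alpha>0) / 2) * exp (- (\<i> * z))) = \<kappa> * exp (Im z)"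
        unfolding norm_mult norm_of_real using \<alpha>0 by (simp_all add: \<sigma>_def \<kappa>_def)
      show ?thesis
      proof (cases "Im z \<ge> 0")
        case True
        have "cmod main \<ge> \<kappa> * exp (Im z) - \<sigma> * exp (- Im z)"
          unfolding eq using norm_diff_ineq[of "of_real ((1 - \<alpha>0) / 2) * exp (- (\<i> * z))" "of_real \<sigma> * exp (\<i> * z)"]
          unfolding n by (simp add: add.commute)
        then show ?thesis using True Tz by simp
      next
        case False
        have "cmod main \<ge> \<sigma> * exp (- Im z) - \<kappa> * exp (Im z)"
          unfolding eq using norm_diff_ineq[of "of_real \<sigma> * exp (\<i> * z)" "of_real ((1 - \<alpha>0) / 2) * exp (- (\<i> * z))"]
          unfolding n by simp
        moreover have "exp (- Im z) = exp T" "exp (Im z) = exp (- T)" using False Tz by auto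
        moreover have "\<kappa> * exp T \<le> \<sigma> * exp T" "\<kappa> * exp (- T) \<le> \<sigma> * exp (- T)" using \<kappa> by auto
        ultimately show ?thesis by (metis diff_mono order_trans)
      qed
    qed
    have 1: "cmod (y b - (1 * cos z + (\<i> * \<alpha>0 * l + \<beta>0) * (sin z / l))) \<le> C * (1 + \<alpha>0 + cmod \<beta>0) * exp T / cmod l"
      using growth_constant_robin(2)[OF G \<alpha>0(1) l1(1) _ s, of b] \<open>b > 0\<close> by (simp add: z_def T_def)
    have 2: "1 * cos z + (\<i> * \<alpha>0 * l + \<beta>0) * (sin z / l) = main + \<beta>0 * sin z / l"
      using l1 by (simp add: main_def field_simps)
    have "cmod (sin z) \<le> exp T"
      using cmod_sin_le[of l b] \<open>b > 0\<close> by (simp add: z_def T_def)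
    then have 3: "cmod (\<beta>0 * sin z / l) \<le> cmod \<beta>0 * exp T / cmod l"
      unfolding norm_mult norm_divide by (intro divide_right_mono mult_left_mono) auto
    have "cmod main - cmod \<beta>0 * exp T / cmod l - C * (1 + \<alpha>0 + cmod \<beta>0) * exp T / cmod l \<le> cmod (y b)"
    proof -
      have "main = y b - (y b - (main + \<beta>0 * sin z / l)) - \<beta>0 * sin z / l" by simp
      then have "cmod main \<le> cmod (y b) + cmod (y b - (main + \<beta>0 * sin z / l)) + cmod (\<beta>0 * sin z / l)"
        by (metis norm_triangle_ineq4 norm_triangle_le_diff order_trans add_right_mono)
      then show ?thesis using 1 3 unfolding 2 by linarith
    qed
    then have 4: "\<kappa> * exp T - \<sigma> * exp (- T) - B * exp T / cmod l \<le> cmod (y b)"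
      using main by (simp add: B_def distrib_right add_divide_distrib)
    \<comment> \<open>The decaying exponential is compared through $e^{2T} \ge 2T \ge 2Mb$.\<close>
    have 5: "\<sigma> * exp (- T) \<le> \<sigma> / (2 * b) / M * exp T"
    proof -
      have "2 * (M * b) \<le> exp (2 * T)"
        using exp_ge_add_one_self[of "2 * T"] T by linarith
      then have "1 \<le> exp (2 * T) / (2 * b * M)" using M \<open>b > 0\<close> by (simp add: field_simps)
      then have "\<sigma> * exp (- T) * 1 \<le> \<sigma> * exp (- T) * (exp (2 * T) / (2 * b * M))"
        using \<kappa> by (intro mult_left_mono) auto
      also have "\<dots> = \<sigma> / (2 * b) / M * (exp (- T) * exp (2 * T))" by simp
      also have "exp (- T) * exp (2 * T) = exp T" unfolding mult_exp_exp by simp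
      finally show ?thesis by simp
    qed
    have 6: "B * exp T / cmod l \<le> B / M * exp T"
    proof -
      have "B * exp T / cmod l \<le> B * exp T / M" using lM M B l1 by (intro divide_left_mono mult_pos_pos) auto
      then show ?thesis by simp
    qed
    have "(\<sigma> / (2 * b) + B) / M \<le> \<kappa> / 2"
      using M by (simp add: divide_le_eq mult.commute)
    then have "(\<sigma> / (2 * b) + B) / M * exp T \<le> \<kappa> / 2 * exp T" by (intro mult_right_mono) auto
    then have "\<sigma> / (2 * b) / M * exp T + B / M * exp T \<le> \<kappa> / 2 * exp T"
      by (simp add: add_divide_distrib distrib_right)
    moreover have "\<kappa> * exp T = \<kappa> / 2 * exp T + \<kappa> / 2 * exp T" by simp
    ultimately have "\<kappa> / 2 * exp T \<le> cmod (y b)" using 4 5 6 by argo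
    then show "\<kappa> / 2 * exp (\<bar>Im l\<bar> * b) \<le> cmod (y b)" by (simp add: T_def)
  qed (use \<kappa> M in auto)
qed

section \<open>A potential is determined by its solution at an endpoint\<close>

text \<open>
  The entry is bounded on the strip $|\mathrm{Im}\,l| \le M$ by the bounds for its factors, and off
  the strip it is $O(1/|l|)$ by a second representation through the solutions from the left, which the
  vanishing Wronskian provides. So it is constant by Liouville's theorem, and zero because it tends to
  zero along the imaginary axis.
\<close>
lemma transfer_entry_vanishes:
  fixes \<alpha>0 \<alpha>0' b :: real and \<beta>0 \<beta>0' :: complex
  assumes p: "potential b p" and p': "potential b p'" and b: "b > 0"
    and \<alpha>0: "\<alpha>0 \<ge> 0" "\<alpha>0 \<noteq> 1" and \<alpha>0': "\<alpha>0' \<ge> 0" "\<alpha>0' \<noteq> 1"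
    and Y: "\<And>l. sl_solution b p l 1 (\<i> * \<alpha>0 * l + \<beta>0) (Y l) (D l)"
    and Y': "\<And>l. sl_solution b p' l 1 (\<i> * \<alpha>0' * l + \<beta>0') (Y' l) (D' l)"
    and W: "\<And>l. Y l b * D' l b = D l b * Y' l b"
    and \<theta>: "\<And>l. sl_solution b (\<lambda>t. p (b - t)) l 1 0 (\<theta> l) (d\<theta> l)"
    and \<phi>: "\<And>l. sl_solution b (\<lambda>t. p (b - t)) l 0 1 (\<phi> l) (d\<phi> l)"
    and \<theta>': "\<And>l. sl_solution b (\<lambda>t. p' (b - t)) l 1 0 (\<theta>' l) (d\<theta>' l)"
    and \<phi>': "\<And>l. sl_solution b (\<lambda>t. p' (b - t)) l 0 1 (\<phi>' l) (d\<phi>' l)"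
    and x: "x \<in> {0..b}"
    and hol: "(\<lambda>l. \<phi> l x * \<theta>' l x - \<theta> l x * \<phi>' l x) holomorphic_on UNIV"
  shows "\<phi> l x * \<theta>' l x = \<theta> l x * \<phi>' l x"
proof -
  define F where "F l = \<phi> l x * \<theta>' l x - \<theta> l x * \<phi>' l x" for l
  note P = potential_reflect[OF p] and P' = potential_reflect[OF p']
  have bx: "b - x \<in> {0..b}" using x by auto
  obtain C1 C2 C3 C4 where G1: "growth_constant b (\<lambda>t. p (b - t)) C1" and G2: "growth_constant b (\<lambda>t. p' (b - t)) C2"
    and G3: "growth_constant b p C3" and G4: "growth_constant b p' C4"
    using growth_constant_exists P P' p p' by meson
  have C: "C1 > 0" "C2 > 0" "C3 > 0" "C4 > 0"
    using G1 G2 G3 G4 by (auto simp: growth_constant_def)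
  define B3 where "B3 = C3 * (1 + \<alpha>0 + cmod \<beta>0)"
  define B4 where "B4 = C4 * (1 + \<alpha>0' + cmod \<beta>0')"
  have B: "B3 > 0" "B4 > 0"
    unfolding B3_def B4_def using C \<alpha>0(1) \<alpha>0'(1) by (auto intro!: mult_pos_pos add_pos_nonneg)
  obtain c1 M1 where c1: "c1 > 0" "M1 \<ge> 1"
    "\<And>l y dy. sl_solution b p l 1 (\<i> * \<alpha>0 * l + \<beta>0) y dy \<Longrightarrow> \<bar>Im l\<bar> \<ge> M1 \<Longrightarrow> cmod (y b) \<ge> c1 * exp (\<bar>Im l\<bar> * b)"
    by (rule robin_solution_lower_bound[OF p b \<alpha>0], rule that) blast+
  obtain c2 M2 where c2: "c2 > 0" "M2 \<ge> 1"
    "\<And>l y dy. sl_solution b p' l 1 (\<i> * \<alpha>0' * l + \<beta>0') y dy \<Longrightarrow> \<bar>Im l\<bar> \<ge> M2 \<Longrightarrow> cmod (y b) \<ge> c2 * exp (\<bar>Im l\<bar> * b)"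
    by (rule robin_solution_lower_bound[OF p' b \<alpha>0'], rule that) blast+
  define M where "M = max M1 M2"
  have M: "M \<ge> 1" "M \<ge> M1" "M \<ge> M2" using c1 by (auto simp: M_def)
  define K where "K = C1 * B4 / c2 + C2 * B3 / c1"
  have K: "K \<ge> 0" using C B c1 c2 by (simp add: K_def)
  \<comment> \<open>The exponentials $e^{\tau x}$ and $e^{\tau (b - x)}$ exactly compensate $e^{\tau b}$.\<close>
  have quotient: "cmod (f * z / d) \<le> A * B / c / cmod l"
    if "cmod f \<le> A * exp (\<tau> * x) / cmod l" "cmod z \<le> B * exp (\<tau> * (b - x))" "cmod d \<ge> c * exp (\<tau> * b)"
      "A > 0" "B > 0" "c > 0" "l \<noteq> 0" for f z d l :: complex and A B c \<tau> :: real
  proof -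
    have "cmod (f * z / d) = cmod f * cmod z / cmod d" by (simp add: norm_mult norm_divide)
    also have "\<dots> \<le> (A * exp (\<tau> * x) / cmod l) * (B * exp (\<tau> * (b - x))) / (c * exp (\<tau> * b))"
      using that by (intro frac_le mult_mono) auto
    also have "\<dots> = A * B / c / cmod l * ((exp (\<tau> * x) * exp (\<tau> * (b - x))) / exp (\<tau> * b))" by (simp add: mult_ac)
    also have "exp (\<tau> * x) * exp (\<tau> * (b - x)) = exp (\<tau> * b)"
      unfolding mult_exp_exp by (simp add: algebra_simps)
    finally show ?thesis by simp
  qed
  \<comment> \<open>Off the strip the solutions from the two ends are used, the denominators being large.\<close>
  have far: "cmod (F l) \<le> K / cmod l" if l: "\<bar>Im l\<bar> \<ge> M" for l
  proof -
    have lM: "cmod l \<ge> M" using l abs_Im_le_cmod[of l] by linarith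
    then have l1: "cmod l \<ge> 1" "l \<noteq> 0" using M by auto
    have d: "cmod (Y l b) \<ge> c1 * exp (\<bar>Im l\<bar> * b)" using c1(3)[OF Y] l M by simp
    have d': "cmod (Y' l b) \<ge> c2 * exp (\<bar>Im l\<bar> * b)" using c2(3)[OF Y'] l M by simp
    have nz: "Y l b \<noteq> 0" "Y' l b \<noteq> 0"
      using less_le_trans[OF mult_pos_pos[OF c1(1) exp_gt_zero] d] less_le_trans[OF mult_pos_pos[OF c2(1) exp_gt_zero] d']
      by auto
    \<comment> \<open>Both sides solve the reflected problem with the same data.\<close>
    have z: "Y l (b - x) = Y l b * \<theta> l x - D l b * \<phi> l x"
    proof (rule sl_solution_unique(1)[OF P _ _ x])
      show "sl_solution b (\<lambda>t. p (b - t)) l (Y l b) (- D l b) (\<lambda>t. Y l (b - t)) (\<lambda>t. - D l (b - t))"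
        using b by (intro sl_solution_reflect[OF p Y]) simp
      show "sl_solution b (\<lambda>t. p (b - t)) l (Y l b) (- D l b) (\<lambda>x. Y l b * \<theta> l x - D l b * \<phi> l x)
          (\<lambda>x. Y l b * d\<theta> l x - D l b * d\<phi> l x)"
        using sl_solution_diff[OF \<theta> \<phi>, of l "Y l b" "D l b"] by simp
    qed
    have z': "Y' l (b - x) = Y' l b * \<theta>' l x - D' l b * \<phi>' l x"
    proof (rule sl_solution_unique(1)[OF P' _ _ x])
      show "sl_solution b (\<lambda>t. p' (b - t)) l (Y' l b) (- D' l b) (\<lambda>t. Y' l (b - t)) (\<lambda>t. - D' l (b - t))"
        using b by (intro sl_solution_reflect[OF p' Y']) simp
      show "sl_solution b (\<lambda>t. p' (b - t)) l (Y' l b) (- D' l b) (\<lambda>x. Y' l b * \<theta>' l x - D' l b * \<phi>' l x)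
          (\<lambda>x. Y' l b * d\<theta>' l x - D' l b * d\<phi>' l x)"
        using sl_solution_diff[OF \<theta>' \<phi>', of l "Y' l b" "D' l b"] by simp
    qed
    have "Y l b * Y' l b * F l = Y l b * (\<phi> l x * Y' l (b - x)) - Y' l b * (\<phi>' l x * Y l (b - x))
        + (Y l b * D' l b - D l b * Y' l b) * (\<phi> l x * \<phi>' l x)"
      unfolding z z' F_def by (simp add: algebra_simps)
    then have "Y l b * Y' l b * F l = Y l b * (\<phi> l x * Y' l (b - x)) - Y' l b * (\<phi>' l x * Y l (b - x))"
      by (simp only: W diff_self mult_zero_left add_0_right)
    then have "F l = \<phi> l x * Y' l (b - x) / Y' l b - \<phi>' l x * Y l (b - x) / Y l b"
      using nz by (simp add: field_simps)
    then have "cmod (F l) \<le> cmod (\<phi> l x * Y' l (b - x) / Y' l b) + cmod (\<phi>' l x * Y l (b - x) / Y l b)"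
      by (simp only: norm_triangle_ineq4)
    also have "\<dots> \<le> C1 * B4 / c2 / cmod l + C2 * B3 / c1 / cmod l"
      using C B c1(1) c2(1) l1
      by (intro add_mono quotient[OF growth_constant_fundamental(2)[OF G1 l1(1) x \<phi>]
            growth_constant_robin(1)[OF G4 \<alpha>0'(1) l1(1) bx Y', folded B4_def] d']
          quotient[OF growth_constant_fundamental(2)[OF G2 l1(1) x \<phi>']
            growth_constant_robin(1)[OF G3 \<alpha>0(1) l1(1) bx Y, folded B3_def] d]) auto
    finally show ?thesis by (simp add: K_def add_divide_distrib)
  qed
  have strip: "cmod (F l) \<le> 2 * C1 * C2 * exp (M * b) * exp (M * b)" if l: "\<bar>Im l\<bar> \<le> M" and l1: "cmod l \<ge> 1" for l
  proof -
    define E where "E = exp (M * b)"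
    have "\<bar>Im l\<bar> * x \<le> M * b" using l x M by (intro mult_mono) auto
    then have e: "exp (\<bar>Im l\<bar> * x) \<le> E" by (simp add: E_def)
    have q: "A * exp (\<bar>Im l\<bar> * x) / cmod l \<le> A * E" if "A > 0" for A
    proof -
      have "A * exp (\<bar>Im l\<bar> * x) / cmod l \<le> A * exp (\<bar>Im l\<bar> * x) / 1"
        using l1 that by (intro divide_left_mono) auto
      also have "\<dots> \<le> A * E" using e that by simp
      finally show ?thesis .
    qed
    have "cmod (\<theta> l x) \<le> C1 * E" "cmod (\<theta>' l x) \<le> C2 * E" "cmod (\<phi> l x) \<le> C1 * E" "cmod (\<phi>' l x) \<le> C2 * E"
      using order_trans[OF growth_constant_fundamental(1)[OF G1 l1 x \<theta>] mult_left_mono[OF e]]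
        order_trans[OF growth_constant_fundamental(1)[OF G2 l1 x \<theta>'] mult_left_mono[OF e]]
        order_trans[OF growth_constant_fundamental(2)[OF G1 l1 x \<phi>] q]
        order_trans[OF growth_constant_fundamental(2)[OF G2 l1 x \<phi>'] q] C by auto
    then have "cmod (\<phi> l x) * cmod (\<theta>' l x) \<le> (C1 * E) * (C2 * E)" "cmod (\<theta> l x) * cmod (\<phi>' l x) \<le> (C1 * E) * (C2 * E)"
      using C(1) by (auto intro!: mult_mono simp: E_def)
    then have "cmod (F l) \<le> (C1 * E) * (C2 * E) + (C1 * E) * (C2 * E)"
      unfolding F_def norm_mult[symmetric] by (rule norm_triangle_le_diff[OF add_mono])
    then show ?thesis by (simp add: E_def)
  qed
  have holF: "F holomorphic_on UNIV" using hol by (simp add: F_def[abs_def])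
  have "compact (F ` cball 0 1)"
    by (intro compact_continuous_image holomorphic_on_imp_continuous_on holomorphic_on_subset[OF holF]) auto
  then obtain B where B: "\<And>l. cmod l \<le> 1 \<Longrightarrow> cmod (F l) \<le> B"
    using compact_imp_bounded by (fastforce simp: bounded_iff)
  have "bounded (range F)"
    unfolding bounded_iff
  proof (intro exI ballI)
    fix z assume "z \<in> range F"
    then obtain l where z: "z = F l" by blast
    consider "cmod l \<le> 1" | "cmod l \<ge> 1" "\<bar>Im l\<bar> \<le> M" | "\<bar>Im l\<bar> \<ge> M" by linarith
    then have "cmod (F l) \<le> max B (max (2 * C1 * C2 * exp (M * b) * exp (M * b)) K)"
    proof cases
      case 3
      have "cmod l \<ge> 1" using 3 M abs_Im_le_cmod[of l] by linarith
      then have "K / cmod l \<le> K / 1" using K by (intro divide_left_mono) auto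
      then show ?thesis using far[OF 3] by simp
    qed (use B strip in \<open>auto simp: le_max_iff_disj\<close>)
    then show "cmod z \<le> max B (max (2 * C1 * C2 * exp (M * b) * exp (M * b)) K)" by (simp add: z)
  qed
  then obtain k where k: "\<And>l. F l = k"
    using Liouville_theorem[OF holF] by (auto simp: constant_on_def)
  have small: "cmod k \<le> e" if "e > 0" for e
  proof -
    define \<eta> where "\<eta> = max M (K / e)"
    have \<eta>: "\<eta> \<ge> M" "\<eta> \<ge> 1" "\<eta> \<ge> K / e" using M by (auto simp: \<eta>_def)
    have "cmod (F (\<i> * of_real \<eta>)) \<le> K / \<eta>"
      using far[of "\<i> * of_real \<eta>"] \<eta> by (simp add: norm_mult)
    also have "\<dots> \<le> e" using \<eta> that by (simp add: field_simps)
    finally show ?thesis by (simp add: k)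
  qed
  have "cmod k \<le> 0" by (rule field_le_epsilon) (simp add: small)
  then show ?thesis using k[of l] by (simp add: F_def)
qed

text \<open>
  By Lebesgue differentiation, $f$ is almost everywhere a limit of averages over short intervals.
\<close>
lemma ae_zero_if_integrals_zero:
  fixes f :: "real \<Rightarrow> complex"
  assumes z: "\<And>s t. 0 \<le> s \<Longrightarrow> s \<le> t \<Longrightarrow> t \<le> b \<Longrightarrow> (f has_integral 0) {s..t}"
  shows "negligible {x \<in> {0<..<b}. f x \<noteq> 0}"
proof (cases "b > 0")
  case True
  define g where "g x = (if x \<in> {0..b} then f x else 0)" for x
  have "f integrable_on {0..b}" using z[of 0 b] True by auto
  then have "g integrable_on UNIV"
    unfolding g_def by (simp only: integrable_restrict_UNIV)
  then have "g integrable_on cbox c d" for c d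
    by (rule integrable_on_subcbox) auto
  then obtain N where N: "negligible N" "\<And>x e. \<lbrakk>x \<notin> N; 0 < e\<rbrakk> \<Longrightarrow>
      \<exists>d>0. \<forall>h. 0 < h \<and> h < d \<longrightarrow> norm (integral (cbox x (x + h *\<^sub>R One)) g /\<^sub>R h ^ DIM(real) - g x) < e"
    using integrable_ccontinuous_explicit[of g] by blast
  have "{x \<in> {0<..<b}. f x \<noteq> 0} \<subseteq> N"
  proof (rule subsetI, rule ccontr)
    fix x assume x: "x \<in> {x \<in> {0<..<b}. f x \<noteq> 0}" and nN: "x \<notin> N"
    then obtain d where d: "d > 0" "\<And>h. 0 < h \<and> h < d \<Longrightarrow>
        norm (integral (cbox x (x + h *\<^sub>R One)) g /\<^sub>R h ^ DIM(real) - g x) < cmod (f x)"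
      using N(2)[OF nN, of "cmod (f x)"] by auto
    define h where "h = min (d / 2) (b - x)"
    have h: "0 < h" "h < d" "x + h \<le> b" using d x by (auto simp: h_def)
    have "(g has_integral 0) {x..x + h}"
      by (rule has_integral_eq[OF _ z[of x "x + h"]]) (use x h in \<open>auto simp: g_def\<close>)
    then have "integral (cbox x (x + h *\<^sub>R One)) g = 0" by (auto intro: integral_unique)
    then show False using d(2)[of h] h x by (simp add: g_def)
  qed
  then show ?thesis using N(1) negligible_subset by blast
qed simp

text \<open>
  By hypothesis $\varphi/\theta = \tilde\varphi/\tilde\theta$, and the derivatives of the two sides are
  $1/\theta^2$ and $1/\tilde\theta^2$ because the Wronskians are $1$. High on the imaginary
  axis $\theta$ and $\tilde\theta$ have positive real part, so that there is neither a division by zero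
  nor a choice of sign, and one such $l$ suffices.
\<close>
lemma potentials_eq_if_transfer_vanishes:
  assumes P: "potential b P" and P': "potential b P'" and b: "b > 0"
    and \<theta>: "\<And>l. sl_solution b P l 1 0 (\<theta> l) (d\<theta> l)" and \<phi>: "\<And>l. sl_solution b P l 0 1 (\<phi> l) (d\<phi> l)"
    and \<theta>': "\<And>l. sl_solution b P' l 1 0 (\<theta>' l) (d\<theta>' l)" and \<phi>': "\<And>l. sl_solution b P' l 0 1 (\<phi>' l) (d\<phi>' l)"
    and eq: "\<And>l x. x \<in> {0..b} \<Longrightarrow> \<phi> l x * \<theta>' l x = \<theta> l x * \<phi>' l x"
  obtains l where "\<And>x. x \<in> {0..b} \<Longrightarrow> \<theta> l x \<noteq> 0"
    "\<And>x. x \<in> {0..b} \<Longrightarrow> ((\<lambda>t. (P t - P' t) * \<theta> l t) has_integral 0) {0..x}"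
proof -
  obtain C1 C2 where G: "growth_constant b P C1" "growth_constant b P' C2"
    using growth_constant_exists P P' by meson
  have C: "C1 > 0" "C2 > 0" using G by (auto simp: growth_constant_def)
  define \<eta> where "\<eta> = 1 + 4 * C1 + 4 * C2"
  have \<eta>: "\<eta> \<ge> 1" "C1 / \<eta> \<le> 1 / 4" "C2 / \<eta> \<le> 1 / 4" using C by (auto simp: \<eta>_def field_simps)
  define l where "l = \<i> * of_real \<eta>"
  have l: "cmod l = \<eta>" "Im l = \<eta>" using \<eta> by (auto simp: l_def norm_mult)
  \<comment> \<open>On the imaginary axis the cosine is a hyperbolic cosine, which the correction cannot cancel.\<close>
  have pos: "Re (f x) > 0" if x: "x \<in> {0..b}" and f: "cmod (f x - cos (l * of_real x)) \<le> C * exp (\<bar>Im l\<bar> * x) / cmod l"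
    and C: "C / \<eta> \<le> 1 / 4" for f :: "real \<Rightarrow> complex" and C x
  proof -
    have "cos (l * of_real x) = of_real ((exp (\<eta> * x) + exp (- (\<eta> * x))) / 2)"
    proof -
      have "\<i> * (l * of_real x) = - of_real (\<eta> * x)" by (simp add: l_def mult.assoc[symmetric])
      then have "cos (l * of_real x) = (exp (of_real (- (\<eta> * x))) + exp (of_real (\<eta> * x))) / 2"
        unfolding cos_exp_eq by simp
      then show ?thesis by (simp only: exp_of_real of_real_add of_real_divide of_real_numeral add.commute)
    qed
    then have re: "2 * Re (cos (l * of_real x)) = exp (\<eta> * x) + exp (- (\<eta> * x))"
      by (simp only: Re_complex_of_real) simp
    have "Re (cos (l * of_real x)) - Re (f x) \<le> cmod (f x - cos (l * of_real x))"
      using abs_Re_le_cmod[of "f x - cos (l * of_real x)"] by simp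
    also note f
    also have "C * exp (\<bar>Im l\<bar> * x) / cmod l = (C / \<eta>) * exp (\<eta> * x)" using l \<eta> by simp
    also have "(C / \<eta>) * exp (\<eta> * x) \<le> 1 / 4 * exp (\<eta> * x)" using C by (intro mult_right_mono) auto
    finally have le: "4 * (Re (cos (l * of_real x)) - Re (f x)) \<le> exp (\<eta> * x)" by simp
    have "0 < f" if "4 * (c - f) \<le> e" "2 * c = e + e'" "0 < e" "0 < e'" for c f e e' :: real
      using that by argo
    from this[OF le re exp_gt_zero exp_gt_zero] show ?thesis .
  qed
  have \<theta>pos: "Re (\<theta> l x) > 0" if "x \<in> {0..b}" for x
    using pos[of x "\<theta> l" C1] growth_constant_fundamental(3)[OF G(1) _ that \<theta>[of l]] that \<eta> l by simp
  have \<theta>'pos: "Re (\<theta>' l x) > 0" if "x \<in> {0..b}" for x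
    using pos[of x "\<theta>' l" C2] growth_constant_fundamental(3)[OF G(2) _ that \<theta>'[of l]] that \<eta> l by simp
  have nz: "\<theta> l x \<noteq> 0" "\<theta>' l x \<noteq> 0" if "x \<in> {0..b}" for x
    using \<theta>pos[OF that] \<theta>'pos[OF that] by auto
  have wr: "th x * dph x - dth x * ph x = 1"
    if Q: "potential b Q" and th: "sl_solution b Q l 1 0 th dth" and ph: "sl_solution b Q l 0 1 ph dph" and x: "x \<in> {0..b}"
    for Q th dth ph dph x
    using wronskian_identity[OF Q th Q ph x] by (auto dest: has_integral_unique[OF _ has_integral_0])
  have dq: "((\<lambda>t. ph t / th t) has_vector_derivative 1 / (th x)\<^sup>2) (at x within {0..b})"
    if Q: "potential b Q" and th: "sl_solution b Q l 1 0 th dth" and ph: "sl_solution b Q l 0 1 ph dph" and x: "x \<in> {0..b}"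
      and n: "th x \<noteq> 0" for Q th dth ph dph x
  proof -
    have "(ph has_vector_derivative dph x) (at x within {0..b})" "(th has_vector_derivative dth x) (at x within {0..b})"
      using th ph x by (auto simp: sl_solution_def)
    then have "((\<lambda>t. ph t / th t) has_vector_derivative (dph x * th x - ph x * dth x) / (th x * th x)) (at x within {0..b})"
      using n unfolding has_vector_derivative_def
      by (auto intro!: derivative_eq_intros simp: fun_eq_iff field_simps scaleR_conv_of_real)
    moreover have "dph x * th x - ph x * dth x = 1" using wr[OF Q th ph x] by (simp add: algebra_simps)
    ultimately show ?thesis by (simp add: power2_eq_square)
  qed
  have \<theta>eq: "\<theta> l x = \<theta>' l x" if x: "x \<in> {0..b}" for x
  proof -
    have "((\<lambda>t. \<phi>' l t / \<theta>' l t) has_vector_derivative 1 / (\<theta> l x)\<^sup>2) (at x within {0..b})"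
    proof (rule has_vector_derivative_transform[OF x _ dq[OF P \<theta> \<phi> x nz(1)[OF x]]])
      fix t assume t: "t \<in> {0..b}"
      show "\<phi>' l t / \<theta>' l t = \<phi> l t / \<theta> l t" using eq[OF t, of l] nz[OF t] by (simp add: field_simps)
    qed
    from vector_derivative_unique_within_closed_interval[OF b _ this[unfolded box_real[symmetric]] dq[OF P' \<theta>' \<phi>' x nz(2)[OF x], unfolded box_real[symmetric]]]
    have "(\<theta> l x)\<^sup>2 = (\<theta>' l x)\<^sup>2" using x by simp
    then have "\<theta> l x = \<theta>' l x \<or> \<theta> l x = - \<theta>' l x" by (simp add: power2_eq_iff)
    then show ?thesis using \<theta>pos[OF x] \<theta>'pos[OF x] by auto
  qed
  have d\<theta>eq: "d\<theta> l x = d\<theta>' l x" if x: "x \<in> {0..b}" for x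
  proof -
    have "(\<theta> l has_vector_derivative d\<theta> l x) (at x within {0..b})"
      using \<theta>[of l] x by (simp add: sl_solution_def)
    then have "(\<theta>' l has_vector_derivative d\<theta> l x) (at x within {0..b})"
      by (rule has_vector_derivative_transform[OF x, rotated]) (simp add: \<theta>eq)
    moreover have "(\<theta>' l has_vector_derivative d\<theta>' l x) (at x within {0..b})"
      using \<theta>'[of l] x by (simp add: sl_solution_def)
    ultimately show ?thesis
      using vector_derivative_unique_within_closed_interval[of 0 b x "\<theta>' l"] b x by simp
  qed
  show ?thesis
  proof (rule that[of l])
    show "\<theta> l x \<noteq> 0" if "x \<in> {0..b}" for x using nz that by blast
    fix x assume x: "x \<in> {0..b}"
    have "((\<lambda>t. (P t - l\<^sup>2) * \<theta> l t - (P' t - l\<^sup>2) * \<theta>' l t) has_integral (d\<theta> l x - 0) - (d\<theta>' l x - 0)) {0..x}"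
      using \<theta>[of l] \<theta>'[of l] x by (intro has_integral_diff) (simp_all add: sl_solution_def)
    then have "((\<lambda>t. (P t - l\<^sup>2) * \<theta> l t - (P' t - l\<^sup>2) * \<theta>' l t) has_integral 0) {0..x}"
      using d\<theta>eq[OF x] by simp
    then show "((\<lambda>t. (P t - P' t) * \<theta> l t) has_integral 0) {0..x}"
      by (rule has_integral_eq[rotated]) (use x \<theta>eq in \<open>auto simp: algebra_simps\<close>)
  qed
qed

lemma fundamental_solution_exists:
  assumes p: "potential L p" and "L \<ge> 0"
  shows "\<exists>Y D. (\<forall>l. sl_solution L p l u v (Y l) (D l)) \<and> (\<forall>x\<in>{0..L}. (\<lambda>l. Y l x) holomorphic_on UNIV)"
proof (rule sl_solution_exists[OF assms, of u v 0])
  fix Y D :: "complex \<Rightarrow> real \<Rightarrow> complex"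
  assume "\<And>l. sl_solution L p l u (v + 0 * l) (Y l) (D l)" "\<And>x. x \<in> {0..L} \<Longrightarrow> (\<lambda>l. Y l x) holomorphic_on UNIV"
  then show ?thesis by (intro exI[of _ Y] exI[of _ D]) simp
qed

text \<open>
  A local uniqueness theorem of Borg-Marchenko type: proportional data at $b$ for all $l$ determine the
  problem on $(0,b)$. Once the potentials agree, the integral in the Wronskian identity disappears and
  leaves the difference of the two initial slopes, an affine function of $l$.
\<close>
theorem local_uniqueness:
  fixes \<alpha>0 \<alpha>0' b :: real and \<beta>0 \<beta>0' :: complex
  assumes p: "potential b p" and p': "potential b p'" and b: "b > 0"
    and \<alpha>0: "\<alpha>0 \<ge> 0" "\<alpha>0 \<noteq> 1" and \<alpha>0': "\<alpha>0' \<ge> 0" "\<alpha>0' \<noteq> 1"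
    and Y: "\<And>l. sl_solution b p l 1 (\<i> * \<alpha>0 * l + \<beta>0) (Y l) (D l)"
    and Y': "\<And>l. sl_solution b p' l 1 (\<i> * \<alpha>0' * l + \<beta>0') (Y' l) (D' l)"
    and W: "\<And>l. Y l b * D' l b = D l b * Y' l b"
  shows "\<alpha>0 = \<alpha>0' \<and> \<beta>0 = \<beta>0' \<and> negligible {x \<in> {0<..<b}. p x \<noteq> p' x}"
proof -
  note P = potential_reflect[OF p] and P' = potential_reflect[OF p']
  have b0: "b \<ge> 0" using b by simp
  obtain \<theta> d\<theta> where \<theta>: "\<And>l. sl_solution b (\<lambda>t. p (b - t)) l 1 0 (\<theta> l) (d\<theta> l)"
    and h\<theta>: "\<And>x. x \<in> {0..b} \<Longrightarrow> (\<lambda>l. \<theta> l x) holomorphic_on UNIV"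
    using fundamental_solution_exists[OF P b0, of 1 0] by blast
  obtain \<phi> d\<phi> where \<phi>: "\<And>l. sl_solution b (\<lambda>t. p (b - t)) l 0 1 (\<phi> l) (d\<phi> l)"
    and h\<phi>: "\<And>x. x \<in> {0..b} \<Longrightarrow> (\<lambda>l. \<phi> l x) holomorphic_on UNIV"
    using fundamental_solution_exists[OF P b0, of 0 1] by blast
  obtain \<theta>' d\<theta>' where \<theta>': "\<And>l. sl_solution b (\<lambda>t. p' (b - t)) l 1 0 (\<theta>' l) (d\<theta>' l)"
    and h\<theta>': "\<And>x. x \<in> {0..b} \<Longrightarrow> (\<lambda>l. \<theta>' l x) holomorphic_on UNIV"
    using fundamental_solution_exists[OF P' b0, of 1 0] by blast
  obtain \<phi>' d\<phi>' where \<phi>': "\<And>l. sl_solution b (\<lambda>t. p' (b - t)) l 0 1 (\<phi>' l) (d\<phi>' l)"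
    and h\<phi>': "\<And>x. x \<in> {0..b} \<Longrightarrow> (\<lambda>l. \<phi>' l x) holomorphic_on UNIV"
    using fundamental_solution_exists[OF P' b0, of 0 1] by blast
  have "\<phi> l x * \<theta>' l x = \<theta> l x * \<phi>' l x" if x: "x \<in> {0..b}" for l x
    by (rule transfer_entry_vanishes[OF p p' b \<alpha>0 \<alpha>0' Y Y' W \<theta> \<phi> \<theta>' \<phi>' x])
      (intro holomorphic_intros h\<theta> h\<phi> h\<theta>' h\<phi>' x)
  then obtain l where nz: "\<And>x. x \<in> {0..b} \<Longrightarrow> \<theta> l x \<noteq> 0"
    and int: "\<And>x. x \<in> {0..b} \<Longrightarrow> ((\<lambda>t. (p (b - t) - p' (b - t)) * \<theta> l t) has_integral 0) {0..x}"
    using potentials_eq_if_transfer_vanishes[OF P P' b \<theta> \<phi> \<theta>' \<phi>'] by blast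
  define f where "f t = (p (b - t) - p' (b - t)) * \<theta> l t" for t
  have f: "(f has_integral 0) {s..t}" if "0 \<le> s" "s \<le> t" "t \<le> b" for s t
    using has_integral_increment[of b f "\<lambda>_. 0" s t] int that by (simp add: f_def[abs_def])
  have "negligible {x \<in> {0<..<b}. f (b - x) \<noteq> 0}"
  proof (rule ae_zero_if_integrals_zero)
    fix s t assume "0 \<le> s" "s \<le> t" "t \<le> b"
    then show "((\<lambda>x. f (b - x)) has_integral 0) {s..t}"
      using has_integral_reflect_interval[OF f[of "b - t" "b - s"], of b] by simp
  qed
  moreover have "{x \<in> {0<..<b}. f (b - x) \<noteq> 0} = {x \<in> {0<..<b}. p x \<noteq> p' x}"
    using nz by (auto simp: f_def)
  ultimately have neg: "negligible {x \<in> {0<..<b}. p x \<noteq> p' x}" by simp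
  have affine: "\<i> * \<alpha>0' * l + \<beta>0' = \<i> * \<alpha>0 * l + \<beta>0" for l
  proof -
    have "((\<lambda>t. (p' t - p t) * (Y l t * Y' l t)) has_integral
        (Y l b * D' l b - D l b * Y' l b - (1 * (\<i> * \<alpha>0' * l + \<beta>0') - (\<i> * \<alpha>0 * l + \<beta>0) * 1))) {0..b}"
      by (rule wronskian_identity[OF p Y p' Y']) (use b in auto)
    moreover have "((\<lambda>t. (p' t - p t) * (Y l t * Y' l t)) has_integral 0) {0..b}"
    proof (rule has_integral_spike[OF _ _ has_integral_0])
      show "negligible ({x \<in> {0<..<b}. p x \<noteq> p' x} \<union> {0, b})" by (intro negligible_Un neg) auto
    qed auto
    ultimately show ?thesis using W[of l] by (auto dest: has_integral_unique)
  qed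
  have "\<beta>0' = \<beta>0" using affine[of 0] by simp
  moreover have "\<alpha>0' = \<alpha>0" using affine[of 1] \<open>\<beta>0' = \<beta>0\<close> by simp
  ultimately show ?thesis using neg by simp
qed

section \<open>Common zeros of characteristic functions\<close>

text \<open>
  Uniqueness of the solution makes the definite description in the characteristic function meaningful.
\<close>
lemma char_fun_eq:
  assumes "potential a q" "a > 0" "sl_solution a q l 1 (\<i> * \<alpha>0 * l + \<beta>0) y dy"
  shows "char_fun s a q \<alpha>0 \<beta>0 \<alpha> \<beta> l = dy a + (s * \<i> * \<alpha> * l + \<beta>) * y a"
  unfolding char_fun_def
proof (rule the_equality)
  have iff: "ivp_solution a q l c y dy \<longleftrightarrow> sl_solution a q l 1 c y dy" for c y dy
    by (simp add: ivp_solution_def sl_solution_def)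
  show "\<exists>y' dy'. ivp_solution a q l (\<i> * \<alpha>0 * l + \<beta>0) y' dy' \<and>
      dy a + (s * \<i> * \<alpha> * l + \<beta>) * y a = dy' a + (s * \<i> * \<alpha> * l + \<beta>) * y' a"
    using assms(3) iff by blast
  fix d assume "\<exists>y' dy'. ivp_solution a q l (\<i> * \<alpha>0 * l + \<beta>0) y' dy' \<and> d = dy' a + (s * \<i> * \<alpha> * l + \<beta>) * y' a"
  then obtain y' dy' where y': "sl_solution a q l 1 (\<i> * \<alpha>0 * l + \<beta>0) y' dy'"
    and d: "d = dy' a + (s * \<i> * \<alpha> * l + \<beta>) * y' a"
    using iff by blast
  show "d = dy a + (s * \<i> * \<alpha> * l + \<beta>) * y a"
    using sl_solution_unique[OF assms(1) y' assms(3), of a] \<open>a > 0\<close> by (simp add: d)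
qed

text \<open>
  If the function vanished identically, all points of the plane would have the same order, whatever its
  value is, and hence be listed equally often. As the list is not empty, it would contain the
  whole plane, but it is countable.
\<close>
lemma char_fun_not_identically_zero:
  assumes "eigenvalue_numbering s a q \<alpha>0 \<beta>0 \<alpha> \<beta> ev"
  obtains z where "char_fun s a q \<alpha>0 \<beta>0 \<alpha> \<beta> z \<noteq> 0"
proof (rule ccontr)
  assume no: "\<not> thesis"
  define f where "f = char_fun s a q \<alpha>0 \<beta>0 \<alpha> \<beta>"
  have f0: "f z = 0" for z using no that by (auto simp: f_def)
  \<comment> \<open>The order of the zero function is the same arbitrary integer at every point.\<close>
  have none: "\<not> (\<exists>h r. r > 0 \<and> h holomorphic_on cball z r \<and> h z \<noteq> 0 \<and>
      (\<forall>w\<in>cball z r - {z}. f w = h w * (w - z) powi n \<and> h w \<noteq> 0))" for z n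
  proof clarify
    fix h r assume r: "(r::real) > 0" and h: "\<forall>w\<in>cball z r - {z}. f w = h w * (w - z) powi n \<and> h w \<noteq> 0"
    have "z + of_real r \<in> cball z r - {z}" using r by (simp add: dist_norm)
    then have "0 = h (z + of_real r) * (of_real r) powi n \<and> h (z + of_real r) \<noteq> 0"
      using h f0 by (metis add_diff_cancel_left')
    then show False using r by simp
  qed
  have const: "zorder f z = (THE n. False)" for z
    unfolding zorder_def by (simp only: none)
  have cnt: "finite {k \<in> Z1 \<alpha>0 \<alpha>. ev k = z}" "card {k \<in> Z1 \<alpha>0 \<alpha>. ev k = z} = nat (THE n. False)" for z
    using assms f0 const unfolding eigenvalue_numbering_def f_def by auto
  have one: "(1::int) \<in> Z1 \<alpha>0 \<alpha>" by (simp add: Z1_def)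
  then have "1 \<in> {k \<in> Z1 \<alpha>0 \<alpha>. ev k = ev 1}" by simp
  then have "card {k \<in> Z1 \<alpha>0 \<alpha>. ev k = ev 1} > 0"
    using cnt(1)[of "ev 1"] card_gt_0_iff by blast
  then have "card {k \<in> Z1 \<alpha>0 \<alpha>. ev k = z} > 0" for z using cnt(2) by metis
  then have ne: "{k \<in> Z1 \<alpha>0 \<alpha>. ev k = z} \<noteq> {}" for z by (metis card.empty less_irrefl)
  have "UNIV \<subseteq> range ev"
  proof
    fix z show "z \<in> range ev" using ne[of z] by auto
  qed
  moreover have "countable (range ev)" by simp
  ultimately have "countable (UNIV :: complex set)" using countable_subset by blast
  then show False using uncountable_UNIV_complex by blast
qed

text \<open>
  The indices of a subfamily are chosen injectively, so a value is listed at most as often as in the full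
  list of zeros.
\<close>
lemma subfamily_multiplicity:
  assumes fam: "eigenvalue_subfamily s a q \<alpha>0 \<beta>0 \<alpha> \<beta> X" and hol: "char_fun s a q \<alpha>0 \<beta>0 \<alpha> \<beta> holomorphic_on UNIV"
  shows "finite {j \<in> Z1 \<alpha>0 \<alpha>. X j = w}"
    "vanishes_to_order (char_fun s a q \<alpha>0 \<beta>0 \<alpha> \<beta>) w (card {j \<in> Z1 \<alpha>0 \<alpha>. X j = w})"
proof -
  obtain ev k where ev: "eigenvalue_numbering s a q \<alpha>0 \<beta>0 \<alpha> \<beta> ev"
    and k: "inj_on k (Z1 \<alpha>0 \<alpha>)" "k ` Z1 \<alpha>0 \<alpha> \<subseteq> Z1 \<alpha>0 \<alpha>" "\<And>j. j \<in> Z1 \<alpha>0 \<alpha> \<Longrightarrow> X j = ev (k j)"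
    using fam unfolding eigenvalue_subfamily_def by blast
  define f where "f = char_fun s a q \<alpha>0 \<beta>0 \<alpha> \<beta>"
  obtain z0 where z0: "f z0 \<noteq> 0" using char_fun_not_identically_zero[OF ev] unfolding f_def by blast
  have cnt: "finite {i \<in> Z1 \<alpha>0 \<alpha>. ev i = w}" "card {i \<in> Z1 \<alpha>0 \<alpha>. ev i = w} = (if f w = 0 then nat (zorder f w) else 0)"
    using ev unfolding eigenvalue_numbering_def f_def by auto
  have inj: "inj_on k {j \<in> Z1 \<alpha>0 \<alpha>. X j = w}" using k(1) by (rule inj_on_subset) auto
  have sub: "k ` {j \<in> Z1 \<alpha>0 \<alpha>. X j = w} \<subseteq> {i \<in> Z1 \<alpha>0 \<alpha>. ev i = w}"
    using k(2,3) by auto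
  show "finite {j \<in> Z1 \<alpha>0 \<alpha>. X j = w}"
    using finite_subset[OF sub cnt(1)] inj finite_imageD by blast
  have "card {j \<in> Z1 \<alpha>0 \<alpha>. X j = w} \<le> card {i \<in> Z1 \<alpha>0 \<alpha>. ev i = w}"
    by (rule card_inj_on_le[OF inj sub cnt(1)])
  moreover have "vanishes_to_order f w (card {i \<in> Z1 \<alpha>0 \<alpha>. ev i = w})"
    unfolding cnt(2) by (rule vanishes_to_order_zorder[where f = f and ?z0.0 = z0]) (use hol z0 in \<open>simp_all add: f_def\<close>)
  ultimately show "vanishes_to_order (char_fun s a q \<alpha>0 \<beta>0 \<alpha> \<beta>) w (card {j \<in> Z1 \<alpha>0 \<alpha>. X j = w})"
    unfolding f_def[symmetric] by (rule vanishes_to_order_mono[rotated])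
qed

lemma same_family_card:
  assumes "same_family I X J Y"
  shows "card {i \<in> I. X i = w} = card {j \<in> J. Y j = w}"
proof -
  obtain \<sigma> where \<sigma>: "bij_betw \<sigma> I J" "\<And>i. i \<in> I \<Longrightarrow> Y (\<sigma> i) = X i"
    using assms unfolding same_family_def by blast
  have "bij_betw \<sigma> {i \<in> I. X i = w} {j \<in> J. Y j = w}"
  proof (rule bij_betw_subset[OF \<sigma>(1)])
    show "\<sigma> ` {i \<in> I. X i = w} = {j \<in> J. Y j = w}"
      using \<sigma> by (auto simp: bij_betw_def image_iff)
  qed auto
  then show ?thesis by (rule bij_betw_same_card)
qed

text \<open>
  Vanishing data at $a$ would make the reflected solution zero, against the value $1$ at $0$.
\<close>
lemma sl_solution_nonzero_data:
  assumes p: "potential a p" and s: "sl_solution a p l 1 v y dy" and "a \<ge> 0"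
  shows "y a \<noteq> 0 \<or> dy a \<noteq> 0"
proof (rule ccontr)
  assume "\<not> ?thesis"
  then have z: "y a = 0" "dy a = 0" by auto
  have "sl_solution a (\<lambda>t. p (a - t)) l 0 0 (\<lambda>t. y (a - t)) (\<lambda>t. - dy (a - t))"
    using sl_solution_reflect[OF p s \<open>a \<ge> 0\<close>] z by simp
  moreover have "sl_solution a (\<lambda>t. p (a - t)) l 0 0 (\<lambda>t. 0) (\<lambda>t. 0)"
    by (simp add: sl_solution_def)
  ultimately have "y (a - a) = 0"
    using sl_solution_unique(1)[OF potential_reflect[OF p], of l 0 0 "\<lambda>t. y (a - t)" _ "\<lambda>t. 0" _ a] \<open>a \<ge> 0\<close> by auto
  then show False using s by (simp add: sl_solution_def)
qed

text \<open>
  Here \<open>Ep\<close> and \<open>Em\<close> are the characteristic functions of the two signs. Their difference is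
  $2 i \alpha l\, y(a)$, and $y(a) \neq 0$ at an eigenvalue. A common zero is therefore at $l = 0$,
  where the difference has a simple zero, so one of the two orders is at most $1$. In every case the
  larger of the two orders is at least the required one.
\<close>
lemma common_zero_orders:
  fixes Y D Ep Em W :: "complex \<Rightarrow> complex" and \<alpha> :: real
  assumes hol: "Y holomorphic_on UNIV" "W holomorphic_on UNIV" and "\<alpha> \<noteq> 0"
    and Ep: "\<And>z. Ep z = D z + (\<i> * \<alpha> * z + \<beta>) * Y z" and Em: "\<And>z. Em z = D z + (- \<i> * \<alpha> * z + \<beta>) * Y z"
    and nz: "\<And>z. Y z \<noteq> 0 \<or> D z \<noteq> 0"
    and vp: "\<And>w. vanishes_to_order Ep w (np w)" and vm: "\<And>w. vanishes_to_order Em w (nm w)"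
    and wp: "\<And>w. vanishes_to_order W w (np w)" and wm: "\<And>w. vanishes_to_order W w (nm w)"
  shows "w \<noteq> 0 \<Longrightarrow> vanishes_to_order W w (np w + nm w)" "vanishes_to_order W 0 (np 0 + nm 0 - 1)"
proof -
  have zero: "f w = 0" if v: "vanishes_to_order f w n" and n: "n > 0" for f w n
    using v n by (auto simp: vanishes_to_order_def power_0_left)
  have diff: "Ep z - Em z = 2 * \<i> * \<alpha> * z * Y z" for z by (simp add: Ep Em algebra_simps)
  have Ynz: "Y w \<noteq> 0" if "Ep w = 0" for w using nz[of w] that by (auto simp: Ep)
  show "vanishes_to_order W w (np w + nm w)" if w: "w \<noteq> 0" for w
  proof -
    have "np w = 0 \<or> nm w = 0"
    proof (rule ccontr)
      assume "\<not> ?thesis"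
      then have "Ep w = 0" "Em w = 0" using zero[OF vp[of w]] zero[OF vm[of w]] by auto
      then show False using diff[of w] Ynz[of w] w \<open>\<alpha> \<noteq> 0\<close> by simp
    qed
    then show ?thesis using wp[of w] wm[of w] by auto
  qed
  have "np 0 \<le> 1 \<or> nm 0 \<le> 1"
  proof (rule ccontr)
    assume "\<not> ?thesis"
    then have 2: "np 0 \<ge> 2" "nm 0 \<ge> 2" by auto
    then have "Ep 0 = 0" using zero[OF vp[of 0]] by auto
    have "vanishes_to_order (\<lambda>z. 1 * Ep z - 1 * Em z) 0 2"
      by (intro vanishes_to_order_combination vanishes_to_order_mono[OF vp 2(1)] vanishes_to_order_mono[OF vm 2(2)]) auto
    then have "vanishes_to_order (\<lambda>z. 2 * \<i> * \<alpha> * z * Y z) 0 2" using diff by simp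
    moreover have "(\<lambda>z. 2 * \<i> * \<alpha> * Y z) holomorphic_on UNIV" by (intro holomorphic_intros hol)
    ultimately have "2 \<le> (1::nat)"
      by (rule vanishes_to_order_le) (use Ynz[OF \<open>Ep 0 = 0\<close>] \<open>\<alpha> \<noteq> 0\<close> in auto)
    then show False by simp
  qed
  then show "vanishes_to_order W 0 (np 0 + nm 0 - 1)"
  proof
    assume "np 0 \<le> 1" then show ?thesis by (intro vanishes_to_order_mono[OF wm[of 0]]) auto
  next
    assume "nm 0 \<le> 1" then show ?thesis by (intro vanishes_to_order_mono[OF wp[of 0]]) auto
  qed
qed

section \<open>The uniqueness theorem\<close>

lemma AE_lebesgue_on_iff_negligible:
  assumes "S \<in> sets lebesgue"
  shows "(AE x in lebesgue_on S. P x) \<longleftrightarrow> negligible {x \<in> S. \<not> P x}"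
proof -
  have "(AE x in lebesgue_on S. P x) \<longleftrightarrow> (AE x in lebesgue. x \<in> S \<longrightarrow> P x)"
    using assms by (intro AE_restrict_space_iff) auto
  also have "\<dots> \<longleftrightarrow> {x \<in> S. \<not> P x} \<in> null_sets lebesgue"
    by (simp add: completion.AE_iff_null_sets)
  finally show ?thesis by (simp add: negligible_iff_null_sets)
qed

theorem theorem6:
  fixes a b \<alpha> \<alpha>0 \<alpha>0' bp bm bp' bm' :: real
    and \<beta> \<beta>0 \<beta>0' :: complex
    and q q' :: "real \<Rightarrow> complex"
    and Xp Xm Xp' Xm' :: "int \<Rightarrow> complex"
  assumes "a > 0" and "0 < b" and "b < a" and "\<alpha> > 0"
    and "L2_on {0<..<a} q" and "\<alpha>0 \<ge> 0" and "(\<alpha>0 - 1) * (1 - \<alpha>) \<noteq> 0"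
    and "eigenvalue_subfamily 1 a q \<alpha>0 \<beta>0 \<alpha> \<beta> Xp"
    and "eigenvalue_subfamily (-1) a q \<alpha>0 \<beta>0 \<alpha> \<beta> Xm"
    and "bp \<noteq> 0" and "bm \<noteq> 0" and "bp + bm = 2 * b"
    and "(\<lambda>j. cmod (Xp j - a * mu 1 a \<alpha>0 \<alpha> j / bp) / (\<bar>real_of_int j\<bar> + 1)) summable_on Z1 \<alpha>0 \<alpha>"
    and "(\<lambda>j. cmod (Xm j - a * mu (-1) a \<alpha>0 \<alpha> j / bm) / (\<bar>real_of_int j\<bar> + 1)) summable_on Z1 \<alpha>0 \<alpha>"
    and "L2_on {0<..<a} q'" and "\<alpha>0' \<ge> 0" and "(\<alpha>0' - 1) * (1 - \<alpha>) \<noteq> 0"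
    and "eigenvalue_subfamily 1 a q' \<alpha>0' \<beta>0' \<alpha> \<beta> Xp'"
    and "eigenvalue_subfamily (-1) a q' \<alpha>0' \<beta>0' \<alpha> \<beta> Xm'"
    and "bp' \<noteq> 0" and "bm' \<noteq> 0" and "bp' + bm' = 2 * b"
    and "(\<lambda>j. cmod (Xp' j - a * mu 1 a \<alpha>0' \<alpha> j / bp') / (\<bar>real_of_int j\<bar> + 1)) summable_on Z1 \<alpha>0' \<alpha>"
    and "(\<lambda>j. cmod (Xm' j - a * mu (-1) a \<alpha>0' \<alpha> j / bm') / (\<bar>real_of_int j\<bar> + 1)) summable_on Z1 \<alpha>0' \<alpha>"
    and "AE x in lebesgue_on {b<..<a}. q x = q' x"
    and "same_family (Z1 \<alpha>0 \<alpha>) Xp (Z1 \<alpha>0' \<alpha>) Xp'"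
    and "same_family (Z1 \<alpha>0 \<alpha>) Xm (Z1 \<alpha>0' \<alpha>) Xm'"
  shows "\<alpha>0 = \<alpha>0' \<and> \<beta>0 = \<beta>0' \<and> (AE x in lebesgue_on {0<..<b}. q x = q' x)"
proof -
  note a = assms(1) and b = assms(2,3) and \<alpha> = assms(4)
  note fam = assms(8,9) and fam' = assms(18,19)
  have q: "potential a q" and q': "potential a q'"
    using assms(5,15) by (auto intro: L2_on_imp_potential)
  have a0: "a \<ge> 0" and aa: "a \<in> {0..a}" and ba: "b \<in> {0..a}" "b \<le> a" using a b by auto
  obtain Y D where Y: "\<And>l. sl_solution a q l 1 (\<beta>0 + (\<i> * \<alpha>0) * l) (Y l) (D l)"
    and hY: "\<And>x. x \<in> {0..a} \<Longrightarrow> (\<lambda>l. Y l x) holomorphic_on UNIV"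
    and hD: "\<And>x. x \<in> {0..a} \<Longrightarrow> (\<lambda>l. D l x) holomorphic_on UNIV"
    by (rule sl_solution_exists[OF q a0, of 1 \<beta>0 "\<i> * \<alpha>0"], rule that) blast+
  obtain Y' D' where Y': "\<And>l. sl_solution a q' l 1 (\<beta>0' + (\<i> * \<alpha>0') * l) (Y' l) (D' l)"
    and hY': "\<And>x. x \<in> {0..a} \<Longrightarrow> (\<lambda>l. Y' l x) holomorphic_on UNIV"
    and hD': "\<And>x. x \<in> {0..a} \<Longrightarrow> (\<lambda>l. D' l x) holomorphic_on UNIV"
    by (rule sl_solution_exists[OF q' a0, of 1 \<beta>0' "\<i> * \<alpha>0'"], rule that) blast+
  have S: "sl_solution a q l 1 (\<i> * \<alpha>0 * l + \<beta>0) (Y l) (D l)" for l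
    using Y[of l] by (simp add: add.commute)
  have S': "sl_solution a q' l 1 (\<i> * \<alpha>0' * l + \<beta>0') (Y' l) (D' l)" for l
    using Y'[of l] by (simp add: add.commute)
  define E where "E s l = D l a + (of_real s * \<i> * \<alpha> * l + \<beta>) * Y l a" for s :: real and l
  define E' where "E' s l = D' l a + (of_real s * \<i> * \<alpha> * l + \<beta>) * Y' l a" for s :: real and l
  have cE: "char_fun s a q \<alpha>0 \<beta>0 \<alpha> \<beta> = E s" for s
    using char_fun_eq[OF q a S] by (auto simp: E_def)
  have cE': "char_fun s a q' \<alpha>0' \<beta>0' \<alpha> \<beta> = E' s" for s
    using char_fun_eq[OF q' a S'] by (auto simp: E'_def)
  have hE: "E s holomorphic_on UNIV" and hE': "E' s holomorphic_on UNIV" for s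
    unfolding E_def[abs_def] E'_def[abs_def]
    by (intro holomorphic_intros hY[OF aa] hD[OF aa] hY'[OF aa] hD'[OF aa])+
  define W where "W l = Y l a * D' l a - D l a * Y' l a" for l
  have hW: "W holomorphic_on UNIV"
    unfolding W_def[abs_def] by (intro holomorphic_intros hY[OF aa] hD[OF aa] hY'[OF aa] hD'[OF aa])
  have WE: "W l = Y l a * E' s l - Y' l a * E s l" for s l
    by (simp add: W_def E_def E'_def algebra_simps)
  define np where "np w = card {j \<in> Z1 \<alpha>0 \<alpha>. Xp j = w}" for w
  define nm where "nm w = card {j \<in> Z1 \<alpha>0 \<alpha>. Xm j = w}" for w
  note mp = subfamily_multiplicity[OF fam(1), unfolded cE, OF hE, folded np_def]
  note mm = subfamily_multiplicity[OF fam(2), unfolded cE, OF hE, folded nm_def]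
  have mp': "vanishes_to_order (E' 1) w (np w)" for w
    using subfamily_multiplicity(2)[OF fam'(1), unfolded cE', OF hE', of w]
    unfolding np_def same_family_card[OF assms(26)] .
  have mm': "vanishes_to_order (E' (- 1)) w (nm w)" for w
    using subfamily_multiplicity(2)[OF fam'(2), unfolded cE', OF hE', of w]
    unfolding nm_def same_family_card[OF assms(27)] .
  have Wp: "vanishes_to_order W w (np w)" for w
    using vanishes_to_order_combination[OF mp' mp(2) hY[OF aa] hY'[OF aa], of w] unfolding WE[symmetric, abs_def] .
  have Wm: "vanishes_to_order W w (nm w)" for w
    using vanishes_to_order_combination[OF mm' mm(2) hY[OF aa] hY'[OF aa], of w] unfolding WE[symmetric, abs_def] .
  have Ep: "E 1 z = D z a + (\<i> * \<alpha> * z + \<beta>) * Y z a" and Em: "E (- 1) z = D z a + (- \<i> * \<alpha> * z + \<beta>) * Y z a" for z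
    by (simp_all add: E_def)
  have nz: "Y z a \<noteq> 0 \<or> D z a \<noteq> 0" for z by (rule sl_solution_nonzero_data[OF q S a0])
  have "\<alpha> \<noteq> 0" using \<alpha> by simp
  note orders = common_zero_orders[OF hY[OF aa] hW \<open>\<alpha> \<noteq> 0\<close> Ep Em nz mp(2) mm(2) Wp Wm]
  \<comment> \<open>The integrand of the Wronskian identity vanishes almost everywhere on $(b,a)$.\<close>
  have Wb: "W l = Y l b * D' l b - D l b * Y' l b" for l
  proof -
    define f where "f t = (q' t - q t) * (Y l t * Y' l t)" for t
    have fa: "(f has_integral (W l - (1 * (\<i> * \<alpha>0' * l + \<beta>0') - (\<i> * \<alpha>0 * l + \<beta>0) * 1))) {0..a}"
      unfolding f_def[abs_def] W_def by (rule wronskian_identity[OF q S q' S' aa])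
    have fb: "(f has_integral (Y l b * D' l b - D l b * Y' l b - (1 * (\<i> * \<alpha>0' * l + \<beta>0') - (\<i> * \<alpha>0 * l + \<beta>0) * 1))) {0..b}"
      unfolding f_def[abs_def] by (rule wronskian_identity[OF q S q' S' ba(1)])
    have "negligible {x \<in> {b<..<a}. \<not> q x = q' x}"
      using assms(25) by (simp add: AE_lebesgue_on_iff_negligible)
    then have neg: "negligible ({x \<in> {b<..<a}. \<not> q x = q' x} \<union> {b, a})" by (intro negligible_Un) auto
    have "(f has_integral 0) {b..a}"
      by (rule has_integral_spike[OF neg _ has_integral_0]) (auto simp: f_def)
    then have "(f has_integral (Y l b * D' l b - D l b * Y' l b - (1 * (\<i> * \<alpha>0' * l + \<beta>0') - (\<i> * \<alpha>0 * l + \<beta>0) * 1) + 0)) {0..a}"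
      using b by (intro has_integral_combine[OF _ _ fb]) auto
    from has_integral_unique[OF fa this] show ?thesis by simp
  qed
  have qb: "potential b q" "potential b q'" using q q' ba(2) by (auto intro: potential_subinterval)
  have Sb: "sl_solution b q l 1 (\<i> * \<alpha>0 * l + \<beta>0) (Y l) (D l)"
    and Sb': "sl_solution b q' l 1 (\<i> * \<alpha>0' * l + \<beta>0') (Y' l) (D' l)" for l
    by (intro sl_solution_subinterval[OF S ba(2)] sl_solution_subinterval[OF S' ba(2)])+
  obtain G G' where G: "growth_constant b q G" "growth_constant b q' G'"
    using growth_constant_exists qb by meson
  define C where "C = G * (1 + \<alpha>0 + cmod \<beta>0)"
  define C' where "C' = G' * (1 + \<alpha>0' + cmod \<beta>0')"
  have C: "C \<ge> 0" "C' \<ge> 0" using G assms(6,16) by (auto simp: C_def C'_def growth_constant_def)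
  define J where "J = integral {0..b} (\<lambda>t. cmod (q' t - q t))"
  have Ji: "(\<lambda>t. cmod (q' t - q t)) integrable_on {0..b}"
    using absolutely_integrable_norm[OF set_integral_diff(1)[of lebesgue "{0..b}" q' q]] qb
    by (auto simp: potential_def o_def absolutely_integrable_on_def)
  have J0: "J \<ge> 0" unfolding J_def by (rule integral_nonneg[OF Ji]) auto
  define K where "K = max (\<bar>\<alpha>0' - \<alpha>0\<bar> + cmod (\<beta>0' - \<beta>0)) (J * (C * C'))"
  have growth: "cmod (W l) \<le> K * (1 + cmod l + exp (2 * b * \<bar>Im l\<bar>))" if l: "cmod l \<ge> 1" for l
  proof -
    define \<tau> where "\<tau> = \<bar>Im l\<bar>"
    have "((\<lambda>t. (q' t - q t) * (Y l t * Y' l t)) has_integral (W l - (1 * (\<i> * \<alpha>0' * l + \<beta>0') - (\<i> * \<alpha>0 * l + \<beta>0) * 1))) {0..b}"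
      unfolding Wb by (rule wronskian_identity[OF q S q' S' ba(1)])
    then have "cmod (W l - (1 * (\<i> * \<alpha>0' * l + \<beta>0') - (\<i> * \<alpha>0 * l + \<beta>0) * 1)) \<le> J * ((C * exp (\<tau> * b)) * (C' * exp (\<tau> * b)))"
    proof (rule has_integral_norm_le)
      show "((\<lambda>t. cmod (q' t - q t) * ((C * exp (\<tau> * b)) * (C' * exp (\<tau> * b)))) has_integral
          J * ((C * exp (\<tau> * b)) * (C' * exp (\<tau> * b)))) {0..b}"
        unfolding J_def by (intro has_integral_mult_left integrable_integral Ji)
      fix t assume t: "t \<in> {0..b}"
      have "\<tau> * t \<le> \<tau> * b" using t by (intro mult_left_mono) (auto simp: \<tau>_def)
      then have e: "exp (\<tau> * t) \<le> exp (\<tau> * b)" by simp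
      have "cmod (Y l t) \<le> C * exp (\<tau> * b)"
        using order_trans[OF growth_constant_robin(1)[OF G(1) assms(6) l t Sb, folded \<tau>_def C_def] mult_left_mono[OF e]] C by simp
      moreover have "cmod (Y' l t) \<le> C' * exp (\<tau> * b)"
        using order_trans[OF growth_constant_robin(1)[OF G(2) assms(16) l t Sb', folded \<tau>_def C'_def] mult_left_mono[OF e]] C by simp
      ultimately show "cmod ((q' t - q t) * (Y l t * Y' l t)) \<le> cmod (q' t - q t) * ((C * exp (\<tau> * b)) * (C' * exp (\<tau> * b)))"
        unfolding norm_mult using C by (intro mult_left_mono mult_mono) auto
    qed
    also have "\<dots> = J * (C * C') * exp (2 * b * \<tau>)"
    proof -
      have "exp (\<tau> * b) * exp (\<tau> * b) = exp (2 * b * \<tau>)" unfolding mult_exp_exp by (simp add: algebra_simps)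
      then show ?thesis by (metis (no_types, opaque_lifting) mult.assoc mult.left_commute)
    qed
    also have "\<dots> \<le> K * exp (2 * b * \<tau>)" by (intro mult_right_mono) (auto simp: K_def)
    finally have 1: "cmod (W l - (1 * (\<i> * \<alpha>0' * l + \<beta>0') - (\<i> * \<alpha>0 * l + \<beta>0) * 1)) \<le> K * exp (2 * b * \<tau>)" .
    have eq: "1 * (\<i> * \<alpha>0' * l + \<beta>0') - (\<i> * \<alpha>0 * l + \<beta>0) * 1 = \<i> * of_real (\<alpha>0' - \<alpha>0) * l + (\<beta>0' - \<beta>0)"
      by (simp add: algebra_simps)
    have "cmod (\<i> * of_real (\<alpha>0' - \<alpha>0) * l) = \<bar>\<alpha>0' - \<alpha>0\<bar> * cmod l"
      unfolding norm_mult norm_of_real by simp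
    then have "cmod (1 * (\<i> * \<alpha>0' * l + \<beta>0') - (\<i> * \<alpha>0 * l + \<beta>0) * 1) \<le> \<bar>\<alpha>0' - \<alpha>0\<bar> * cmod l + cmod (\<beta>0' - \<beta>0)"
      unfolding eq using norm_triangle_ineq[of "\<i> * of_real (\<alpha>0' - \<alpha>0) * l" "\<beta>0' - \<beta>0"] by linarith
    also have "\<dots> \<le> (\<bar>\<alpha>0' - \<alpha>0\<bar> + cmod (\<beta>0' - \<beta>0)) * (1 + cmod l)"
      by (simp add: algebra_simps add_increasing)
    also have "\<dots> \<le> K * (1 + cmod l)" by (intro mult_right_mono) (auto simp: K_def)
    finally have "cmod (W l) \<le> K * (1 + cmod l) + K * exp (2 * b * \<tau>)"
      using 1 norm_triangle_sub[of "W l" "1 * (\<i> * \<alpha>0' * l + \<beta>0') - (\<i> * \<alpha>0 * l + \<beta>0) * 1"] by linarith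
    then show ?thesis by (simp add: \<tau>_def distrib_left)
  qed
  obtain Cp where Cp: "\<And>R. R \<ge> 1 \<Longrightarrow> \<exists>F. finite F \<and> F \<subseteq> Z1 \<alpha>0 \<alpha> \<and>
      (\<Sum>j\<in>F. ln (R / nz_norm (Xp j))) \<ge> 2 * \<bar>bp\<bar> * R / pi + ln R - Cp"
    by (rule eigenvalue_family_log_sum[OF a assms(10,7,13)], rule that) blast
  obtain Cm where Cm: "\<And>R. R \<ge> 1 \<Longrightarrow> \<exists>F. finite F \<and> F \<subseteq> Z1 \<alpha>0 \<alpha> \<and>
      (\<Sum>j\<in>F. ln (R / nz_norm (Xm j))) \<ge> 2 * \<bar>bm\<bar> * R / pi + ln R - Cm"
    by (rule eigenvalue_family_log_sum[OF a assms(11,7,14)], rule that) blast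
  have types: "\<bar>bp\<bar> + \<bar>bm\<bar> \<ge> 2 * b" using assms(12) by linarith
  have W0: "W l = 0" for l
    by (rule entire_zero_if_too_many_zeros[OF hW b(1) types growth mp(1) mm(1)
          orders(1)[unfolded np_def nm_def] orders(2)[unfolded np_def nm_def] Cp Cm])
  have "\<alpha>0 \<noteq> 1" "\<alpha>0' \<noteq> 1" using assms(7,17) by auto
  then have "\<alpha>0 = \<alpha>0' \<and> \<beta>0 = \<beta>0' \<and> negligible {x \<in> {0<..<b}. q x \<noteq> q' x}"
    using W0 Wb by (intro local_uniqueness[OF qb b(1) assms(6) _ assms(16) _ Sb Sb']) auto
  then show ?thesis by (simp add: AE_lebesgue_on_iff_negligible)
qed

end
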